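(* Let $G$ be a finite group. The Mackey algebra $\mu_{\mathbb Z}(G)$ is a symmetric $\mathbb{Z}$-algebra if and only if $G$ is a square-free group, i.e. $p^2$ does not divide $|G|$ for any prime number $p$.
   Context: Conventions: for $g\in G$ and $H\leqslant G$, ${}^gH=gHg^{-1}$ and $H^g=g^{-1}Hg$. Symmetric algebra: for a commutative ring $R$, an $R$-algebra $A$ is symmetric if it is a finitely generated projective $R$-module and there is an $R$-bilinear form $b$ on $A$ with $b(xy,z)=b(x,yz)$ and $b(x,y)=b(y,x)$ for all $x,y,z\in A$, which is non-degenerate, i.e. $x\mapsto b(x,-)$ is an isomorphism of $R$-modules $A\to \mathrm{Hom}_R(A,R)$. Mackey algebra: $\mu_R(G)$ is the unital associative $R$-algebra with generators $t^K_H$, $r^K_H$, $c_{g,H}$ for $H\leqslant K\leqslant G$, $g\in G$, and relations: $\sum_{H\leqslant G}t^H_H=1$; $t^H_H=r^H_H=c_{h,H}$ for $h\in H$; $t^L_Kt^K_H=t^L_H$ and $r^K_Hr^L_K=r^L_H$ for $H\leqslant K\leqslant L$; $c_{g',{}^gH}c_{g,H}=c_{g'g,H}$; $t^{{}^gK}_{{}^gH}c_{g,H}=c_{g,K}t^K_H$ and $r^{{}^gK}_{{}^gH}c_{g,K}=c_{g,H}r^K_H$ for $H\leqslant K$; $r^H_Lt^H_K=\sum_{h\in[L\backslash H/K]}t^L_{L\cap{}^hK}\,c_{h,L^h\cap K}\,r^K_{L^h\cap K}$ for $L,K\leqslant H$; all other products of generators are zero. *)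

theory Defs
  imports "HOL-Algebra.Algebra"
begin

section \<open>Modules and symmetric algebras\<close>

definition module_hom ::
  "('r, 'm) ring_scheme \<Rightarrow> ('r, 'a, 'n) module_scheme \<Rightarrow> ('r, 'b, 'k) module_scheme \<Rightarrow> ('a \<Rightarrow> 'b) set"
  where
  "module_hom R M N =
    {f \<in> carrier M \<rightarrow>\<^sub>E carrier N.
      (\<forall>x\<in>carrier M. \<forall>y\<in>carrier M. f (x \<oplus>\<^bsub>M\<^esub> y) = f x \<oplus>\<^bsub>N\<^esub> f y) \<and>
      (\<forall>a\<in>carrier R. \<forall>x\<in>carrier M. f (a \<odot>\<^bsub>M\<^esub> x) = a \<odot>\<^bsub>N\<^esub> f x)}"

definition module_iso ::
  "('r, 'm) ring_scheme \<Rightarrow> ('r, 'a, 'n) module_scheme \<Rightarrow> ('r, 'b, 'k) module_scheme \<Rightarrow> ('a \<Rightarrow> 'b) set"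
  where
  "module_iso R M N = {f \<in> module_hom R M N. bij_betw f (carrier M) (carrier N)}"

text \<open>
  The fields \<open>mult\<close> and \<open>one\<close> of a record that is only used as a module play no role;
  they are left undefined.
\<close>

definition regular_module :: "('r, 'm) ring_scheme \<Rightarrow> ('r, 'r) module" where
  "regular_module R =
    \<lparr>carrier = carrier R, monoid.mult = (\<otimes>\<^bsub>R\<^esub>), monoid.one = \<one>\<^bsub>R\<^esub>,
     ring.zero = \<zero>\<^bsub>R\<^esub>, ring.add = ring.add R, smult = (\<otimes>\<^bsub>R\<^esub>)\<rparr>"

definition hom_module ::
  "('r, 'm) ring_scheme \<Rightarrow> ('r, 'a, 'n) module_scheme \<Rightarrow> ('r, 'b, 'k) module_scheme \<Rightarrow> ('r, 'a \<Rightarrow> 'b) module"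
  where
  "hom_module R M N =
    \<lparr>carrier = module_hom R M N, monoid.mult = undefined, monoid.one = undefined,
     ring.zero = (\<lambda>x\<in>carrier M. \<zero>\<^bsub>N\<^esub>),
     ring.add = (\<lambda>f g. \<lambda>x\<in>carrier M. f x \<oplus>\<^bsub>N\<^esub> g x),
     smult = (\<lambda>a f. \<lambda>x\<in>carrier M. a \<odot>\<^bsub>N\<^esub> f x)\<rparr>"

text \<open>The free module with basis \<open>I\<close>: finitely supported functions.\<close>

definition free_module :: "('r, 'm) ring_scheme \<Rightarrow> 'i set \<Rightarrow> ('r, 'i \<Rightarrow> 'r) module" where
  "free_module R I =
    \<lparr>carrier = {f. range f \<subseteq> carrier R \<and> finite {i. f i \<noteq> \<zero>\<^bsub>R\<^esub>} \<and> {i. f i \<noteq> \<zero>\<^bsub>R\<^esub>} \<subseteq> I},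
     monoid.mult = undefined, monoid.one = undefined,
     ring.zero = (\<lambda>i. \<zero>\<^bsub>R\<^esub>),
     ring.add = (\<lambda>f g i. f i \<oplus>\<^bsub>R\<^esub> g i),
     smult = (\<lambda>a f i. a \<otimes>\<^bsub>R\<^esub> f i)\<rparr>"

definition finitely_generated_module ::
  "('r, 'm) ring_scheme \<Rightarrow> ('r, 'a, 'n) module_scheme \<Rightarrow> bool" where
  "finitely_generated_module R M \<longleftrightarrow>
    (\<exists>S. finite S \<and> S \<subseteq> carrier M \<and>
      (\<forall>x\<in>carrier M. \<exists>a\<in>S \<rightarrow> carrier R. x = (\<Oplus>\<^bsub>M\<^esub>s\<in>S. a s \<odot>\<^bsub>M\<^esub> s)))"

text \<open>
  A module is projective if it is a direct summand of a free module.  Index sets inside the type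
  of the module are enough: a projective module \<open>M\<close> is a direct summand of the free module
  on the set \<open>carrier M\<close>.
\<close>

definition projective_module ::
  "('r, 'm) ring_scheme \<Rightarrow> ('r, 'a, 'n) module_scheme \<Rightarrow> bool" where
  "projective_module R M \<longleftrightarrow>
    (\<exists>I :: 'a set. \<exists>i \<in> module_hom R M (free_module R I). \<exists>p \<in> module_hom R (free_module R I) M.
      \<forall>x\<in>carrier M. p (i x) = x)"

text \<open>The locale \<^locale>\<open>algebra\<close> of the library requires commutativity.\<close>

locale assoc_algebra = module R A + ring A for R (structure) and A (structure) +
  assumes smult_mult_left:
    "\<lbrakk>a \<in> carrier R; x \<in> carrier A; y \<in> carrier A\<rbrakk> \<Longrightarrow>
      (a \<odot>\<^bsub>A\<^esub> x) \<otimes>\<^bsub>A\<^esub> y = a \<odot>\<^bsub>A\<^esub> (x \<otimes>\<^bsub>A\<^esub> y)"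
  and smult_mult_right:
    "\<lbrakk>a \<in> carrier R; x \<in> carrier A; y \<in> carrier A\<rbrakk> \<Longrightarrow>
      x \<otimes>\<^bsub>A\<^esub> (a \<odot>\<^bsub>A\<^esub> y) = a \<odot>\<^bsub>A\<^esub> (x \<otimes>\<^bsub>A\<^esub> y)"

definition bilinear_form ::
  "('r, 'm) ring_scheme \<Rightarrow> ('r, 'a, 'n) module_scheme \<Rightarrow> ('a \<Rightarrow> 'a \<Rightarrow> 'r) \<Rightarrow> bool" where
  "bilinear_form R M b \<longleftrightarrow>
    (\<forall>x\<in>carrier M. (\<lambda>y\<in>carrier M. b x y) \<in> module_hom R M (regular_module R)) \<and>
    (\<forall>y\<in>carrier M. (\<lambda>x\<in>carrier M. b x y) \<in> module_hom R M (regular_module R))"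

definition nondegenerate_form ::
  "('r, 'm) ring_scheme \<Rightarrow> ('r, 'a, 'n) module_scheme \<Rightarrow> ('a \<Rightarrow> 'a \<Rightarrow> 'r) \<Rightarrow> bool" where
  "nondegenerate_form R M b \<longleftrightarrow>
    (\<lambda>x\<in>carrier M. \<lambda>y\<in>carrier M. b x y) \<in> module_iso R M (hom_module R M (regular_module R))"

definition symmetric_algebra ::
  "('r, 'm) ring_scheme \<Rightarrow> ('r, 'a, 'n) module_scheme \<Rightarrow> bool" where
  "symmetric_algebra R A \<longleftrightarrow>
    assoc_algebra R A \<and> finitely_generated_module R A \<and> projective_module R A \<and>
    (\<exists>b. bilinear_form R A b \<and>
      (\<forall>x\<in>carrier A. \<forall>y\<in>carrier A. \<forall>z\<in>carrier A. b (x \<otimes>\<^bsub>A\<^esub> y) z = b x (y \<otimes>\<^bsub>A\<^esub> z)) \<and>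
      (\<forall>x\<in>carrier A. \<forall>y\<in>carrier A. b x y = b y x) \<and>
      nondegenerate_form R A b)"


section \<open>Algebras given by generators and relations\<close>

text \<open>
  The free unital associative algebra on \<open>S\<close> is the free module on the words over \<open>S\<close>;
  the product extends concatenation of words.
\<close>

definition free_algebra :: "('r, 'm) ring_scheme \<Rightarrow> 'x set \<Rightarrow> ('r, 'x list \<Rightarrow> 'r) module" where
  "free_algebra R S =
    \<lparr>carrier = carrier (free_module R (lists S)),
     monoid.mult = (\<lambda>f g w. \<Oplus>\<^bsub>R\<^esub>k\<in>{..length w}. f (take k w) \<otimes>\<^bsub>R\<^esub> g (drop k w)),
     monoid.one = (\<lambda>w. if w = [] then \<one>\<^bsub>R\<^esub> else \<zero>\<^bsub>R\<^esub>),
     ring.zero = \<zero>\<^bsub>free_module R (lists S)\<^esub>,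
     ring.add = ring.add (free_module R (lists S)),
     smult = smult (free_module R (lists S))\<rparr>"

definition word :: "('r, 'm) ring_scheme \<Rightarrow> 'x list \<Rightarrow> ('x list \<Rightarrow> 'r)" where
  "word R v = (\<lambda>w. if w = v then \<one>\<^bsub>R\<^esub> else \<zero>\<^bsub>R\<^esub>)"

definition quotient_algebra ::
  "('r, 'a, 'n) module_scheme \<Rightarrow> 'a set \<Rightarrow> ('r, 'a set) module" where
  "quotient_algebra A I =
    \<lparr>carrier = carrier (A Quot I), monoid.mult = monoid.mult (A Quot I), monoid.one = \<one>\<^bsub>A Quot I\<^esub>,
     ring.zero = \<zero>\<^bsub>A Quot I\<^esub>, ring.add = ring.add (A Quot I),
     smult = (\<lambda>a C. \<Union>x\<in>C. I +>\<^bsub>A\<^esub> (a \<odot>\<^bsub>A\<^esub> x))\<rparr>"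

text \<open>A pair \<open>(u, v)\<close> in \<open>rels\<close> stands for the relation \<open>u = v\<close>.\<close>

definition presented_algebra ::
  "('r, 'm) ring_scheme \<Rightarrow> 'x set \<Rightarrow> (('x list \<Rightarrow> 'r) \<times> ('x list \<Rightarrow> 'r)) set
    \<Rightarrow> ('r, ('x list \<Rightarrow> 'r) set) module"
  where
  "presented_algebra R S rels =
    (let F = free_algebra R S
     in quotient_algebra F (Idl\<^bsub>F\<^esub> {u \<ominus>\<^bsub>F\<^esub> v | u v. (u, v) \<in> rels}))"


section \<open>The Mackey algebra\<close>

definition conjugate :: "('g, 'm) monoid_scheme \<Rightarrow> 'g \<Rightarrow> 'g set \<Rightarrow> 'g set" where
  "conjugate G g H = {g \<otimes>\<^bsub>G\<^esub> h \<otimes>\<^bsub>G\<^esub> inv\<^bsub>G\<^esub> g | h. h \<in> H}"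

definition conjugate_right :: "('g, 'm) monoid_scheme \<Rightarrow> 'g set \<Rightarrow> 'g \<Rightarrow> 'g set" where
  "conjugate_right G H g = {inv\<^bsub>G\<^esub> g \<otimes>\<^bsub>G\<^esub> h \<otimes>\<^bsub>G\<^esub> g | h. h \<in> H}"

text \<open>\<open>D\<close> is a set of representatives of the double cosets in \<open>L \ H / K\<close>.\<close>

definition double_coset_reps ::
  "('g, 'm) monoid_scheme \<Rightarrow> 'g set \<Rightarrow> 'g set \<Rightarrow> 'g set \<Rightarrow> 'g set \<Rightarrow> bool" where
  "double_coset_reps G L H K D \<longleftrightarrow>
    D \<subseteq> H \<and> (\<forall>x\<in>H. \<exists>!d. d \<in> D \<and> d \<in> (L #>\<^bsub>G\<^esub> x) <#>\<^bsub>G\<^esub> K)"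

text \<open>
  \<open>Tr K H\<close>, \<open>Res K H\<close>, \<open>Conj g H\<close> are the generators written \<open>t\<close> and \<open>r\<close> (superscript \<open>K\<close>,
  subscript \<open>H\<close>) and \<open>c\<close> (subscript \<open>g, H\<close>).
\<close>

datatype 'g mackey_gen =
    Tr "'g set" "'g set"
  | Res "'g set" "'g set"
  | Conj 'g "'g set"

definition mackey_gens :: "('g, 'm) monoid_scheme \<Rightarrow> 'g mackey_gen set" where
  "mackey_gens G =
    {Tr K H | K H. subgroup H G \<and> subgroup K G \<and> H \<subseteq> K} \<union>
    {Res K H | K H. subgroup H G \<and> subgroup K G \<and> H \<subseteq> K} \<union>
    {Conj g H | g H. g \<in> carrier G \<and> subgroup H G}"

text \<open>
  Every generator goes from one subgroup to another, as the corresponding structure map of a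
  Mackey functor does.  Products are composed from right to left.
\<close>

fun source :: "'g mackey_gen \<Rightarrow> 'g set" where
  "source (Tr K H) = H"
| "source (Res K H) = K"
| "source (Conj g H) = H"

fun target :: "('g, 'm) monoid_scheme \<Rightarrow> 'g mackey_gen \<Rightarrow> 'g set" where
  "target G (Tr K H) = K"
| "target G (Res K H) = H"
| "target G (Conj g H) = conjugate G g H"

text \<open>
  The Mackey formula is imposed for every choice \<open>D\<close> of double coset representatives; by the
  other relations its right-hand side does not depend on the choice.  The products declared to be
  zero are exactly the non-composable ones: a product such as \<open>Tr K H\<close> times \<open>Res L H\<close>
  is composable and is not zero, although it does not occur in any of the preceding relations.
\<close>

inductive_set mackey_relations ::
  "('r, 'm) ring_scheme \<Rightarrow> ('g, 'n) monoid_scheme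
    \<Rightarrow> (('g mackey_gen list \<Rightarrow> 'r) \<times> ('g mackey_gen list \<Rightarrow> 'r)) set"
  for R :: "('r, 'm) ring_scheme" and G :: "('g, 'n) monoid_scheme" where
  unit:
    "(\<Oplus>\<^bsub>free_algebra R (mackey_gens G)\<^esub>H\<in>{H. subgroup H G}. word R [Tr H H],
      \<one>\<^bsub>free_algebra R (mackey_gens G)\<^esub>) \<in> mackey_relations R G"
| tr_self:
    "subgroup H G
      \<Longrightarrow> (word R [Tr H H], word R [Res H H]) \<in> mackey_relations R G"
| conj_self:
    "\<lbrakk>subgroup H G; h \<in> H\<rbrakk>
      \<Longrightarrow> (word R [Res H H], word R [Conj h H]) \<in> mackey_relations R G"
| tr_tr:
    "\<lbrakk>subgroup H G; subgroup K G; subgroup L G; H \<subseteq> K; K \<subseteq> L\<rbrakk>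
      \<Longrightarrow> (word R [Tr L K, Tr K H], word R [Tr L H]) \<in> mackey_relations R G"
| res_res:
    "\<lbrakk>subgroup H G; subgroup K G; subgroup L G; H \<subseteq> K; K \<subseteq> L\<rbrakk>
      \<Longrightarrow> (word R [Res K H, Res L K], word R [Res L H]) \<in> mackey_relations R G"
| conj_conj:
    "\<lbrakk>subgroup H G; g \<in> carrier G; g' \<in> carrier G\<rbrakk>
      \<Longrightarrow> (word R [Conj g' (conjugate G g H), Conj g H], word R [Conj (g' \<otimes>\<^bsub>G\<^esub> g) H])
        \<in> mackey_relations R G"
| tr_conj:
    "\<lbrakk>subgroup H G; subgroup K G; H \<subseteq> K; g \<in> carrier G\<rbrakk>
      \<Longrightarrow> (word R [Tr (conjugate G g K) (conjugate G g H), Conj g H], word R [Conj g K, Tr K H])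
        \<in> mackey_relations R G"
| res_conj:
    "\<lbrakk>subgroup H G; subgroup K G; H \<subseteq> K; g \<in> carrier G\<rbrakk>
      \<Longrightarrow> (word R [Res (conjugate G g K) (conjugate G g H), Conj g K], word R [Conj g H, Res K H])
        \<in> mackey_relations R G"
| mackey_formula:
    "\<lbrakk>subgroup H G; subgroup K G; subgroup L G; L \<subseteq> H; K \<subseteq> H; double_coset_reps G L H K D\<rbrakk>
      \<Longrightarrow> (word R [Res H L, Tr H K],
           \<Oplus>\<^bsub>free_algebra R (mackey_gens G)\<^esub>h\<in>D.
             word R [Tr L (L \<inter> conjugate G h K),
                     Conj h (conjugate_right G L h \<inter> K),
                     Res K (conjugate_right G L h \<inter> K)])
        \<in> mackey_relations R G"
| non_composable:
    "\<lbrakk>x \<in> mackey_gens G; y \<in> mackey_gens G; source x \<noteq> target G y\<rbrakk>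
      \<Longrightarrow> (word R [x, y], \<zero>\<^bsub>free_algebra R (mackey_gens G)\<^esub>) \<in> mackey_relations R G"

definition mackey_algebra ::
  "('r, 'm) ring_scheme \<Rightarrow> ('g, 'n) monoid_scheme
    \<Rightarrow> ('r, ('g mackey_gen list \<Rightarrow> 'r) set) module"
  where
  "mackey_algebra R G = presented_algebra R (mackey_gens G) (mackey_relations R G)"

end

theory Submission
  imports Defs
begin

text \<open>
  The Mackey algebra is the endomorphism algebra of the \<open>G\<close>-set of all left cosets of all subgroups
  in the category of spans of \<open>G\<close>-sets. A closed path of spans is a \<open>G\<close>-set, and the number of its
  orbits with stabilizer conjugate to \<open>L\<close> is a central linear form \<open>\<psi>\<^sub>L\<close> on the algebra; it is obtained
  by Moebius inversion from the traces on the fixed points of the subgroups containing \<open>L\<close>.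

  If the order of \<open>G\<close> is squarefree, then every subgroup \<open>M\<close> has exactly one conjugacy class of
  subgroups of each order dividing \<open>|M|\<close>. Pairing subgroups of order \<open>d\<close> of \<open>M\<close> with subgroups of
  order \<open>|M| / d\<close>, the form \<open>\<psi>\<^sub>1(x y)\<close> becomes unitriangular, which shows at once that the obvious
  generators form a basis and that the form is non-degenerate.

  If \<open>p\<^sup>2\<close> divides \<open>|G|\<close>, let \<open>P\<close> be a subgroup of order \<open>p\<^sup>2\<close>. In the Burnside ring of \<open>G\<close>, the corner
  at \<open>G\<close>, multiplication acts modulo \<open>p\<close> on both \<open>u = G/1\<close> and \<open>v = \<Sum> G/Q\<close> (\<open>Q\<close> running over the
  subgroups of order \<open>p\<close> of \<open>P\<close>) through the mark at \<open>1\<close>. Every central form \<open>\<phi>\<close> therefore kills, modulo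
  \<open>p\<close>, the ideal generated by \<open>u\<close> (if \<open>p\<close> divides \<open>\<phi>(u)\<close>) or by \<open>\<phi>(v) u - \<phi>(u) v\<close>, whereas some \<open>\<psi>\<^sub>L\<close>
  does not vanish modulo \<open>p\<close> there.
\<close>

section \<open>Algebras presented over the integers\<close>

text \<open>The algebra is given by generators and relations only, so at the outset no element is
  known to be nonzero. Everything is therefore detected by linear forms, and a function on words
  descends as soon as it respects every relation in every context. Orbit counts of a given type do
  not multiply along words, but numbers of \<open>Q\<close>-fixed points do: they are the entries of
  a matrix product. This is why traces come first and orbit counts are recovered from them. What
  inversion yields is the number of points with stabilizer exactly \<open>L\<close>; it carries the
  factor |N(L) : L|, which has to be divided out before the value 1, and hence a unimodular form,
  can appear over the integers.

  In the case where p^2 divides the order, v cannot be replaced by a single G/Q: the product of G/Q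
  and G/J contains G/1 with a multiplicity k that need not vanish modulo \<open>p\<close>. The
  number of subgroups of order \<open>p\<close> of \<open>P\<close> is 1 modulo \<open>p\<close>,
  and this makes the sum of these multiplicities over all \<open>Q\<close> divisible by
  \<open>p\<close>.\<close>

definition linear_extension :: "('x \<Rightarrow> int) \<Rightarrow> ('x \<Rightarrow> int) \<Rightarrow> int" where
  "linear_extension F f = (\<Sum>w | f w \<noteq> 0. f w * F w)"

lemma linear_extension_superset:
  assumes "finite C" "{w. f w \<noteq> 0} \<subseteq> C"
  shows "linear_extension F f = (\<Sum>w\<in>C. f w * F w)"
  unfolding linear_extension_def
  by (rule sum.mono_neutral_left) (use assms in auto)

lemma linear_extension_add:
  assumes "finite {w. f w \<noteq> 0}" "finite {w. g w \<noteq> 0}"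
  shows "linear_extension F (\<lambda>w. f w + g w) = linear_extension F f + linear_extension F g"
proof -
  let ?C = "{w. f w \<noteq> 0} \<union> {w. g w \<noteq> 0}"
  have C: "finite ?C" using assms by simp
  have C': "{w. f w + g w \<noteq> 0} \<subseteq> ?C" by (rule subsetI, rule ccontr) simp
  show ?thesis
    unfolding linear_extension_superset[OF C C'] linear_extension_superset[OF C Un_upper1]
      linear_extension_superset[OF C Un_upper2]
    by (simp add: sum.distrib distrib_right)
qed

lemma linear_extension_smult:
  "linear_extension F (\<lambda>w. a * f w) = a * linear_extension F f"
  by (cases "a = 0") (simp_all add: linear_extension_def sum_distrib_left mult.assoc)

lemma linear_extension_delta [simp]:
  "linear_extension F (\<lambda>w. if w = v then 1 else 0) = F v"
  by (simp add: linear_extension_def)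

lemma linear_extension_zero [simp]: "linear_extension F (\<lambda>w. 0) = 0"
  by (simp add: linear_extension_def)

lemma linear_extension_eval:
  assumes "finite {w. f w \<noteq> 0}"
  shows "linear_extension (\<lambda>w. of_bool (w = v)) f = f v"
proof -
  have "linear_extension (\<lambda>w. of_bool (w = v)) f = (\<Sum>w\<in>{w. f w \<noteq> 0}. if w = v then f w else 0)"
    unfolding linear_extension_def by (rule sum.cong) auto
  then show ?thesis using assms by (simp add: sum.delta)
qed

definition convolution :: "('x list \<Rightarrow> int) \<Rightarrow> ('x list \<Rightarrow> int) \<Rightarrow> 'x list \<Rightarrow> int" where
  "convolution f g w = (\<Sum>k\<le>length w. f (take k w) * g (drop k w))"

lemma convolution_support:
  "{w. convolution f g w \<noteq> 0} \<subseteq> (\<lambda>(u, v). u @ v) ` ({u. f u \<noteq> 0} \<times> {v. g v \<noteq> 0})"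
proof
  fix w assume "w \<in> {w. convolution f g w \<noteq> 0}"
  then obtain k where "f (take k w) * g (drop k w) \<noteq> 0"
    using sum.not_neutral_contains_not_neutral[of "\<lambda>k. f (take k w) * g (drop k w)" "{..length w}"]
    unfolding convolution_def by blast
  then show "w \<in> (\<lambda>(u, v). u @ v) ` ({u. f u \<noteq> 0} \<times> {v. g v \<noteq> 0})"
    by (intro image_eqI[of _ _ "(take k w, drop k w)"]) auto
qed

text \<open>Summing over all words and all ways of cutting them is summing over all pairs of words.
  The nested form on the right turns the laws of the product into laws of \<open>@\<close>.\<close>

lemma linear_extension_convolution:
  assumes f: "finite {w. f w \<noteq> 0}" and g: "finite {w. g w \<noteq> 0}"
  shows "linear_extension F (convolution f g) =
    linear_extension (\<lambda>u. linear_extension (\<lambda>v. F (u @ v)) g) f"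
proof -
  let ?A = "{u. f u \<noteq> 0}" and ?B = "{v. g v \<noteq> 0}"
  let ?P = "?A \<times> ?B" and ?app = "\<lambda>(u, v). u @ v"
  let ?C = "?app ` ?P"
  have P: "finite ?P" using f g by simp
  have conv: "convolution f g w = (\<Sum>(u, v)\<in>{p \<in> ?P. ?app p = w}. f u * g v)" for w
  proof -
    \<comment> \<open>The cut position is recovered as the length of the prefix.\<close>
    have inj: "inj_on (\<lambda>k. (take k w, drop k w)) {..length w}"
      by (rule inj_onI) (metis Pair_inject length_take min.absorb2 atMost_iff)
    have "convolution f g w =
        (\<Sum>(u, v)\<in>(\<lambda>k. (take k w, drop k w)) ` {..length w}. f u * g v)"
      by (simp add: convolution_def sum.reindex[OF inj] split_def)
    also have "\<dots> = (\<Sum>(u, v)\<in>{p \<in> ?P. ?app p = w}. f u * g v)"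
    proof (rule sum.mono_neutral_right)
      show "{p \<in> ?P. ?app p = w} \<subseteq> (\<lambda>k. (take k w, drop k w)) ` {..length w}"
      proof clarify
        fix u v show "(u, v) \<in> (\<lambda>k. (take k (u @ v), drop k (u @ v))) ` {..length (u @ v)}"
          by (rule image_eqI[of _ _ "length u"]) auto
      qed
    qed auto
    finally show ?thesis .
  qed
  have "linear_extension F (convolution f g) = (\<Sum>w\<in>?C. convolution f g w * F w)"
    by (rule linear_extension_superset) (use P convolution_support in auto)
  also have "\<dots> = (\<Sum>w\<in>?C. \<Sum>p\<in>{p \<in> ?P. ?app p = w}. f (fst p) * g (snd p) * F (?app p))"
    unfolding conv sum_distrib_right by (intro sum.cong) (auto simp: split_def)
  also have "\<dots> = (\<Sum>p\<in>?P. f (fst p) * g (snd p) * F (?app p))"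
    by (rule sum.group) (use P in auto)
  also have "\<dots> = (\<Sum>u\<in>?A. \<Sum>v\<in>?B. f u * g v * F (u @ v))"
    by (simp add: sum.cartesian_product split_def)
  also have "\<dots> = linear_extension (\<lambda>u. linear_extension (\<lambda>v. F (u @ v)) g) f"
    unfolding linear_extension_def by (simp add: sum_distrib_left mult.assoc)
  finally show ?thesis .
qed

lemma int_free_algebra_simps:
  "carrier (free_algebra \<Z> S) = {f. finite {w. f w \<noteq> 0} \<and> (\<forall>w. f w \<noteq> 0 \<longrightarrow> w \<in> lists S)}"
  "monoid.mult (free_algebra \<Z> S) = convolution"
  "\<one>\<^bsub>free_algebra \<Z> S\<^esub> = word \<Z> []"
  "\<zero>\<^bsub>free_algebra \<Z> S\<^esub> = (\<lambda>w. 0)"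
  "ring.add (free_algebra \<Z> S) = (\<lambda>f g w. f w + g w)"
  "smult (free_algebra \<Z> S) = (\<lambda>a f w. a * f w)"
  unfolding free_algebra_def free_module_def word_def convolution_def
  by (auto simp: int_finsum_eq convolution_def fun_eq_iff)

lemma word_int: "word \<Z> v = (\<lambda>w. if w = v then 1 else 0)"
  by (simp add: word_def cong: if_cong)

lemma linear_extension_word [simp]: "linear_extension F (word \<Z> v) = F v"
  by (simp add: word_int)

lemma word_in_free_algebra: "v \<in> lists S \<Longrightarrow> word \<Z> v \<in> carrier (free_algebra \<Z> S)"
  by (simp add: int_free_algebra_simps word_int)

lemma free_algebra_mult_closed:
  assumes "f \<in> carrier (free_algebra \<Z> S)" "g \<in> carrier (free_algebra \<Z> S)"
  shows "convolution f g \<in> carrier (free_algebra \<Z> S)"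
proof -
  let ?C = "(\<lambda>(u, v). u @ v) ` ({u. f u \<noteq> 0} \<times> {v. g v \<noteq> 0})"
  have "finite ?C" using assms by (auto simp: int_free_algebra_simps)
  moreover have "?C \<subseteq> lists S"
    using assms by (auto simp: int_free_algebra_simps simp del: in_lists_conv_set del: in_listsI)
  ultimately show ?thesis
    using finite_subset[OF convolution_support[of f g]]
      subset_trans[OF convolution_support[of f g]]
    by (simp only: int_free_algebra_simps(1)) blast
qed

text \<open>Coordinates are themselves linear extensions, so testing all \<open>F\<close> suffices.
  Together with \<open>linear_extension_mult\<close> this yields associativity and the unit laws
  without manipulating double sums.\<close>

lemma free_algebra_eqI:
  assumes "f \<in> carrier (free_algebra \<Z> S)" "g \<in> carrier (free_algebra \<Z> S)"
    and "\<And>F. linear_extension F f = linear_extension F g"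
  shows "f = g"
proof
  fix v
  have "f v = linear_extension (\<lambda>w. of_bool (w = v)) f"
    using assms(1) by (simp add: linear_extension_eval int_free_algebra_simps)
  also have "\<dots> = g v"
    unfolding assms(3) using assms(2) by (simp add: linear_extension_eval int_free_algebra_simps)
  finally show "f v = g v" .
qed

lemma linear_extension_mult:
  assumes "f \<in> carrier (free_algebra \<Z> S)" "g \<in> carrier (free_algebra \<Z> S)"
  shows "linear_extension F (convolution f g) =
    linear_extension (\<lambda>u. linear_extension (\<lambda>v. F (u @ v)) g) f"
  using assms by (intro linear_extension_convolution) (auto simp: int_free_algebra_simps)

lemma finite_support_add:
  fixes f g :: "'x \<Rightarrow> int"
  assumes "finite {w. f w \<noteq> 0}" "finite {w. g w \<noteq> 0}"
  shows "finite {w. f w + g w \<noteq> 0}"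
proof -
  have "{w. f w + g w \<noteq> 0} \<subseteq> {w. f w \<noteq> 0} \<union> {w. g w \<noteq> 0}"
    by (rule subsetI, rule ccontr) simp
  then show ?thesis using assms by (simp add: finite_subset)
qed

lemma free_algebra_abelian_group: "abelian_group (free_algebra \<Z> S)"
proof (rule abelian_groupI)
  fix f assume "f \<in> carrier (free_algebra \<Z> S)"
  then show "\<exists>g\<in>carrier (free_algebra \<Z> S). g \<oplus>\<^bsub>free_algebra \<Z> S\<^esub> f = \<zero>\<^bsub>free_algebra \<Z> S\<^esub>"
    by (intro bexI[of _ "\<lambda>w. - f w"]) (auto simp: int_free_algebra_simps)
next
  fix f g assume "f \<in> carrier (free_algebra \<Z> S)" "g \<in> carrier (free_algebra \<Z> S)"
  then show "f \<oplus>\<^bsub>free_algebra \<Z> S\<^esub> g \<in> carrier (free_algebra \<Z> S)"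
    unfolding int_free_algebra_simps(1,5) mem_Collect_eq
    by (intro conjI finite_support_add) (simp, simp, metis add_0)
qed (auto simp: int_free_algebra_simps algebra_simps)

lemma free_algebra_ring: "ring (free_algebra \<Z> S)"
proof -
  let ?F = "free_algebra \<Z> S"
  have mc: "convolution f g \<in> carrier ?F" if "f \<in> carrier ?F" "g \<in> carrier ?F" for f g
    using free_algebra_mult_closed that .
  have one: "word \<Z> [] \<in> carrier ?F" by (rule word_in_free_algebra) simp
  show ?thesis
  proof (rule ringI)
    show "Group.monoid ?F"
    proof (rule monoidI)
      fix f g h assume fgh: "f \<in> carrier ?F" "g \<in> carrier ?F" "h \<in> carrier ?F"
      show "f \<otimes>\<^bsub>?F\<^esub> g \<otimes>\<^bsub>?F\<^esub> h = f \<otimes>\<^bsub>?F\<^esub> (g \<otimes>\<^bsub>?F\<^esub> h)"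
        unfolding int_free_algebra_simps(2)
        by (rule free_algebra_eqI[where S = S])
          (use fgh in \<open>simp_all add: mc linear_extension_mult[where S = S]\<close>)
    next
      fix f assume f: "f \<in> carrier ?F"
      show "\<one>\<^bsub>?F\<^esub> \<otimes>\<^bsub>?F\<^esub> f = f" "f \<otimes>\<^bsub>?F\<^esub> \<one>\<^bsub>?F\<^esub> = f"
        unfolding int_free_algebra_simps(2,3)
        by (rule free_algebra_eqI[where S = S];
            use f in \<open>simp add: mc one linear_extension_mult[where S = S]\<close>)+
    qed (use mc one in \<open>simp_all add: int_free_algebra_simps(2,3)\<close>)
  qed (auto simp: free_algebra_abelian_group int_free_algebra_simps(2,5) convolution_def
        sum.distrib algebra_simps fun_eq_iff)
qed

lemma free_algebra_assoc_algebra: "assoc_algebra \<Z> (free_algebra \<Z> S)"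
proof -
  let ?F = "free_algebra \<Z> S"
  have "module \<Z> ?F"
    by (rule moduleI)
      (auto simp: free_algebra_abelian_group int_is_cring int_free_algebra_simps algebra_simps
        fun_eq_iff)
  then show ?thesis
    unfolding assoc_algebra_def assoc_algebra_axioms_def
    using free_algebra_ring[of S]
    by (auto simp: int_free_algebra_simps convolution_def sum_distrib_left algebra_simps fun_eq_iff)
qed

lemma convolution_word:
  "convolution (word \<Z> u) (word \<Z> v) = word \<Z> (u @ v)"
\<comment> \<open>The equation does not mention an alphabet, so the largest one is taken.\<close>
proof (rule free_algebra_eqI[where S = UNIV])
  show "convolution (word \<Z> u) (word \<Z> v) \<in> carrier (free_algebra \<Z> UNIV)"
    by (intro free_algebra_mult_closed word_in_free_algebra) auto
  show "word \<Z> (u @ v) \<in> carrier (free_algebra \<Z> UNIV)"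
    by (intro word_in_free_algebra) auto
next
  fix F :: "'a list \<Rightarrow> int"
  have "linear_extension F (convolution (word \<Z> u) (word \<Z> v)) =
    linear_extension (\<lambda>u. linear_extension (\<lambda>v. F (u @ v)) (word \<Z> v)) (word \<Z> u)"
    by (rule linear_extension_mult[where S = UNIV]) (auto intro!: word_in_free_algebra)
  then show "linear_extension F (convolution (word \<Z> u) (word \<Z> v)) = linear_extension F (word \<Z> (u @ v))"
    by simp
qed

subsection \<open>Quotients\<close>

context assoc_algebra begin

text \<open>A scalar acts as multiplication by its multiple of the unit. Hence the ideal generated
  by the relations in the sense of rings is an ideal in the sense of algebras.\<close>

lemma ideal_smult_closed:
  assumes "ideal I A" "a \<in> carrier R" "x \<in> I"
  shows "a \<odot>\<^bsub>A\<^esub> x \<in> I"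
proof -
  interpret I: ideal I A by fact
  have x: "x \<in> carrier A" using assms(3) by (rule I.a_Hcarr)
  have "a \<odot>\<^bsub>A\<^esub> x = (a \<odot>\<^bsub>A\<^esub> \<one>\<^bsub>A\<^esub>) \<otimes>\<^bsub>A\<^esub> x"
    using assms(2) x by (simp add: smult_mult_left)
  then show ?thesis using assms x by (simp add: I.I_l_closed)
qed

text \<open>The union in the definition of \<open>quotient_algebra\<close> ranges over one and the
  same coset, repeated for every representative.\<close>

lemma quotient_smult:
  assumes "ideal I A" "a \<in> carrier R" "x \<in> carrier A"
  shows "a \<odot>\<^bsub>quotient_algebra A I\<^esub> (I +>\<^bsub>A\<^esub> x) = I +>\<^bsub>A\<^esub> (a \<odot>\<^bsub>A\<^esub> x)"
proof -
  interpret I: ideal I A by fact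
  have "I +>\<^bsub>A\<^esub> (a \<odot>\<^bsub>A\<^esub> y) = I +>\<^bsub>A\<^esub> (a \<odot>\<^bsub>A\<^esub> x)" if y: "y \<in> I +>\<^bsub>A\<^esub> x" for y
  proof -
    obtain i where i: "i \<in> I" "y = i \<oplus>\<^bsub>A\<^esub> x"
      using y by (auto simp: a_r_coset_def')
    have "i \<in> carrier A" using i(1) by (rule I.a_Hcarr)
    then have "a \<odot>\<^bsub>A\<^esub> y = a \<odot>\<^bsub>A\<^esub> i \<oplus>\<^bsub>A\<^esub> a \<odot>\<^bsub>A\<^esub> x"
      using i assms by (simp add: smult_r_distr)
    then have "a \<odot>\<^bsub>A\<^esub> y \<in> I +>\<^bsub>A\<^esub> (a \<odot>\<^bsub>A\<^esub> x)"
      using ideal_smult_closed[OF assms(1,2) i(1)] by (auto simp: a_r_coset_def')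
    then show ?thesis
      by (rule I.a_repr_independence'[OF _ smult_closed[OF assms(2,3)], symmetric])
  qed
  moreover have "x \<in> I +>\<^bsub>A\<^esub> x" using I.a_rcos_self assms(3) by blast
  ultimately have "(\<Union>y\<in>I +>\<^bsub>A\<^esub> x. I +>\<^bsub>A\<^esub> (a \<odot>\<^bsub>A\<^esub> y)) = I +>\<^bsub>A\<^esub> (a \<odot>\<^bsub>A\<^esub> x)"
    by (intro UN_constant_eq ballI)
  then show ?thesis by (simp add: quotient_algebra_def)
qed

lemma quotient_carrier: "carrier (quotient_algebra A I) = (\<lambda>x. I +>\<^bsub>A\<^esub> x) ` carrier A"
  by (auto simp: quotient_algebra_def FactRing_def A_RCOSETS_defs a_r_coset_def r_coset_def)

lemma quotient_ops:
  assumes "ideal I A" "x \<in> carrier A" "y \<in> carrier A"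
  shows "(I +>\<^bsub>A\<^esub> x) \<otimes>\<^bsub>quotient_algebra A I\<^esub> (I +>\<^bsub>A\<^esub> y) = I +>\<^bsub>A\<^esub> (x \<otimes>\<^bsub>A\<^esub> y)"
    "(I +>\<^bsub>A\<^esub> x) \<oplus>\<^bsub>quotient_algebra A I\<^esub> (I +>\<^bsub>A\<^esub> y) = I +>\<^bsub>A\<^esub> (x \<oplus>\<^bsub>A\<^esub> y)"
proof -
  interpret I: ideal I A by fact
  show "(I +>\<^bsub>A\<^esub> x) \<otimes>\<^bsub>quotient_algebra A I\<^esub> (I +>\<^bsub>A\<^esub> y) = I +>\<^bsub>A\<^esub> (x \<otimes>\<^bsub>A\<^esub> y)"
    "(I +>\<^bsub>A\<^esub> x) \<oplus>\<^bsub>quotient_algebra A I\<^esub> (I +>\<^bsub>A\<^esub> y) = I +>\<^bsub>A\<^esub> (x \<oplus>\<^bsub>A\<^esub> y)"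
    using assms by (auto simp: quotient_algebra_def FactRing_def I.rcoset_mult_add I.a_rcos_sum)
qed

lemma quotient_ring:
  assumes "ideal I A"
  shows "ring (quotient_algebra A I)"
proof -
  interpret Q: ring "A Quot I" using assms by (rule ideal.quotient_is_ring)
  show ?thesis
  proof (rule ringI)
    show "abelian_group (quotient_algebra A I)"
    proof (rule abelian_groupI)
      fix x assume "x \<in> carrier (quotient_algebra A I)"
      then have "x \<in> carrier (A Quot I)" by (simp add: quotient_algebra_def)
      then show "\<exists>y\<in>carrier (quotient_algebra A I). y \<oplus>\<^bsub>quotient_algebra A I\<^esub> x = \<zero>\<^bsub>quotient_algebra A I\<^esub>"
        by (intro bexI[of _ "\<ominus>\<^bsub>A Quot I\<^esub> x"]) (simp_all add: quotient_algebra_def Q.l_neg)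
    qed (auto simp: quotient_algebra_def Q.add.m_ac)
    show "Group.monoid (quotient_algebra A I)"
      by (rule monoidI) (auto simp: quotient_algebra_def Q.m_assoc)
  qed (auto simp: quotient_algebra_def Q.l_distr Q.r_distr)
qed

lemma quotient_assoc_algebra:
  assumes "ideal I A"
  shows "assoc_algebra R (quotient_algebra A I)"
proof -
  interpret Q: ring "quotient_algebra A I" using assms by (rule quotient_ring)
  have "module R (quotient_algebra A I)"
    by (rule moduleI)
      (auto simp: quotient_carrier quotient_smult[OF assms] quotient_ops[OF assms] R.is_cring
        Q.is_abelian_group smult_l_distr smult_r_distr smult_assoc1)
  then show ?thesis
    unfolding assoc_algebra_def assoc_algebra_axioms_def
    using Q.ring_axioms by (auto simp: quotient_carrier quotient_smult[OF assms]
        quotient_ops[OF assms] smult_mult_left smult_mult_right)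
qed

end

section \<open>Linear forms on an algebra given by generators and relations\<close>

lemma linear_extension_cong:
  "(\<And>w. f w \<noteq> 0 \<Longrightarrow> F w = F' w) \<Longrightarrow> linear_extension F f = linear_extension F' f"
  unfolding linear_extension_def by (rule sum.cong) auto

lemma free_algebra_minus:
  assumes "f \<in> carrier (free_algebra \<Z> S)"
  shows "\<ominus>\<^bsub>free_algebra \<Z> S\<^esub> f = (\<lambda>w. - f w)"
proof -
  interpret F: ring "free_algebra \<Z> S" by (rule free_algebra_ring)
  have "(\<lambda>w. - f w) \<in> carrier (free_algebra \<Z> S)" using assms by (simp add: int_free_algebra_simps)
  moreover have "(\<lambda>w. - f w) \<oplus>\<^bsub>free_algebra \<Z> S\<^esub> f = \<zero>\<^bsub>free_algebra \<Z> S\<^esub>"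
    by (simp add: int_free_algebra_simps)
  ultimately show ?thesis using assms by (intro F.minus_equality)
qed

lemma linear_extension_diff:
  assumes "f \<in> carrier (free_algebra \<Z> S)" "g \<in> carrier (free_algebra \<Z> S)"
  shows "linear_extension F (f \<ominus>\<^bsub>free_algebra \<Z> S\<^esub> g) = linear_extension F f - linear_extension F g"
proof -
  have "f \<ominus>\<^bsub>free_algebra \<Z> S\<^esub> g = (\<lambda>w. f w + (- 1) * g w)"
    using assms(2) by (simp add: a_minus_def free_algebra_minus) (simp add: int_free_algebra_simps)
  moreover have "finite {w. (- 1) * g w \<noteq> 0}" "finite {w. f w \<noteq> 0}"
    using assms by (simp_all add: int_free_algebra_simps)
  ultimately show ?thesis
    by (simp only: linear_extension_add linear_extension_smult)
qed

text \<open>The contexts \<open>u\<close> and \<open>v\<close> make this the largest two-sided ideal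
  on which the linear extension of \<open>F\<close> vanishes. By minimality, the ideal generated by
  a set of differences lies in it as soon as the differences do.\<close>

lemma annihilator_ideal:
  fixes F :: "'x list \<Rightarrow> int"
  shows "ideal {f \<in> carrier (free_algebra \<Z> S).
    \<forall>u\<in>lists S. \<forall>v\<in>lists S. linear_extension (\<lambda>w. F (u @ w @ v)) f = 0} (free_algebra \<Z> S)"
    (is "ideal ?J ?F")
proof -
  interpret F: ring ?F by (rule free_algebra_ring)
  have fin: "finite {w. f w \<noteq> 0}" if "f \<in> carrier ?F" for f
    using that by (simp add: int_free_algebra_simps)
  show ?thesis
  proof (rule idealI)
    show "subgroup ?J (add_monoid ?F)"
    proof (rule group.subgroupI[OF F.a_group])
      show "?J \<noteq> {}" using F.zero_closed
        by (auto intro!: exI[of _ "\<zero>\<^bsub>?F\<^esub>"]) (simp add: int_free_algebra_simps)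
      show "inv\<^bsub>add_monoid ?F\<^esub> f \<in> ?J" if "f \<in> ?J" for f
      proof -
        have f: "f \<in> carrier ?F" using that by simp
        have "inv\<^bsub>add_monoid ?F\<^esub> f = (\<lambda>w. (- 1) * f w)"
          using free_algebra_minus[OF f] by (simp add: a_inv_def)
        moreover have "(\<lambda>w. (- 1) * f w) \<in> carrier ?F"
          using f by (simp add: int_free_algebra_simps)
        ultimately show ?thesis
          using that by (simp only: mem_Collect_eq linear_extension_smult) simp
      qed
      show "f \<otimes>\<^bsub>add_monoid ?F\<^esub> g \<in> ?J" if "f \<in> ?J" "g \<in> ?J" for f g
        using that F.a_closed[of f g] by (simp add: int_free_algebra_simps(5) linear_extension_add fin)
    qed (use F.zero_closed in auto)
  next
    fix f g assume "f \<in> ?J" and g: "g \<in> carrier ?F"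
    then have f: "f \<in> carrier ?F"
      and z: "\<And>u v. u \<in> lists S \<Longrightarrow> v \<in> lists S \<Longrightarrow> linear_extension (\<lambda>w. F (u @ w @ v)) f = 0"
      by auto
    have gS: "\<And>w. g w \<noteq> 0 \<Longrightarrow> w \<in> lists S" using g by (simp add: int_free_algebra_simps)
    have zero: "linear_extension (\<lambda>w. 0 :: int) h = 0" for h :: "'x list \<Rightarrow> int"
      by (simp add: linear_extension_def)
    have swap: "linear_extension (\<lambda>x. linear_extension (\<lambda>y. H x y) g) f =
        linear_extension (\<lambda>y. linear_extension (\<lambda>x. H x y) f) g" for H
      unfolding linear_extension_def sum_distrib_left
      by (subst sum.swap) (simp add: mult.left_commute)
    show "g \<otimes>\<^bsub>?F\<^esub> f \<in> ?J"
      unfolding mem_Collect_eq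
    proof (intro conjI ballI F.m_closed f g)
      fix u v assume uv: "u \<in> lists S" "v \<in> lists S"
      have "linear_extension (\<lambda>w. F (u @ w @ v)) (convolution g f) =
        linear_extension (\<lambda>p. linear_extension (\<lambda>q. F ((u @ p) @ q @ v)) f) g"
        using linear_extension_mult[OF g f] by simp
      also have "\<dots> = linear_extension (\<lambda>p. 0) g"
        by (rule linear_extension_cong, rule z) (use uv gS in \<open>simp_all del: in_lists_conv_set\<close>)
      finally show "linear_extension (\<lambda>w. F (u @ w @ v)) (g \<otimes>\<^bsub>?F\<^esub> f) = 0"
        by (simp add: zero int_free_algebra_simps(2))
    qed
    show "f \<otimes>\<^bsub>?F\<^esub> g \<in> ?J"
      unfolding mem_Collect_eq
    proof (intro conjI ballI F.m_closed f g)
      fix u v assume uv: "u \<in> lists S" "v \<in> lists S"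
      have "linear_extension (\<lambda>w. F (u @ w @ v)) (convolution f g) =
        linear_extension (\<lambda>p. linear_extension (\<lambda>q. F (u @ p @ (q @ v))) g) f"
        using linear_extension_mult[OF f g] by simp
      also have "\<dots> = linear_extension (\<lambda>q. linear_extension (\<lambda>p. F (u @ p @ (q @ v))) f) g"
        by (rule swap)
      also have "\<dots> = linear_extension (\<lambda>p. 0) g"
        by (rule linear_extension_cong, rule z) (use uv gS in \<open>simp_all del: in_lists_conv_set\<close>)
      finally show "linear_extension (\<lambda>w. F (u @ w @ v)) (f \<otimes>\<^bsub>?F\<^esub> g) = 0"
        by (simp add: zero int_free_algebra_simps(2))
    qed
  qed (rule F.ring_axioms)
qed

lemma free_algebra_induct [consumes 1, case_names word add smult]:
  assumes f: "f \<in> carrier (free_algebra \<Z> S)"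
    and word: "\<And>w. w \<in> lists S \<Longrightarrow> P (word \<Z> w)"
    and add: "\<And>f g. \<lbrakk>f \<in> carrier (free_algebra \<Z> S); g \<in> carrier (free_algebra \<Z> S); P f; P g\<rbrakk>
      \<Longrightarrow> P (\<lambda>w. f w + g w)"
    and smult: "\<And>a f. \<lbrakk>f \<in> carrier (free_algebra \<Z> S); P f\<rbrakk> \<Longrightarrow> P (\<lambda>w. a * f w)"
  shows "P f"
proof -
  have "P f" if "finite C" "C \<subseteq> lists S" "{w. f w \<noteq> 0} \<subseteq> C" for C and f :: "'a list \<Rightarrow> int"
    using that
  proof (induction C arbitrary: f)
    case empty
    then have "f = (\<lambda>w. 0 * word \<Z> [] w)" by auto
    then show ?case using smult[of "word \<Z> []" 0] word[of "[]"] word_in_free_algebra[of "[]" S]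
      by (simp only: lists.Nil)
  next
    case (insert v C)
    let ?g = "\<lambda>w. f v * word \<Z> v w" and ?h = "f(v := 0)"
    have v: "v \<in> lists S" using insert.prems by simp
    have "{w. ?h w \<noteq> 0} \<subseteq> C" using insert.prems by auto
    then have "P ?h" "?h \<in> carrier (free_algebra \<Z> S)"
      using insert finite_subset[of "{w. ?h w \<noteq> 0}" C] by (auto simp: int_free_algebra_simps)
    moreover have "P ?g" "?g \<in> carrier (free_algebra \<Z> S)"
      using smult[OF word_in_free_algebra[OF v] word[OF v]] word_in_free_algebra[OF v]
      by (simp_all add: int_free_algebra_simps)
    ultimately have "P (\<lambda>w. ?g w + ?h w)" using add by blast
    moreover have "(\<lambda>w. ?g w + ?h w) = f" by (auto simp: word_int)
    ultimately show ?case by simp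
  qed
  from this[of "{w. f w \<noteq> 0}" f] f show ?thesis by (auto simp: int_free_algebra_simps)
qed

locale int_presentation =
  fixes S :: "'x set" and rels :: "(('x list \<Rightarrow> int) \<times> ('x list \<Rightarrow> int)) set"
  assumes relations_closed:
    "rels \<subseteq> carrier (free_algebra \<Z> S) \<times> carrier (free_algebra \<Z> S)"
begin

abbreviation A :: "(int, ('x list \<Rightarrow> int) set) module" where
  "A \<equiv> presented_algebra \<Z> S rels"

abbreviation F :: "(int, 'x list \<Rightarrow> int) module" where
  "F \<equiv> free_algebra \<Z> S"

definition relation_ideal :: "('x list \<Rightarrow> int) set" where
  "relation_ideal = Idl\<^bsub>F\<^esub> {u \<ominus>\<^bsub>F\<^esub> v | u v. (u, v) \<in> rels}"

definition cls :: "('x list \<Rightarrow> int) \<Rightarrow> ('x list \<Rightarrow> int) set" where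
  "cls f = relation_ideal +>\<^bsub>F\<^esub> f"

definition wd :: "'x list \<Rightarrow> ('x list \<Rightarrow> int) set" where
  "wd w = cls (word \<Z> w)"

lemma presented_algebra_eq: "A = quotient_algebra F relation_ideal"
  by (simp add: presented_algebra_def relation_ideal_def Let_def)

sublocale F: assoc_algebra \<Z> F by (rule free_algebra_assoc_algebra)

lemma differences_closed: "{u \<ominus>\<^bsub>F\<^esub> v | u v. (u, v) \<in> rels} \<subseteq> carrier F"
  using relations_closed F.minus_closed by blast

lemma ideal: "ideal relation_ideal F"
  unfolding relation_ideal_def by (intro F.genideal_ideal differences_closed)

sublocale A: assoc_algebra \<Z> A
  unfolding presented_algebra_eq by (intro F.quotient_assoc_algebra ideal)

lemma carrier_A: "carrier A = cls ` carrier F"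
  unfolding presented_algebra_eq F.quotient_carrier cls_def ..

lemma cls_closed: "f \<in> carrier F \<Longrightarrow> cls f \<in> carrier A"
  by (simp add: carrier_A)

lemma cls_mult: "\<lbrakk>f \<in> carrier F; g \<in> carrier F\<rbrakk> \<Longrightarrow> cls f \<otimes>\<^bsub>A\<^esub> cls g = cls (f \<otimes>\<^bsub>F\<^esub> g)"
  unfolding presented_algebra_eq cls_def by (rule F.quotient_ops[OF ideal])

lemma cls_add: "\<lbrakk>f \<in> carrier F; g \<in> carrier F\<rbrakk> \<Longrightarrow> cls f \<oplus>\<^bsub>A\<^esub> cls g = cls (f \<oplus>\<^bsub>F\<^esub> g)"
  unfolding presented_algebra_eq cls_def by (rule F.quotient_ops[OF ideal])

lemma cls_smult: "f \<in> carrier F \<Longrightarrow> a \<odot>\<^bsub>A\<^esub> cls f = cls (a \<odot>\<^bsub>F\<^esub> f)"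
  unfolding presented_algebra_eq cls_def by (rule F.quotient_smult[OF ideal]) simp

lemma cls_one: "cls \<one>\<^bsub>F\<^esub> = \<one>\<^bsub>A\<^esub>"
  unfolding presented_algebra_eq cls_def by (simp add: quotient_algebra_def FactRing_def)

lemma cls_zero: "cls \<zero>\<^bsub>F\<^esub> = \<zero>\<^bsub>A\<^esub>"
  using cls_smult[of "\<zero>\<^bsub>F\<^esub>" 0] A.smult_l_null[OF cls_closed, of "\<zero>\<^bsub>F\<^esub>"] by simp

lemma cls_finsum:
  "h \<in> D \<rightarrow> carrier F \<Longrightarrow> cls (\<Oplus>\<^bsub>F\<^esub>i\<in>D. h i) = (\<Oplus>\<^bsub>A\<^esub>i\<in>D. cls (h i))"
  by (induction D rule: infinite_finite_induct)
    (simp_all add: cls_zero Pi_def cls_add[symmetric] cls_closed)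

lemma relation_cls: "(u, v) \<in> rels \<Longrightarrow> cls u = cls v"
proof -
  assume uv: "(u, v) \<in> rels"
  interpret I: ideal relation_ideal F by (rule ideal)
  have "u \<ominus>\<^bsub>F\<^esub> v \<in> relation_ideal"
    unfolding relation_ideal_def using F.genideal_self[OF differences_closed] uv by blast
  moreover have "u \<in> carrier F" "v \<in> carrier F" using uv relations_closed by auto
  ultimately show ?thesis
    unfolding cls_def by (simp add: F.quotient_eq_iff_same_a_r_cos[OF ideal])
qed

lemma wd_closed: "w \<in> lists S \<Longrightarrow> wd w \<in> carrier A"
  unfolding wd_def by (intro cls_closed word_in_free_algebra)

lemma wd_append: "\<lbrakk>u \<in> lists S; v \<in> lists S\<rbrakk> \<Longrightarrow> wd u \<otimes>\<^bsub>A\<^esub> wd v = wd (u @ v)"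
  unfolding wd_def
  by (simp add: cls_mult word_in_free_algebra int_free_algebra_simps(2) convolution_word
      del: in_lists_conv_set)

lemma wd_Nil: "wd [] = \<one>\<^bsub>A\<^esub>"
  unfolding wd_def using cls_one by (simp add: int_free_algebra_simps(3))

lemma presented_induct [consumes 1, case_names word add smult]:
  assumes x: "x \<in> carrier A"
    and word: "\<And>w. w \<in> lists S \<Longrightarrow> P (wd w)"
    and add: "\<And>x y. \<lbrakk>x \<in> carrier A; y \<in> carrier A; P x; P y\<rbrakk> \<Longrightarrow> P (x \<oplus>\<^bsub>A\<^esub> y)"
    and smult: "\<And>a x. \<lbrakk>x \<in> carrier A; P x\<rbrakk> \<Longrightarrow> P (a \<odot>\<^bsub>A\<^esub> x)"
  shows "P x"
proof -
  obtain f where "f \<in> carrier F" and xf: "x = cls f" using x by (auto simp: carrier_A)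
  from this(1) have "P (cls f)"
  proof (induction f rule: free_algebra_induct)
    case (word w)
    then show ?case using assms(2) by (simp add: wd_def)
  next
    case (add f g)
    then show ?case using assms(3)[of "cls f" "cls g"] by (simp add: cls_closed cls_add int_free_algebra_simps(5))
  next
    case (smult a f)
    then show ?case using assms(4)[of "cls f" a] by (simp add: cls_closed cls_smult int_free_algebra_simps(6))
  qed
  then show ?thesis using xf by simp
qed

text \<open>The relations lie in the annihilator ideal of \<open>H\<close>, hence so does the ideal
  that they generate, and \<open>linear_extension H\<close> is constant on classes. All trace forms
  below are obtained in this way.\<close>

lemma functional_exists:
  fixes H :: "'x list \<Rightarrow> int"
  assumes rel: "\<And>x y u v. \<lbrakk>(x, y) \<in> rels; u \<in> lists S; v \<in> lists S\<rbrakk> \<Longrightarrow>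
    linear_extension (\<lambda>w. H (u @ w @ v)) x = linear_extension (\<lambda>w. H (u @ w @ v)) y"
  shows "\<exists>\<phi>. (\<forall>x\<in>carrier A. \<forall>y\<in>carrier A. \<phi> (x \<oplus>\<^bsub>A\<^esub> y) = \<phi> x + \<phi> y) \<and>
    (\<forall>a. \<forall>x\<in>carrier A. \<phi> (a \<odot>\<^bsub>A\<^esub> x) = a * \<phi> x) \<and> (\<forall>w\<in>lists S. \<phi> (wd w) = H w)"
proof -
  interpret I: ideal relation_ideal F by (rule ideal)
  let ?J = "{f \<in> carrier F. \<forall>u\<in>lists S. \<forall>v\<in>lists S. linear_extension (\<lambda>w. H (u @ w @ v)) f = 0}"
  have "relation_ideal \<subseteq> ?J"
    unfolding relation_ideal_def
  proof (rule F.genideal_minimal[OF annihilator_ideal], clarify, intro conjI ballI)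
    fix x y u v assume xy: "(x, y) \<in> rels" and uv: "u \<in> lists S" "v \<in> lists S"
    then have "x \<in> carrier F" "y \<in> carrier F" using relations_closed by auto
    then show "linear_extension (\<lambda>w. H (u @ w @ v)) (x \<ominus>\<^bsub>F\<^esub> y) = 0"
      using rel[OF xy uv] by (simp add: linear_extension_diff)
  qed (use differences_closed in blast)
  \<comment> \<open>The empty context on both sides recovers the value at \<open>f\<close>
    itself.\<close>
  then have vanish: "linear_extension H f = 0" if "f \<in> relation_ideal" for f
    using that by (force dest!: subsetD bspec[of _ _ "[]"])
  \<comment> \<open>A class is evaluated at a chosen representative; \<open>vanish\<close> makes the
    choice immaterial.\<close>
  define \<phi> where "\<phi> x = linear_extension H (SOME f. f \<in> carrier F \<and> cls f = x)" for x
  have \<phi>: "\<phi> (cls f) = linear_extension H f" if f: "f \<in> carrier F" for f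
  proof -
    let ?g = "SOME g. g \<in> carrier F \<and> cls g = cls f"
    have g: "?g \<in> carrier F" "cls ?g = cls f" using someI[of "\<lambda>g. g \<in> carrier F \<and> cls g = cls f" f] f by auto
    then have "?g \<ominus>\<^bsub>F\<^esub> f \<in> relation_ideal"
      using f unfolding cls_def by (simp add: F.quotient_eq_iff_same_a_r_cos[OF ideal])
    from vanish[OF this] show ?thesis unfolding \<phi>_def using g f by (simp add: linear_extension_diff)
  qed
  show ?thesis
  proof (intro exI[of _ \<phi>] conjI ballI allI)
    fix x y assume "x \<in> carrier A" "y \<in> carrier A"
    then obtain f g where fg: "f \<in> carrier F" "g \<in> carrier F" "x = cls f" "y = cls g"
      by (auto simp: carrier_A)
    then have "\<phi> (x \<oplus>\<^bsub>A\<^esub> y) = linear_extension H (f \<oplus>\<^bsub>F\<^esub> g)"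
      using \<phi> F.a_closed by (simp add: cls_add)
    then show "\<phi> (x \<oplus>\<^bsub>A\<^esub> y) = \<phi> x + \<phi> y"
      using fg \<phi> by (simp add: int_free_algebra_simps linear_extension_add)
  next
    fix a x assume "x \<in> carrier A"
    then obtain f where f: "f \<in> carrier F" "x = cls f" by (auto simp: carrier_A)
    then have "\<phi> (a \<odot>\<^bsub>A\<^esub> x) = linear_extension H (a \<odot>\<^bsub>F\<^esub> f)"
      using \<phi> F.smult_closed by (simp add: cls_smult)
    then show "\<phi> (a \<odot>\<^bsub>A\<^esub> x) = a * \<phi> x"
      using f \<phi> by (simp add: int_free_algebra_simps linear_extension_smult)
  next
    fix w assume "w \<in> lists S"
    then show "\<phi> (wd w) = H w" using \<phi>[OF word_in_free_algebra] by (simp add: wd_def)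
  qed
qed

end

section \<open>Conjugates and coset actions\<close>

context group begin

lemma inv_mult_cancel_left:
  assumes "g \<in> carrier G" "y \<in> carrier G"
  shows "inv g \<otimes> (g \<otimes> y) = y" "g \<otimes> (inv g \<otimes> y) = y"
  using assms by (simp_all add: m_assoc[symmetric])

lemma conjugate_eq_image: "conjugate G g H = (\<lambda>h. g \<otimes> h \<otimes> inv g) ` H"
  by (auto simp: conjugate_def)

lemma conjugate_right_eq: "g \<in> carrier G \<Longrightarrow> conjugate_right G H g = conjugate G (inv g) H"
  by (auto simp: conjugate_def conjugate_right_def)

lemma conjugate_closed: "\<lbrakk>H \<subseteq> carrier G; g \<in> carrier G\<rbrakk> \<Longrightarrow> conjugate G g H \<subseteq> carrier G"
  by (auto simp: conjugate_def)

lemma conjugate_mono: "H \<subseteq> K \<Longrightarrow> conjugate G g H \<subseteq> conjugate G g K"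
  by (auto simp: conjugate_def)

lemma mem_conjugate:
  assumes "H \<subseteq> carrier G" "g \<in> carrier G" "x \<in> carrier G"
  shows "x \<in> conjugate G g H \<longleftrightarrow> inv g \<otimes> x \<otimes> g \<in> H"
proof
  assume "x \<in> conjugate G g H"
  then obtain h where h: "h \<in> H" "x = g \<otimes> h \<otimes> inv g" by (auto simp: conjugate_def)
  then have "inv g \<otimes> x \<otimes> g = h"
    using assms by (simp add: m_assoc inv_mult_cancel_left subsetD)
  then show "inv g \<otimes> x \<otimes> g \<in> H" using h by simp
next
  assume *: "inv g \<otimes> x \<otimes> g \<in> H"
  have "x = g \<otimes> (inv g \<otimes> x \<otimes> g) \<otimes> inv g"
    using assms by (simp add: m_assoc inv_mult_cancel_left)
  then show "x \<in> conjugate G g H" using * by (auto simp: conjugate_def)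
qed

lemma conjugate_conjugate:
  assumes "H \<subseteq> carrier G" "g \<in> carrier G" "h \<in> carrier G"
  shows "conjugate G g (conjugate G h H) = conjugate G (g \<otimes> h) H"
proof -
  have "g \<otimes> (h \<otimes> x \<otimes> inv h) \<otimes> inv g = g \<otimes> h \<otimes> x \<otimes> inv (g \<otimes> h)" if "x \<in> H" for x
    using assms that by (simp add: m_assoc inv_mult_group subsetD)
  then show ?thesis by (auto simp: conjugate_eq_image image_image intro!: image_cong)
qed

lemma conjugate_one: "H \<subseteq> carrier G \<Longrightarrow> conjugate G \<one> H = H"
  by (auto simp: conjugate_eq_image image_iff subsetD)

lemma conjugate_inv_cancel:
  assumes "H \<subseteq> carrier G" "g \<in> carrier G"
  shows "conjugate G (inv g) (conjugate G g H) = H" "conjugate G g (conjugate G (inv g) H) = H"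
  using assms by (simp_all add: conjugate_conjugate conjugate_one)

lemma conjugate_subset_iff:
  assumes "H \<subseteq> carrier G" "K \<subseteq> carrier G" "g \<in> carrier G"
  shows "conjugate G g H \<subseteq> K \<longleftrightarrow> H \<subseteq> conjugate G (inv g) K"
  using assms conjugate_inv_cancel conjugate_mono inv_closed by metis

lemma inj_on_conjugation: "g \<in> carrier G \<Longrightarrow> inj_on (\<lambda>h. g \<otimes> h \<otimes> inv g) (carrier G)"
  by (auto intro!: inj_onI)

lemma card_conjugate:
  "\<lbrakk>H \<subseteq> carrier G; g \<in> carrier G\<rbrakk> \<Longrightarrow> card (conjugate G g H) = card H"
  unfolding conjugate_eq_image using inj_on_conjugation inj_on_subset by (blast intro: card_image)

lemma conjugate_Int:
  assumes "H \<subseteq> carrier G" "K \<subseteq> carrier G" "g \<in> carrier G"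
  shows "conjugate G g (H \<inter> K) = conjugate G g H \<inter> conjugate G g K"
  unfolding conjugate_eq_image
  by (rule inj_on_image_Int[OF inj_on_conjugation]) (use assms in auto)

lemma conjugate_subgroup:
  assumes "subgroup H G" "g \<in> carrier G"
  shows "subgroup (conjugate G g H) G"
proof (rule subgroupI)
  have sub: "H \<subseteq> carrier G" using assms(1) by (rule subgroup.subset)
  show "conjugate G g H \<subseteq> carrier G" using sub assms(2) by (rule conjugate_closed)
  show "conjugate G g H \<noteq> {}"
    using subgroup.one_closed[OF assms(1)] by (auto simp: conjugate_def)
  fix x assume "x \<in> conjugate G g H"
  then obtain h where h: "h \<in> H" "x = g \<otimes> h \<otimes> inv g" by (auto simp: conjugate_def)
  then have "inv x = g \<otimes> inv h \<otimes> inv g"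
    using assms(2) sub by (simp add: inv_mult_group m_assoc subsetD)
  then show "inv x \<in> conjugate G g H"
    using h subgroup.m_inv_closed[OF assms(1)] by (auto simp: conjugate_def)
  fix y assume "y \<in> conjugate G g H"
  then obtain k where k: "k \<in> H" "y = g \<otimes> k \<otimes> inv g" by (auto simp: conjugate_def)
  have hk: "h \<in> carrier G" "k \<in> carrier G" using h k sub by auto
  have "x \<otimes> y = g \<otimes> (h \<otimes> ((inv g \<otimes> g) \<otimes> k)) \<otimes> inv g"
    unfolding h(2) k(2) using hk assms(2) by (simp only: m_assoc m_closed inv_closed)
  then have "x \<otimes> y = g \<otimes> (h \<otimes> k) \<otimes> inv g" using hk assms(2) by simp
  then show "x \<otimes> y \<in> conjugate G g H"
    using h k subgroup.m_closed[OF assms(1)] by (auto simp: conjugate_def)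
qed

lemma conjugate_self:
  assumes "subgroup H G" "h \<in> H"
  shows "conjugate G h H = H"
proof -
  interpret H: subgroup H G by fact
  have "\<And>k. k \<in> H \<Longrightarrow> conjugate G k H \<subseteq> H" by (auto simp: conjugate_def)
  then have "conjugate G h H \<subseteq> H" "conjugate G (inv h) H \<subseteq> H" using assms(2) by auto
  then show ?thesis
    using conjugate_subset_iff[of H H "inv h"] assms(2) H.subset by auto
qed

lemma conjugate_subset_subgroup:
  assumes "subgroup H G" "K \<subseteq> H" "h \<in> H"
  shows "conjugate G h K \<subseteq> H"
  using conjugate_mono[OF assms(2), of h] conjugate_self[OF assms(1,3)] by simp

section \<open>Counting by fibres, orbits and cosets\<close>

lemma card_fibres:
  assumes "subgroup Q G" "finite Q" "S \<subseteq> Q"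
    and fibre: "\<And>a b. \<lbrakk>a \<in> Q; b \<in> Q\<rbrakk> \<Longrightarrow> f a = f b \<longleftrightarrow> inv a \<otimes> b \<in> S"
  shows "card Q = card (f ` Q) * card S"
proof -
  interpret Q: subgroup Q G by fact
  have "card {b \<in> Q. f b = y} = card S" if y: "y \<in> f ` Q" for y
  proof -
    obtain a where a: "a \<in> Q" "y = f a" using y by auto
    \<comment> \<open>The fibre through \<open>a\<close> is the translate of \<open>S\<close> by
      \<open>a\<close>, so all fibres have the size of \<open>S\<close>.\<close>
    have "{b \<in> Q. f b = y} = (\<lambda>s. a \<otimes> s) ` S"
    proof (intro equalityI subsetI)
      fix b assume "b \<in> {b \<in> Q. f b = y}"
      then have "b \<in> Q" "f a = f b" using a(2) by simp_all
      then have "b \<in> Q" "inv a \<otimes> b \<in> S" using fibre[OF a(1) \<open>b \<in> Q\<close>] by simp_all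
      moreover have "b = a \<otimes> (inv a \<otimes> b)"
        using a(1) \<open>b \<in> Q\<close> by (simp add: inv_mult_cancel_left)
      ultimately show "b \<in> (\<lambda>s. a \<otimes> s) ` S" by blast
    next
      fix b assume "b \<in> (\<lambda>s. a \<otimes> s) ` S"
      then obtain s where s: "s \<in> S" "b = a \<otimes> s" by auto
      then have "b \<in> Q" "inv a \<otimes> b = s"
        using a(1) assms(3) by (auto simp: inv_mult_cancel_left)
      then show "b \<in> {b \<in> Q. f b = y}" using fibre[OF a(1) \<open>b \<in> Q\<close>] a(2) s(1) by simp
    qed
    moreover have "inj_on (\<lambda>s. a \<otimes> s) S"
      using assms(3) a(1) by (intro inj_onI) (metis Q.mem_carrier l_cancel subsetD)
    ultimately show ?thesis by (simp add: card_image)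
  qed
  then have "(\<Sum>y\<in>f ` Q. card {b \<in> Q. f b = y}) = card (f ` Q) * card S" by simp
  moreover have "(\<Sum>y\<in>f ` Q. card {b \<in> Q. f b = y}) = card Q"
    using sum.image_gen[OF assms(2), of "\<lambda>_. 1 :: nat" f] by (simp only: card_eq_sum)
  ultimately show ?thesis by simp
qed

lemma l_coset_eq_iff:
  assumes "C \<subseteq> carrier G" "a \<in> carrier G" "b \<in> carrier G"
  shows "a <# C = b <# C \<longleftrightarrow> (inv a \<otimes> b) <# C = C"
proof
  assume "a <# C = b <# C"
  then have "inv a <# (a <# C) = inv a <# (b <# C)" by simp
  then show "(inv a \<otimes> b) <# C = C" using assms by (simp add: lcos_m_assoc lcos_mult_one)
next
  assume "(inv a \<otimes> b) <# C = C"
  then have "a <# ((inv a \<otimes> b) <# C) = a <# C" by simp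
  then show "a <# C = b <# C" using assms by (simp add: lcos_m_assoc m_assoc[symmetric])
qed

lemma card_orbit_stabilizer:
  assumes "subgroup Q G" "finite Q" "C \<subseteq> carrier G"
  shows "card Q = card ((\<lambda>q. q <# C) ` Q) * card {q \<in> Q. q <# C = C}"
proof (rule card_fibres[OF assms(1,2)])
  interpret Q: subgroup Q G by fact
  fix a b assume "a \<in> Q" "b \<in> Q"
  then show "a <# C = b <# C \<longleftrightarrow> inv a \<otimes> b \<in> {q \<in> Q. q <# C = C}"
    using l_coset_eq_iff[OF assms(3), of a b] by auto
qed auto

lemma stabilizer_subgroup:
  assumes "subgroup Q G" "C \<subseteq> carrier G"
  shows "subgroup {q \<in> Q. q <# C = C} G"
proof (rule subgroupI)
  interpret Q: subgroup Q G by fact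
  show "{q \<in> Q. q <# C = C} \<noteq> {}" using assms lcos_mult_one Q.one_closed by blast
  fix a assume a: "a \<in> {q \<in> Q. q <# C = C}"
  then show "inv a \<in> {q \<in> Q. q <# C = C}"
    using l_coset_eq_iff[OF assms(2), of a \<one>] lcos_mult_one[OF assms(2)] by auto
  fix b assume "b \<in> {q \<in> Q. q <# C = C}"
  then show "a \<otimes> b \<in> {q \<in> Q. q <# C = C}"
    using a assms(2) by (auto simp: lcos_m_assoc[symmetric])
qed (use subgroup.subset[OF assms(1)] in auto)

text \<open>An orbit with stabilizers of order \<open>s\<close> has length card Q / s, so after
  multiplication by \<open>s\<close> each orbit contributes exactly card Q. The case
  \<open>s = 1\<close> is that of free actions; other values serve to isolate the orbits of one
  prescribed length.\<close>

lemma card_dvd_stabilizer_mult_card: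
  assumes Q: "subgroup Q G" "finite Q" and fin: "finite \<C>"
    and sub: "\<And>C. C \<in> \<C> \<Longrightarrow> C \<subseteq> carrier G"
    and closed: "\<And>q C. \<lbrakk>q \<in> Q; C \<in> \<C>\<rbrakk> \<Longrightarrow> q <# C \<in> \<C>"
    and stab: "\<And>C. C \<in> \<C> \<Longrightarrow> card {q \<in> Q. q <# C = C} = s"
  shows "card Q dvd s * card \<C>"
proof -
  interpret Q: subgroup Q G by fact
  let ?r = "{(C, D). C \<in> \<C> \<and> D \<in> \<C> \<and> (\<exists>q\<in>Q. D = q <# C)}"
  have cls: "?r `` {C} = (\<lambda>q. q <# C) ` Q" if "C \<in> \<C>" for C
    using that closed by auto
  have "equiv \<C> ?r"
  proof (rule equivI)
    show "refl_on \<C> ?r"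
      using sub lcos_mult_one by (auto intro!: refl_onI bexI[of _ \<one>])
    show "sym ?r"
    proof (rule symI, clarify)
      fix C q assume "C \<in> \<C>" "q \<in> Q"
      then show "\<exists>q'\<in>Q. C = q' <# (q <# C)"
        using sub by (intro bexI[of _ "inv q"]) (auto simp: lcos_m_assoc lcos_mult_one)
    qed
    show "trans ?r"
    proof (rule transI, clarify)
      fix C q q' assume "C \<in> \<C>" "q \<in> Q" "q' \<in> Q"
      then show "\<exists>p\<in>Q. q' <# (q <# C) = p <# C"
        using sub by (intro bexI[of _ "q' \<otimes> q"]) (auto simp: lcos_m_assoc)
    qed
  qed auto
  have "card Y * s = card Q" if Y: "Y \<in> \<C> // ?r" for Y
  proof -
    obtain C where "C \<in> \<C>" "Y = ?r `` {C}" using Y by (auto elim: quotientE)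
    then show ?thesis
      using card_orbit_stabilizer[OF Q sub, of C] stab[of C] cls[of C] by simp
  qed
  moreover have "card \<C> = (\<Sum>Y\<in>\<C> // ?r. card Y)"
  proof -
    have "card (\<Union>(\<C> // ?r)) = sum card (\<C> // ?r)"
    proof (rule card_Union_disjoint)
      show "disjoint (\<C> // ?r)"
        using quotient_disj[OF \<open>equiv \<C> ?r\<close>] by (auto simp: pairwise_def disjnt_def)
      show "\<And>Y. Y \<in> \<C> // ?r \<Longrightarrow> finite Y"
        using fin \<open>equiv \<C> ?r\<close> by (meson finite_subset in_quotient_imp_subset)
    qed
    then show ?thesis by (simp add: Union_quotient[OF \<open>equiv \<C> ?r\<close>])
  qed
  ultimately have "s * card \<C> = (\<Sum>Y\<in>\<C> // ?r. card Q)"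
    by (simp add: sum_distrib_left mult.commute)
  then show ?thesis by simp
qed

lemma subgroup_card_dvd:
  assumes "finite (carrier G)" "subgroup H G" "subgroup K G" "H \<subseteq> K"
  shows "card H dvd card K"
proof -
  interpret K: group "G\<lparr>carrier := K\<rparr>" using assms(3) by (rule subgroup_imp_group)
  have "subgroup H (G\<lparr>carrier := K\<rparr>)" using assms by (intro subgroup_incl)
  from K.lagrange[OF this] have "card K = card H * card (rcosets\<^bsub>G\<lparr>carrier := K\<rparr>\<^esub> H)"
    by (simp add: order_def mult.commute)
  then show ?thesis by (rule dvdI)
qed

lemma subgroup_card_dvd_order:
  "\<lbrakk>finite (carrier G); subgroup H G\<rbrakk> \<Longrightarrow> card H dvd order G"
  using subgroup_card_dvd[OF _ _ subgroup_self] subgroup.subset by (auto simp: order_def)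

text \<open>Here \<open>p ^ a\<close> may be a proper divisor of the full power of \<open>p\<close>
  in card M. It is used for \<open>a = 1\<close> (Cauchy) and for \<open>a = 2\<close>.\<close>

lemma exists_subgroup_prime_power:
  assumes "finite (carrier G)" "subgroup M G" "Factorial_Ring.prime (p::nat)" "p ^ a dvd card M"
  shows "\<exists>P. subgroup P G \<and> P \<subseteq> M \<and> card P = p ^ a"
proof -
  obtain m where m: "card M = p ^ a * m" using assms(4) by (elim dvdE)
  have "\<exists>P. subgroup P (G\<lparr>carrier := M\<rparr>) \<and> card P = p ^ a"
    by (rule sylow_thm[OF assms(3) subgroup_imp_group[OF assms(2)], of a m])
      (use m assms(1) subgroup.subset[OF assms(2)] finite_subset in \<open>auto simp: order_def\<close>)
  then show ?thesis using incl_subgroup[OF assms(2)] subgroup.subset by fastforce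
qed

lemma card_cosets_in_subgroup:
  assumes "finite (carrier G)" "subgroup H G" "subgroup M G" "H \<subseteq> M"
  shows "card M = card ((\<lambda>m. m <# H) ` M) * card H"
proof -
  interpret H: subgroup H G by fact
  interpret M: subgroup M G by fact
  have "{q \<in> M. q <# H = H} = H"
  proof (intro equalityI subsetI)
    fix q assume "q \<in> {q \<in> M. q <# H = H}"
    then have "q \<in> M" "q <# H = H" by auto
    then show "q \<in> H" using lcos_self[OF _ assms(2), of q] by auto
  next
    fix q assume "q \<in> H"
    moreover from this have "q <# H = H"
      using lcos_mult_one[OF H.subset] l_repr_independence[of q \<one> H] assms(2) by simp
    ultimately show "q \<in> {q \<in> M. q <# H = H}" using assms(4) by auto
  qed
  moreover have "finite M" using assms(1) M.subset finite_subset by blast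
  ultimately show ?thesis
    using card_orbit_stabilizer[OF assms(3) _ H.subset] by simp
qed

lemma trivial_card_subgroup: "\<lbrakk>subgroup H G; card H = 1\<rbrakk> \<Longrightarrow> H = {\<one>}"
  using subgroup.one_closed[of H G] by (auto simp: card_1_singleton_iff)

lemma prime_subgroup_cases:
  assumes "finite (carrier G)" "subgroup Q G" "Factorial_Ring.prime (card Q)" "subgroup H G" "H \<subseteq> Q"
  shows "H = {\<one>} \<or> H = Q"
proof -
  have "card H dvd card Q" using assms by (intro subgroup_card_dvd)
  then have "card H = 1 \<or> card H = card Q" using assms(3) prime_nat_iff by auto
  moreover have "finite Q" using assms(1,2) subgroup.subset finite_subset by blast
  ultimately show ?thesis
    using trivial_card_subgroup[OF assms(4)] card_subset_eq[OF _ assms(5)] by auto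
qed

text \<open>\<open>Q1\<close> acts on the cosets of \<open>Q2\<close> in \<open>M\<close>. Without a
  fixed coset all stabilizers would be trivial, so \<open>q\<close> would divide the index of
  \<open>Q2\<close> and q^2 the order of \<open>M\<close>. A fixed coset \<open>m <# Q2\<close>
  means that \<open>m\<close> conjugates \<open>Q2\<close> onto \<open>Q1\<close>.\<close>

lemma prime_subgroups_conjugate:
  assumes fin: "finite (carrier G)" and M: "subgroup M G"
    and q: "Factorial_Ring.prime q" "\<not> q\<^sup>2 dvd card M"
    and Q1: "subgroup Q1 G" "Q1 \<subseteq> M" "card Q1 = q"
    and Q2: "subgroup Q2 G" "Q2 \<subseteq> M" "card Q2 = q"
  shows "\<exists>m\<in>M. conjugate G m Q1 = Q2"
proof -
  interpret M: subgroup M G by fact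
  interpret Q1: subgroup Q1 G by fact
  interpret Q2: subgroup Q2 G by fact
  let ?C = "(\<lambda>m. m <# Q2) ` M"
  have finM: "finite M" using fin M.subset finite_subset by blast
  have cM: "card M = card ?C * q" using card_cosets_in_subgroup[OF fin Q2(1) M Q2(2)] Q2(3) by simp
  have sub: "C \<subseteq> carrier G" if "C \<in> ?C" for C using that l_coset_subset_G[OF Q2.subset] M.subset by blast
  have "\<exists>C\<in>?C. {x \<in> Q1. x <# C = C} = Q1"
  proof (rule ccontr)
    assume no: "\<not> ?thesis"
    have "card Q1 dvd 1 * card ?C"
    proof (rule card_dvd_stabilizer_mult_card[OF Q1(1)])
      fix C assume C: "C \<in> ?C"
      have "subgroup {x \<in> Q1. x <# C = C} G" by (rule stabilizer_subgroup[OF Q1(1) sub[OF C]])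
      then have "{x \<in> Q1. x <# C = C} = {\<one>}"
        using prime_subgroup_cases[OF fin Q1(1), of "{x \<in> Q1. x <# C = C}"] q(1) Q1(3) no C by auto
      then show "card {x \<in> Q1. x <# C = C} = 1" by simp
    next
      fix x C assume "x \<in> Q1" "C \<in> ?C"
      then obtain m where "m \<in> M" "C = m <# Q2" "x \<in> M" using Q1(2) by auto
      then show "x <# C \<in> ?C" using Q2.subset by (auto simp: lcos_m_assoc)
    qed (use finM Q1(2) finite_subset sub in auto)
    then have "q * q dvd card M" using cM Q1(3) by (simp add: mult_dvd_mono)
    then show False using q(2) by (simp add: power2_eq_square)
  qed
  then obtain m where m: "m \<in> M" and stab: "{x \<in> Q1. x <# (m <# Q2) = m <# Q2} = Q1" by auto
  have "inv m \<otimes> x \<otimes> m \<in> Q2" if x: "x \<in> Q1" for x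
  proof -
    have "x <# (m <# Q2) = m <# Q2" using stab x by blast
    then have "(x \<otimes> m) <# Q2 = m <# Q2" using x m Q2.subset by (simp add: lcos_m_assoc)
    moreover have "x \<otimes> m \<in> (x \<otimes> m) <# Q2" using x m by (intro lcos_self[OF _ Q2(1)]) auto
    ultimately have "inv m \<otimes> (x \<otimes> m) \<in> Q2"
      using Q2.lcos_module_imp[OF group_axioms] m by auto
    then show ?thesis using x m by (simp add: m_assoc)
  qed
  then have "conjugate G (inv m) Q1 \<subseteq> Q2" using m by (auto simp: conjugate_def)
  moreover have "card (conjugate G (inv m) Q1) = card Q2"
    using card_conjugate[OF Q1.subset, of "inv m"] m Q1 Q2 by simp
  ultimately have "conjugate G (inv m) Q1 = Q2"
    using finM Q2(2) finite_subset by (intro card_subset_eq) auto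
  then show ?thesis using m by auto
qed

section \<open>Groups of squarefree order\<close>

text \<open>The conjugates of \<open>x\<close> under the normalizer of \<open>P\<close> lie in
  \<open>P\<close> without \<open>\<one>\<close>, so there are fewer than \<open>p\<close> of them,
  while their number divides the order of \<open>G\<close>. As no prime below \<open>p\<close>
  divides this order, there is only one conjugate.\<close>

lemma smallest_prime_centralizes:
  assumes fin: "finite (carrier G)" and P: "subgroup P G" "card P = p" "Factorial_Ring.prime (p::nat)"
    and small: "\<And>r. \<lbrakk>Factorial_Ring.prime r; r dvd order G\<rbrakk> \<Longrightarrow> p \<le> r"
    and g: "g \<in> carrier G" "conjugate G g P = P" and x: "x \<in> P"
  shows "g \<otimes> x \<otimes> inv g = x"
proof (cases "x = \<one>")
  case False
  interpret P: subgroup P G by fact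
  let ?N = "{m \<in> carrier G. conjugate G m P = P}"
  let ?f = "\<lambda>m. m \<otimes> x \<otimes> inv m"
  let ?S = "{m \<in> ?N. ?f m = x}"
  have N: "subgroup ?N G"
  proof (rule subgroupI)
    fix m assume m: "m \<in> ?N"
    then show "inv m \<in> ?N" using conjugate_inv_cancel[OF P.subset, of m] by auto
    fix n assume "n \<in> ?N"
    then show "m \<otimes> n \<in> ?N" using m P.subset by (auto simp: conjugate_conjugate[symmetric])
  qed (use conjugate_one[OF P.subset] in auto)
  have xG: "x \<in> carrier G" using x by simp
  have fibre: "card ?N = card (?f ` ?N) * card ?S"
  proof (rule card_fibres[OF N])
    fix a b assume ab: "a \<in> ?N" "b \<in> ?N"
    have "?f a = ?f b \<longleftrightarrow> ?f (inv a \<otimes> b) = x"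
    proof
      assume "?f a = ?f b"
      then have "inv a \<otimes> (?f b) \<otimes> a = inv a \<otimes> (?f a) \<otimes> a" by simp
      then show "?f (inv a \<otimes> b) = x"
        using ab xG by (simp add: m_assoc inv_mult_group inv_mult_cancel_left)
    next
      assume "?f (inv a \<otimes> b) = x"
      then have "a \<otimes> ?f (inv a \<otimes> b) \<otimes> inv a = ?f a" by simp
      then show "?f a = ?f b"
        using ab xG by (simp add: m_assoc inv_mult_group inv_mult_cancel_left)
    qed
    moreover have "inv a \<otimes> b \<in> ?N"
      using ab subgroup.m_closed[OF N] subgroup.m_inv_closed[OF N] by blast
    ultimately show "?f a = ?f b \<longleftrightarrow> inv a \<otimes> b \<in> ?S" by blast
  qed (use fin in auto)
  have "?f ` ?N \<subseteq> P - {\<one>}"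
  proof
    fix y assume "y \<in> ?f ` ?N"
    then obtain m where m: "m \<in> carrier G" "conjugate G m P = P" "y = ?f m" by auto
    then have "y \<in> P" using x by (auto simp: conjugate_def)
    moreover have "y \<noteq> \<one>"
    proof
      assume "y = \<one>"
      then have "inv m \<otimes> ?f m \<otimes> m = \<one>" using m by simp
      then show False using m(1) xG False by (simp add: m_assoc inv_mult_cancel_left)
    qed
    ultimately show "y \<in> P - {\<one>}" by simp
  qed
  then have "card (?f ` ?N) \<le> card (P - {\<one>})"
    using fin P.subset by (meson card_mono finite_Diff finite_subset)
  also have "\<dots> = p - 1" using P(2) P.one_closed by simp
  finally have le: "card (?f ` ?N) \<le> p - 1" .
  have one: "card (?f ` ?N) = 1"
  proof (rule ccontr)
    assume "card (?f ` ?N) \<noteq> 1"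
    then obtain r where r: "Factorial_Ring.prime r" "r dvd card (?f ` ?N)"
      using prime_factor_nat by blast
    have "r dvd order G"
      using r(2) dvdI[OF fibre] subgroup_card_dvd_order[OF fin N] dvd_trans by blast
    then have "p \<le> r" by (rule small[OF r(1)])
    moreover have "card (?f ` ?N) > 0"
      unfolding card_gt_0_iff using fin g by auto
    then have "r \<le> card (?f ` ?N)" using r(2) by (rule dvd_imp_le[rotated])
    then have "r \<le> p - 1" using le by (rule le_trans)
    ultimately show False using prime_gt_1_nat[OF P(3)] by linarith
  qed
  then obtain y where "?f ` ?N = {y}" by (meson card_1_singletonE)
  moreover have "?f g \<in> ?f ` ?N" using g by blast
  moreover have "?f \<one> \<in> ?f ` ?N" by (rule imageI) (use conjugate_one[OF P.subset] in simp)
  ultimately show ?thesis using xG by simp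
qed (use g in simp)

text \<open>
  Transfer to \<open>P\<close>, computed with a transversal that is equivariant on the cosets not fixed by
  \<open>P\<close>: such cosets contribute nothing to the transfer of an element of \<open>P\<close>, and each of the others
  contributes the element itself.
\<close>

lemma transfer_complement:
  assumes fin: "finite (carrier G)" and P: "subgroup P G" "card P = p" "Factorial_Ring.prime (p::nat)"
    and p2: "\<not> p\<^sup>2 dvd order G"
    and central: "\<And>g x. \<lbrakk>g \<in> carrier G; conjugate G g P = P; x \<in> P\<rbrakk> \<Longrightarrow> g \<otimes> x \<otimes> inv g = x"
  shows "\<exists>N. N \<lhd> G \<and> card N * p = order G"
proof -
  interpret P: subgroup P G by fact
  have commP: "x \<otimes> y = y \<otimes> x" if "x \<in> P" "y \<in> P" for x y
  proof -
    have "x \<otimes> y \<otimes> inv x = y" using central[of x y] conjugate_self[OF P(1)] that by simp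
    then have "x \<otimes> y \<otimes> inv x \<otimes> x = y \<otimes> x" by simp
    then show ?thesis using that by (simp add: m_assoc)
  qed
  let ?P = "G\<lparr>carrier := P\<rparr>"
  interpret Pg: group ?P by (rule subgroup_imp_group[OF P(1)])
  interpret Pc: comm_group ?P by (rule Pg.group_comm_groupI) (simp add: commP)
  let ?Y = "lcosets P"
  have coset: "\<exists>a\<in>carrier G. C = a <# P" if "C \<in> ?Y" for C using that by (auto simp: LCOSETS_def)
  have subY: "C \<subseteq> carrier G" if "C \<in> ?Y" for C using P.lcosets_carrier[OF group_axioms that] .
  have actY: "g <# C \<in> ?Y" if "g \<in> carrier G" "C \<in> ?Y" for g C
    using coset[OF that(2)] that(1) P.subset by (auto simp: LCOSETS_def lcos_m_assoc)
  have eqY: "C = t <# P" if "C \<in> ?Y" "t \<in> C" for C t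
    using coset[OF that(1)] that(2) l_repr_independence[OF _ _ P(1)] by blast
  have finY: "finite ?Y"
    using lcosets_subset_PowG[OF P(1)] fin by (meson finite_Pow_iff finite_subset)
  let ?Fx = "{C \<in> ?Y. \<forall>z\<in>P. z <# C = C}"
  have stab_cases: "{z \<in> P. z <# C = C} = {\<one>}" if "C \<in> ?Y - ?Fx" for C
    using prime_subgroup_cases[OF fin P(1) _ stabilizer_subgroup[OF P(1) subY]] P(2,3) that by blast

  \<comment> \<open>A point chosen in the union of the \<open>P\<close>-orbit of \<open>C\<close>;
    it depends on that orbit only (\<open>t0_eq\<close>).\<close>
  define t0 where "t0 C = (SOME t. t \<in> P <#> C)" for C
  have t0: "t0 C \<in> P <#> C" if "C \<in> ?Y" for C
  proof -
    have "C \<noteq> {}" using coset[OF that] lcos_self[OF _ P(1)] by blast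
    then obtain c where "c \<in> C" by blast
    then have "\<one> \<otimes> c \<in> P <#> C" using P.one_closed unfolding set_mult_def by blast
    then have "\<exists>t. t \<in> P <#> C" by blast
    then show ?thesis unfolding t0_def by (rule someI_ex)
  qed
  have t0_eq: "t0 (z <# C) = t0 C" if z: "z \<in> P" and C: "C \<in> ?Y" for z C
  proof -
    have "P <#> (z <# C) = P <#> C"
    proof (intro equalityI subsetI)
      fix y assume "y \<in> P <#> (z <# C)"
      then obtain w c where wc: "w \<in> P" "c \<in> C" "y = w \<otimes> (z \<otimes> c)" by (auto simp: set_mult_def l_coset_def)
      then have "y = (w \<otimes> z) \<otimes> c" using z subY[OF C] by (simp add: m_assoc subsetD)
      then show "y \<in> P <#> C" using wc z by (auto simp: set_mult_def)
    next
      fix y assume "y \<in> P <#> C"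
      then obtain w c where wc: "w \<in> P" "c \<in> C" "y = w \<otimes> c" by (auto simp: set_mult_def)
      then have "y = (w \<otimes> inv z) \<otimes> (z \<otimes> c)"
        using z subY[OF C] by (simp add: m_assoc subsetD inv_mult_cancel_left)
      then show "y \<in> P <#> (z <# C)" using wc z by (auto simp: set_mult_def l_coset_def)
    qed
    then show ?thesis by (simp add: t0_def)
  qed
  \<comment> \<open>An element of \<open>C\<close> among the \<open>P\<close>-translates of the
    chosen point. On a free orbit it is unique, and this gives equivariance.\<close>
  define \<tau> where "\<tau> C = (SOME t. t \<in> C \<and> (\<exists>z\<in>P. t = z \<otimes> t0 C))" for C
  have \<tau>: "\<tau> C \<in> C \<and> (\<exists>z\<in>P. \<tau> C = z \<otimes> t0 C)" if C: "C \<in> ?Y" for C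
  proof -
    obtain w c where wc: "w \<in> P" "c \<in> C" "t0 C = w \<otimes> c" using t0[OF C] by (auto simp: set_mult_def)
    then have "c = inv w \<otimes> t0 C" using subY[OF C] by (simp add: inv_mult_cancel_left subsetD)
    then have "\<exists>t. t \<in> C \<and> (\<exists>z\<in>P. t = z \<otimes> t0 C)" using wc by blast
    then show ?thesis unfolding \<tau>_def by (rule someI_ex)
  qed
  have \<tau>G: "\<tau> C \<in> carrier G" if "C \<in> ?Y" for C using \<tau>[OF that] subY[OF that] by blast
  have \<tau>_eq: "\<tau> (z <# C) = z \<otimes> \<tau> C" if z: "z \<in> P" and C: "C \<in> ?Y - ?Fx" for z C
  proof -
    have CY: "C \<in> ?Y" and zCY: "z <# C \<in> ?Y" using C z actY by auto
    obtain u where u: "u \<in> P" "\<tau> C = u \<otimes> t0 C" using \<tau>[OF CY] by blast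
    obtain v where v: "v \<in> P" "\<tau> (z <# C) = v \<otimes> t0 C" using \<tau>[OF zCY] t0_eq[OF z CY] by auto
    have t0G: "t0 C \<in> carrier G" using t0[OF CY] subY[OF CY] by (auto simp: set_mult_def)
    \<comment> \<open>The discrepancy between the two choices maps a point of \<open>C\<close> to a
      point of \<open>C\<close>. It therefore stabilizes \<open>C\<close>, and is trivial because
      \<open>C\<close> is not fixed.\<close>
    let ?s = "inv z \<otimes> v \<otimes> inv u"
    have sP: "?s \<in> P" using z u v by simp
    have "inv z \<otimes> \<tau> (z <# C) \<in> C"
      using \<tau>[OF zCY] z subY[OF CY] by (auto simp: l_coset_def subsetD inv_mult_cancel_left)
    moreover have "inv z \<otimes> \<tau> (z <# C) = ?s \<otimes> \<tau> C"
      using u v z t0G by (simp add: m_assoc inv_mult_cancel_left)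
    ultimately have sC: "?s \<otimes> \<tau> C \<in> C" by simp
    have "?s <# C = ?s <# (\<tau> C <# P)" using eqY[OF CY] \<tau>[OF CY] by auto
    also have "\<dots> = (?s \<otimes> \<tau> C) <# P" using sP \<tau>G[OF CY] P.subset by (simp add: lcos_m_assoc)
    also have "\<dots> = C" using eqY[OF CY sC] by simp
    finally have "?s = \<one>" using stab_cases[OF C] sP by blast
    then have "v = z \<otimes> u" using z u v by (metis P.mem_carrier inv_closed inv_mult_cancel_left(2) inv_inv l_one inv_solve_right m_assoc m_closed)
    then show ?thesis using u v z t0G by (simp add: m_assoc)
  qed
  \<comment> \<open>The classical transfer formula; the product over all cosets makes sense because
    \<open>P\<close> is abelian.\<close>
  define V where "V g = finprod ?P (\<lambda>C. inv (\<tau> (g <# C)) \<otimes> g \<otimes> \<tau> C) ?Y" for g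
  have term_P: "inv (\<tau> (g <# C)) \<otimes> g \<otimes> \<tau> C \<in> P" if g: "g \<in> carrier G" and C: "C \<in> ?Y" for g C
  proof -
    have "g \<otimes> \<tau> C \<in> g <# C" using \<tau>[OF C] by (auto simp: l_coset_def)
    then have "g \<otimes> \<tau> C \<in> \<tau> (g <# C) <# P" using eqY[OF actY[OF g C]] \<tau>[OF actY[OF g C]] by blast
    then show ?thesis
      using P.lcos_module_imp[OF group_axioms \<tau>G[OF actY[OF g C]]] g \<tau>G[OF C] \<tau>G[OF actY[OF g C]]
      by (simp add: m_assoc)
  qed
  have V_P: "V g \<in> P" if "g \<in> carrier G" for g
    using Pc.finprod_closed[of "\<lambda>C. inv (\<tau> (g <# C)) \<otimes> g \<otimes> \<tau> C" ?Y] term_P[OF that]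
    unfolding V_def by auto
  have V_mult: "V (g \<otimes> h) = V g \<otimes> V h" if g: "g \<in> carrier G" and h: "h \<in> carrier G" for g h
  proof -
    have inj: "inj_on (\<lambda>C. h <# C) ?Y"
    proof (rule inj_onI)
      fix C D assume CD: "C \<in> ?Y" "D \<in> ?Y" "h <# C = h <# D"
      have "inv h <# (h <# E) = E" if "E \<in> ?Y" for E
        using lcos_m_assoc[OF subY[OF that], of "inv h" h] lcos_mult_one[OF subY[OF that]] h by simp
      then show "C = D" using CD by metis
    qed
    have im: "(\<lambda>C. h <# C) ` ?Y = ?Y"
      by (rule endo_inj_surj[OF finY _ inj]) (use actY h in auto)
    \<comment> \<open>Insert \<open>\<tau> (h <# C)\<close> and its inverse. Left multiplication by
      \<open>h\<close> permutes the cosets, which afterwards turns the product of the first factors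
      into \<open>V g\<close>.\<close>
    have "V (g \<otimes> h) = finprod ?P (\<lambda>C. (inv (\<tau> (g <# (h <# C))) \<otimes> g \<otimes> \<tau> (h <# C)) \<otimes>\<^bsub>?P\<^esub>
        (inv (\<tau> (h <# C)) \<otimes> h \<otimes> \<tau> C)) ?Y"
      unfolding V_def
    proof (rule Pc.finprod_cong'[OF refl])
      fix C assume C: "C \<in> ?Y"
      have hC: "h <# C \<in> ?Y" "g <# (h <# C) \<in> ?Y" using actY g h C by auto
      show "inv (\<tau> (g \<otimes> h <# C)) \<otimes> (g \<otimes> h) \<otimes> \<tau> C =
          (inv (\<tau> (g <# (h <# C))) \<otimes> g \<otimes> \<tau> (h <# C)) \<otimes>\<^bsub>?P\<^esub> (inv (\<tau> (h <# C)) \<otimes> h \<otimes> \<tau> C)"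
        using g h \<tau>G[OF C] \<tau>G[OF hC(1)] \<tau>G[OF hC(2)] subY[OF C]
        by (simp add: lcos_m_assoc m_assoc inv_mult_cancel_left)
    qed (use term_P actY g h in auto)
    also have "\<dots> = finprod ?P (\<lambda>C. inv (\<tau> (g <# (h <# C))) \<otimes> g \<otimes> \<tau> (h <# C)) ?Y \<otimes>\<^bsub>?P\<^esub> V h"
      unfolding V_def by (rule Pc.finprod_multf) (use term_P actY g h in auto)
    also have "finprod ?P (\<lambda>C. inv (\<tau> (g <# (h <# C))) \<otimes> g \<otimes> \<tau> (h <# C)) ?Y = V g"
      unfolding V_def
      using Pc.finprod_reindex[OF _ inj, of "\<lambda>C. inv (\<tau> (g <# C)) \<otimes> g \<otimes> \<tau> C"] term_P[OF g] im by auto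
    finally show ?thesis by simp
  qed
  have V_fixed: "V z = z [^] card ?Fx" if z: "z \<in> P" for z
  proof -
    have zG: "z \<in> carrier G" using z by simp
    have nf: "inv (\<tau> (z <# C)) \<otimes> z \<otimes> \<tau> C = \<one>" if C: "C \<in> ?Y - ?Fx" for C
      using \<tau>_eq[OF z C] \<tau>G[of C] C zG by (simp add: m_assoc)
    have fx: "inv (\<tau> (z <# C)) \<otimes> z \<otimes> \<tau> C = z" if C: "C \<in> ?Fx" for C
    proof -
      let ?t = "\<tau> C"
      have CY: "C \<in> ?Y" using C by simp
      have tG: "?t \<in> carrier G" by (rule \<tau>G[OF CY])
      have Ct: "C = ?t <# P" using eqY[OF CY] \<tau>[OF CY] by blast
      have "inv ?t \<otimes> w \<otimes> ?t \<in> P" if w: "w \<in> P" for w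
      proof -
        have "w \<otimes> ?t \<in> w <# C" using \<tau>[OF CY] by (auto simp: l_coset_def)
        then have "w \<otimes> ?t \<in> ?t <# P" using C w Ct by auto
        then show ?thesis using P.lcos_module_imp[OF group_axioms tG] w tG by (simp add: m_assoc)
      qed
      then have "conjugate G (inv ?t) P \<subseteq> P" using tG by (auto simp: conjugate_def)
      moreover have "card (conjugate G (inv ?t) P) = card P" using tG P.subset by (simp add: card_conjugate)
      ultimately have "conjugate G (inv ?t) P = P"
        using fin P.subset finite_subset by (intro card_subset_eq) auto
      from central[OF _ this z] have "inv ?t \<otimes> z \<otimes> ?t = z" using tG by simp
      moreover have "z <# C = C" using C z by blast
      ultimately show ?thesis by simp
    qed
    have "V z = finprod ?P (\<lambda>C. inv (\<tau> (z <# C)) \<otimes> z \<otimes> \<tau> C) ?Fx"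
      unfolding V_def
      by (rule Pc.finprod_mono_neutral_cong_right[OF finY]) (use nf term_P[OF zG] in auto)
    also have "\<dots> = finprod ?P (\<lambda>C. z) ?Fx"
      by (rule Pc.finprod_cong'[OF refl]) (use fx z in auto)
    also have "\<dots> = z [^]\<^bsub>?P\<^esub> card ?Fx" using z by (intro Pc.finprod_const) auto
    also have "\<dots> = z [^] card ?Fx" by (simp add: nat_pow_def)
    finally show ?thesis .
  qed
  have cY: "card ?Y * p = order G" using l_lagrange[OF fin P(1)] P(2) by simp
  \<comment> \<open>The cosets that are not fixed form free \<open>P\<close>-orbits. If
    \<open>p\<close> divided the number of fixed ones, it would divide the index of
    \<open>P\<close>, against \<open>p2\<close>.\<close>
  have pFx: "\<not> p dvd card ?Fx"
  proof
    assume "p dvd card ?Fx"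
    moreover have "p dvd 1 * card (?Y - ?Fx)"
      unfolding P(2)[symmetric]
    proof (rule card_dvd_stabilizer_mult_card[OF P(1)])
      show "z <# C \<in> ?Y - ?Fx" if z: "z \<in> P" and C: "C \<in> ?Y - ?Fx" for z C
      proof -
        have "C \<in> ?Fx" if *: "\<forall>w\<in>P. w <# (z <# C) = z <# C"
        proof -
          have "z <# C = inv z <# (z <# C)" using * z by auto
          then have zC: "z <# C = C" using z subY C by (simp add: lcos_m_assoc lcos_mult_one)
          then show ?thesis using * C by simp
        qed
        moreover have "z <# C \<in> ?Y" using actY z C by simp
        ultimately show ?thesis using C by blast
      qed
    qed (use fin P.subset finite_subset finY subY stab_cases in auto)
    ultimately have "p dvd card ?Fx + card (?Y - ?Fx)" by simp
    also have "card ?Fx + card (?Y - ?Fx) = card ?Y"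
      using finY by (subst card_Un_disjoint[symmetric]) (auto intro: arg_cong[where f = card])
    finally have "p * p dvd card ?Y * p" by (rule mult_dvd_mono) simp
    then show False using p2 cY by (simp add: power2_eq_square)
  qed
  let ?N = "{g \<in> carrier G. V g = \<one>}"
  have V_hom: "group_hom G ?P V"
    by (unfold_locales) (auto simp: hom_def V_P V_mult)
  interpret V: group_hom G ?P V by (rule V_hom)
  have "kernel G ?P V = ?N" by (auto simp: kernel_def)
  then have N: "?N \<lhd> G" using V.normal_kernel by simp
  have "card (carrier G) = card (V ` carrier G) * card ?N"
  proof (rule card_fibres[OF subgroup_self fin])
    fix a b assume ab: "a \<in> carrier G" "b \<in> carrier G"
    have "V (inv a \<otimes> b) = inv (V a) \<otimes> V b"
      using ab V.hom_inv[of a] V_P by (simp add: V_mult m_inv_consistent[OF P(1)])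
    then show "V a = V b \<longleftrightarrow> inv a \<otimes> b \<in> ?N"
      using ab V_P by (auto simp: inv_solve_left')
  qed auto
  \<comment> \<open>On \<open>P\<close> the transfer is a power map whose exponent is prime to
    \<open>p\<close>, so the image is a nontrivial subgroup of a group of prime order.\<close>
  moreover have "V ` carrier G = P"
  proof -
    have "subgroup (V ` carrier G) ?P" using V.img_is_subgroup .
    then have sub: "subgroup (V ` carrier G) G" using incl_subgroup[OF P(1)] by blast
    obtain z where z: "z \<in> P" "z \<noteq> \<one>"
    proof -
      have "P \<noteq> {\<one>}" using P(2,3) by auto
      then show ?thesis using that P.one_closed by blast
    qed
    have "ord z dvd p"
    proof -
      have "z [^]\<^bsub>?P\<^esub> order ?P = \<one>\<^bsub>?P\<^esub>" by (rule Pg.pow_order_eq_1) (use z in simp)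
      then have "z [^] p = \<one>" using P(2) by (simp add: nat_pow_def order_def)
      then show ?thesis using z by (simp add: pow_eq_id)
    qed
    then have "ord z = 1 \<or> ord z = p" using P(3) prime_nat_iff by blast
    moreover have "ord z \<noteq> 1" using z ord_eq_1[of z] by simp
    ultimately have "ord z = p" by blast
    then have "V z \<noteq> \<one>" using V_fixed[OF z(1)] pFx z(1) pow_eq_id[of z] by auto
    then have "V ` carrier G \<noteq> {\<one>}" using z(1) by auto
    moreover have "V ` carrier G \<subseteq> P" using V_P by auto
    ultimately show ?thesis using prime_subgroup_cases[OF fin P(1) _ sub] P(2,3) by auto
  qed
  ultimately show ?thesis using N P(2) by (auto simp: order_def mult.commute)
qed

text \<open>Burnside's transfer argument: a subgroup \<open>P\<close> of order \<open>p\<close> is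
  central in its normalizer, so the kernel of the transfer to \<open>P\<close> has index
  \<open>p\<close>. Taking the smallest prime divisor is what forces the normalizer to act trivially
  on \<open>P\<close>.\<close>

lemma squarefree_normal_subgroup:
  assumes fin: "finite (carrier G)" and M: "subgroup M G" and sq: "\<forall>p::nat. Factorial_Ring.prime p \<longrightarrow> \<not> p\<^sup>2 dvd card M"
    and M1: "card M \<noteq> 1"
  obtains N p where "Factorial_Ring.prime (p::nat)" "subgroup N G" "N \<subseteq> M" "card N * p = card M"
    "\<And>m. m \<in> M \<Longrightarrow> conjugate G m N = N"
proof -
  interpret M: subgroup M G by fact
  interpret Mg: group "G\<lparr>carrier := M\<rparr>" by (rule subgroup_imp_group[OF M])
  have finM: "finite M" using fin M.subset finite_subset by blast
  have conjM: "conjugate (G\<lparr>carrier := M\<rparr>) m H = conjugate G m H" if "m \<in> M" for m H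
    using that by (simp add: conjugate_def m_inv_consistent[OF M])
  have ex: "\<exists>p. Factorial_Ring.prime p \<and> p dvd card M" using M1 prime_factor_nat by blast
  define p where "p = (LEAST p. Factorial_Ring.prime p \<and> p dvd card M)"
  have p: "Factorial_Ring.prime p" "p dvd card M" using LeastI_ex[OF ex] by (simp_all add: p_def)
  have least: "p \<le> r" if "Factorial_Ring.prime r" "r dvd card M" for r
    unfolding p_def using that by (intro Least_le) simp
  have p2: "\<not> p\<^sup>2 dvd card M" using sq p(1) by blast
  obtain P where P: "subgroup P G" "P \<subseteq> M" "card P = p"
    using exists_subgroup_prime_power[OF fin M p(1), of 1] p(2) by auto
  have PM: "subgroup P (G\<lparr>carrier := M\<rparr>)" using subgroup_incl[OF P(1) M P(2)] .
  have "\<exists>N. N \<lhd> G\<lparr>carrier := M\<rparr> \<and> card N * p = order (G\<lparr>carrier := M\<rparr>)"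
  proof (rule Mg.transfer_complement[OF _ PM P(3) p(1)])
    fix g x assume "g \<in> carrier (G\<lparr>carrier := M\<rparr>)" "conjugate (G\<lparr>carrier := M\<rparr>) g P = P" "x \<in> P"
    then show "g \<otimes>\<^bsub>G\<lparr>carrier := M\<rparr>\<^esub> x \<otimes>\<^bsub>G\<lparr>carrier := M\<rparr>\<^esub> inv\<^bsub>G\<lparr>carrier := M\<rparr>\<^esub> g = x"
      using Mg.smallest_prime_centralizes[OF _ PM P(3) p(1)] least finM by (auto simp: order_def)
  qed (use finM p2 in \<open>auto simp: order_def\<close>)
  then obtain N where N: "N \<lhd> G\<lparr>carrier := M\<rparr>" "card N * p = card M" by (auto simp: order_def)
  have NM: "subgroup N (G\<lparr>carrier := M\<rparr>)" using N(1) by (rule normal_imp_subgroup)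
  have NG: "subgroup N G" using incl_subgroup[OF M NM] .
  have "conjugate G m N = N" if m: "m \<in> M" for m
  proof -
    have sub: "conjugate G k N \<subseteq> N" if "k \<in> M" for k
      using Mg.normal_inv_iff[of N] N(1) that by (auto simp: conjugate_def m_inv_consistent[OF M])
    then have "conjugate G m N \<subseteq> N" "conjugate G (inv m) N \<subseteq> N" using m by auto
    then show ?thesis
      using conjugate_subset_iff[of N N "inv m"] m subgroup.subset[OF NG] by auto
  qed
  then show ?thesis using that[OF p(1) NG _ N(2)] subgroup.subset[OF NM] by auto
qed

section \<open>Products of subgroups and normal subgroups of prime index\<close>

lemma set_mult_subgroup_normalized:
  assumes "subgroup E G" "subgroup Q G" and norm: "\<And>x. x \<in> Q \<Longrightarrow> conjugate G x E = E"
  shows "subgroup (E <#> Q) G"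
proof (rule subgroupI)
  interpret E: subgroup E G by fact
  interpret Q: subgroup Q G by fact
  show "E <#> Q \<subseteq> carrier G" by (auto simp: set_mult_def)
  show "E <#> Q \<noteq> {}" using E.one_closed Q.one_closed unfolding set_mult_def by blast
  have conj: "x \<otimes> e \<otimes> inv x \<in> E" if "x \<in> Q" "e \<in> E" for x e
    using norm[OF that(1)] that(2) by (auto simp: conjugate_def)
  fix a assume "a \<in> E <#> Q"
  then obtain e x where a: "e \<in> E" "x \<in> Q" "a = e \<otimes> x" by (auto simp: set_mult_def)
  have "inv a = (inv x \<otimes> inv e \<otimes> inv (inv x)) \<otimes> inv x"
    using a by (simp add: inv_mult_group m_assoc)
  then show "inv a \<in> E <#> Q" using conj[of "inv x" "inv e"] a unfolding set_mult_def by blast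
  fix b assume "b \<in> E <#> Q"
  then obtain f y where b: "f \<in> E" "y \<in> Q" "b = f \<otimes> y" by (auto simp: set_mult_def)
  have "a \<otimes> b = (e \<otimes> (x \<otimes> f \<otimes> inv x)) \<otimes> (x \<otimes> y)"
    using a b by (simp add: m_assoc inv_mult_cancel_left)
  then show "a \<otimes> b \<in> E <#> Q" using conj[of x f] a b unfolding set_mult_def by blast
qed

lemma card_set_mult_disjoint:
  assumes "subgroup E G" "subgroup Q G" "E \<inter> Q = {\<one>}"
  shows "card (E <#> Q) = card E * card Q"
proof -
  interpret E: subgroup E G by fact
  interpret Q: subgroup Q G by fact
  have "inj_on (\<lambda>(e, x). e \<otimes> x) (E \<times> Q)"
  proof (rule inj_onI, clarsimp)
    fix e x f y assume *: "e \<in> E" "x \<in> Q" "f \<in> E" "y \<in> Q" "e \<otimes> x = f \<otimes> y"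
    then have "inv f \<otimes> (e \<otimes> x) \<otimes> inv x = inv f \<otimes> (f \<otimes> y) \<otimes> inv x" by simp
    moreover have "e \<in> carrier G" "x \<in> carrier G" "f \<in> carrier G" "y \<in> carrier G" using * by auto
    ultimately have eq: "inv f \<otimes> e = y \<otimes> inv x" by (simp add: m_assoc inv_mult_cancel_left)
    have "inv f \<otimes> e \<in> E" "y \<otimes> inv x \<in> Q" using * by auto
    then have "inv f \<otimes> e = \<one>" "y \<otimes> inv x = \<one>" using eq assms(3) by auto
    then show "e = f \<and> x = y" using * by (metis E.mem_carrier Q.mem_carrier inv_equality inv_inv inv_closed)
  qed
  moreover have "E <#> Q = (\<lambda>(e, x). e \<otimes> x) ` (E \<times> Q)" by (auto simp: set_mult_def)
  ultimately show ?thesis by (simp add: card_image card_cartesian_product)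
qed

lemma coprime_subgroups_Int:
  assumes "finite (carrier G)" "subgroup E G" "subgroup Q G" "coprime (card E) (card Q)"
  shows "E \<inter> Q = {\<one>}"
proof -
  have "subgroup (E \<inter> Q) G" using assms by (intro subgroups_Inter_pair)
  moreover from this have "card (E \<inter> Q) dvd card E" "card (E \<inter> Q) dvd card Q"
    using subgroup_card_dvd[OF assms(1)] assms(2,3) by auto
  then have "card (E \<inter> Q) = 1" using assms(4) coprime_common_divisor_nat by blast
  ultimately show ?thesis by (rule trivial_card_subgroup)
qed

text \<open>The product of \<open>N\<close> and \<open>H\<close> lies between \<open>N\<close> and
  \<open>M\<close>, so it is one of the two because the index is prime. If it is \<open>M\<close>,
  then \<open>H\<close> meets every coset of \<open>N\<close>, and orbit-stabilizer gives the order
  of \<open>H\<close>.\<close>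

lemma prime_index_cases:
  assumes fin: "finite (carrier G)" and M: "subgroup M G" and N: "subgroup N G" "N \<subseteq> M"
    and p: "Factorial_Ring.prime (p::nat)" "card N * p = card M"
    and normal: "\<And>m. m \<in> M \<Longrightarrow> conjugate G m N = N"
    and H: "subgroup H G" "H \<subseteq> M"
  shows "H \<subseteq> N \<or> card H = card (H \<inter> N) * p"
proof -
  interpret M: subgroup M G by fact
  interpret N: subgroup N G by fact
  interpret H: subgroup H G by fact
  have finM: "finite M" using fin M.subset finite_subset by blast
  have posN: "card N > 0" using N.finite_imp_card_positive fin by blast
  have NH: "subgroup (N <#> H) G"
    using set_mult_subgroup_normalized[OF N(1) H(1)] normal H(2) by blast
  have NHM: "N <#> H \<subseteq> M" using N(2) H(2) by (auto simp: set_mult_def)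
  have NNH: "N \<subseteq> N <#> H" and HNH: "H \<subseteq> N <#> H"
    using mono_set_mult[of N N "{\<one>}" H G] mono_set_mult[of "{\<one>}" N H H G]
      N.one_closed H.one_closed N.subset H.subset
    by (auto simp: set_mult_def subset_iff)
  have "card N dvd card (N <#> H)" using subgroup_card_dvd[OF fin N(1) NH NNH] .
  then obtain k where k: "card (N <#> H) = card N * k" by (elim dvdE)
  have "card N * k dvd card N * p" using subgroup_card_dvd[OF fin NH M NHM] k p(2) by simp
  then have "k dvd p" using posN by simp
  then have "k = 1 \<or> k = p" using p(1) prime_nat_iff by auto
  then show ?thesis
  proof
    assume "k = 1"
    then have "N = N <#> H"
      using k NNH finite_subset[OF NHM finM] by (intro card_subset_eq) auto
    then show ?thesis using HNH by simp
  next
    assume "k = p"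
    then have MNH: "N <#> H = M" using k p(2) finM NHM by (intro card_subset_eq) auto
    have stab: "h <# N = N \<longleftrightarrow> h \<in> N" if "h \<in> carrier G" for h
    proof
      assume "h <# N = N"
      then show "h \<in> N" using lcos_self[OF that N(1)] by (rule subst)
    next
      assume "h \<in> N"
      then show "h <# N = N"
        using l_repr_independence[of h \<one> N] N(1) lcos_mult_one[OF N.subset] by simp
    qed
    have "(\<lambda>h. h <# N) ` H = (\<lambda>m. m <# N) ` M"
    proof (intro equalityI image_subsetI)
      fix m assume "m \<in> M"
      then obtain n h where nh: "n \<in> N" "h \<in> H" "m = n \<otimes> h" using MNH by (auto simp: set_mult_def)
      have "conjugate G (inv h) N = N" using normal[of "inv h"] nh(2) H(2) by auto
      then have "inv h \<otimes> n \<otimes> inv (inv h) \<in> N" using nh(1) unfolding conjugate_def by blast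
      then have "inv h \<otimes> m \<in> N" using nh by (simp add: m_assoc)
      then have "(inv h \<otimes> m) <# N = N" using stab nh by simp
      then have "h <# N = m <# N" using nh N.subset by (subst l_coset_eq_iff) auto
      then show "m <# N \<in> (\<lambda>h. h <# N) ` H" using nh(2) by blast
    qed (use H(2) in blast)
    moreover have "card N * card ((\<lambda>m. m <# N) ` M) = card N * p"
      unfolding p(2) using card_cosets_in_subgroup[OF fin N(1) M N(2)] by (simp add: mult.commute)
    ultimately have "card ((\<lambda>h. h <# N) ` H) = p" using posN by auto
    moreover have "{h \<in> H. h <# N = N} = H \<inter> N" using stab[OF H.mem_carrier] by blast
    ultimately show ?thesis
      using card_orbit_stabilizer[OF H(1) finite_subset[OF H(2) finM] N.subset] by simp
  qed
qed

lemma normalizer_subgroup: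
  assumes "subgroup M G" "E \<subseteq> carrier G"
  shows "subgroup {m \<in> M. conjugate G m E = E} G"
proof (rule subgroupI)
  interpret M: subgroup M G by fact
  show "{m \<in> M. conjugate G m E = E} \<noteq> {}" using conjugate_one[OF assms(2)] M.one_closed by blast
  fix a assume a: "a \<in> {m \<in> M. conjugate G m E = E}"
  then show "inv a \<in> {m \<in> M. conjugate G m E = E}"
    using conjugate_inv_cancel(1)[OF assms(2), of a] by auto
  fix b assume "b \<in> {m \<in> M. conjugate G m E = E}"
  then show "a \<otimes> b \<in> {m \<in> M. conjugate G m E = E}"
    using a assms(2) by (auto simp: conjugate_conjugate[symmetric])
qed (use subgroup.subset[OF assms(1)] in auto)

text \<open>
  Hall's theorem for squarefree order, by induction along a normal subgroup \<open>N\<close> of prime index \<open>p\<close>.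
  Subgroups of order prime to \<open>p\<close> lie in \<open>N\<close>; the others are products of their intersection \<open>E\<close>
  with \<open>N\<close> and a subgroup of order \<open>p\<close> of the normalizer of \<open>E\<close>.
\<close>

lemma squarefree_hall:
  assumes fin: "finite (carrier G)" and "subgroup M G"
    and "\<forall>p::nat. Factorial_Ring.prime p \<longrightarrow> \<not> p\<^sup>2 dvd card M" "d dvd card M"
  shows "(\<exists>H. subgroup H G \<and> H \<subseteq> M \<and> card H = d) \<and>
    (\<forall>H K. subgroup H G \<and> H \<subseteq> M \<and> card H = d \<and> subgroup K G \<and> K \<subseteq> M \<and> card K = d
      \<longrightarrow> (\<exists>m\<in>M. conjugate G m H = K))"
  using assms(2-)
proof (induction "card M" arbitrary: M d rule: less_induct)
  case less
  note M = less.prems(1) and sq = less.prems(2) and d = less.prems(3)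
  interpret M: subgroup M G by fact
  have finM: "finite M" using fin M.subset finite_subset by blast
  show ?case
  proof (cases "card M = 1")
    case True
    then have M1: "M = {\<one>}" "d = 1" using trivial_card_subgroup[OF M] d by auto
    have "conjugate G \<one> {\<one>} = {\<one>}" by (rule conjugate_one) simp
    then show ?thesis
      using M M1 trivial_card_subgroup by (metis True order_refl singletonI)
  next
    case False
    obtain N p where p: "Factorial_Ring.prime p" and N: "subgroup N G" "N \<subseteq> M" "card N * p = card M"
      and normal: "\<And>m. m \<in> M \<Longrightarrow> conjugate G m N = N"
      using squarefree_normal_subgroup[OF fin M sq False] by metis
    interpret N: subgroup N G by fact
    have p2: "\<not> p\<^sup>2 dvd card M" using sq p by blast
    have pN: "\<not> p dvd card N"
    proof
      assume "p dvd card N"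
      then have "p * p dvd card N * p" by (intro mult_dvd_mono) auto
      then show False using p2 N(3) by (simp add: power2_eq_square)
    qed
    have posN: "card N > 0" using N.finite_imp_card_positive fin by blast
    have less: "card N < card M" unfolding N(3)[symmetric] using prime_gt_1_nat[OF p] posN by simp
    have "card N dvd card M" unfolding N(3)[symmetric] by simp
    then have sqN: "\<forall>p::nat. Factorial_Ring.prime p \<longrightarrow> \<not> p\<^sup>2 dvd card N"
      using sq dvd_trans by blast
    note IH = less.hyps[OF less N(1) sqN]
    have index: "H \<subseteq> N \<or> card H = card (H \<inter> N) * p" if "subgroup H G" "H \<subseteq> M" for H
      by (rule prime_index_cases[OF fin M N(1,2) p N(3) normal that])
    show ?thesis
    proof (cases "p dvd d")
      case False
      then have "d dvd card N"
        using d p by (metis N(3) coprime_commute coprime_dvd_mult_left_iff prime_imp_coprime)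

      note dN = this
      have HN: "H \<subseteq> N" if "subgroup H G" "H \<subseteq> M" "card H = d" for H
        using index[OF that(1,2)] that(3) False by auto
      obtain H where H: "subgroup H G" "H \<subseteq> N" "card H = d" using IH[OF dN] by blast
      show ?thesis
      proof (intro conjI allI impI)
        show "\<exists>H. subgroup H G \<and> H \<subseteq> M \<and> card H = d" using H N(2) by blast
        fix H K assume "subgroup H G \<and> H \<subseteq> M \<and> card H = d \<and> subgroup K G \<and> K \<subseteq> M \<and> card K = d"
        then have "\<exists>m\<in>N. conjugate G m H = K" using IH[OF dN] HN by blast
        then show "\<exists>m\<in>M. conjugate G m H = K" using N(2) by blast
      qed
    next
      case True
      then obtain e where e: "d = e * p" by (metis dvdE mult.commute)
      have eN: "e dvd card N" using d prime_gt_0_nat[OF p] unfolding e N(3)[symmetric] by simp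
      have cop: "coprime e p" using pN p eN by (metis coprime_commute dvd_trans prime_imp_coprime)
      have prod: "subgroup (E <#> Q) G \<and> card (E <#> Q) = d"
        if "subgroup E G" "card E = e" "subgroup Q G" "card Q = p" "\<And>x. x \<in> Q \<Longrightarrow> conjugate G x E = E" for E Q
        using set_mult_subgroup_normalized[OF that(1,3,5)] that(2,4) e cop
          card_set_mult_disjoint[OF that(1,3) coprime_subgroups_Int[OF fin that(1,3)]] by simp
      have cauchy: "\<exists>Q. subgroup Q G \<and> Q \<subseteq> H \<and> card Q = p" if "subgroup H G" "p dvd card H" for H
        using exists_subgroup_prime_power[OF fin that(1) p, of 1] that(2) by simp
      show ?thesis
      proof (intro conjI allI impI)
        obtain E where E: "subgroup E G" "E \<subseteq> N" "card E = e" using IH[OF eN] by blast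
        interpret E: subgroup E G by fact
        let ?T = "{m \<in> M. conjugate G m E = E}"
        have T: "subgroup ?T G" by (rule normalizer_subgroup[OF M E.subset])
        \<comment> \<open>Frattini argument: every \<open>M\<close>-conjugate of \<open>E\<close>
          lies in \<open>N\<close> and is, by induction, conjugate to \<open>E\<close> within
          \<open>N\<close>. Hence \<open>M\<close> is \<open>N\<close> times the normalizer of
          \<open>E\<close>, and a normalizer inside \<open>N\<close> would give
          \<open>M = N\<close>.\<close>
        have "\<not> ?T \<subseteq> N"
        proof
          assume TN: "?T \<subseteq> N"
          have "m \<in> N" if m: "m \<in> M" for m
          proof -
            have "conjugate G m E \<subseteq> N" using conjugate_mono[OF E(2), of m] normal[OF m] by simp
            moreover have "card (conjugate G m E) = e" using card_conjugate[OF E.subset, of m] m E(3) by simp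
            ultimately obtain n where n: "n \<in> N" "conjugate G n (conjugate G m E) = E"
              using IH[OF eN] E conjugate_subgroup[OF E(1) M.mem_carrier[OF m]] by blast
            then have "n \<otimes> m \<in> ?T"
              using m N(2) by (auto simp: conjugate_conjugate[OF E.subset])
            then have "inv n \<otimes> (n \<otimes> m) \<in> N" using n TN by blast
            then show ?thesis using n m by (simp add: inv_mult_cancel_left)
          qed
          then have "M \<subseteq> N" by (rule subsetI)
          then show False using less N(2) by auto
        qed
        then have "p dvd card ?T" using index[OF T] by auto
        then obtain Q where Q: "subgroup Q G" "Q \<subseteq> ?T" "card Q = p" using cauchy[OF T] by blast
        have "subgroup (E <#> Q) G \<and> card (E <#> Q) = d"
          by (rule prod[OF E(1,3) Q(1,3)]) (use Q(2) in blast)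
        moreover have "E <#> Q \<subseteq> M" using E(2) N(2) Q(2) by (auto simp: set_mult_def)
        ultimately show "\<exists>H. subgroup H G \<and> H \<subseteq> M \<and> card H = d" by blast
      next
        fix H K assume HK: "subgroup H G \<and> H \<subseteq> M \<and> card H = d \<and> subgroup K G \<and> K \<subseteq> M \<and> card K = d"
        then have H: "subgroup H G" "H \<subseteq> M" "card H = d" and K: "subgroup K G" "K \<subseteq> M" "card K = d"
          by auto
        interpret H: subgroup H G by fact
        interpret K: subgroup K G by fact
        have inter: "card (L \<inter> N) = e" if "subgroup L G" "L \<subseteq> M" "card L = d" for L
        proof -
          have "\<not> L \<subseteq> N"
            using subgroup_card_dvd[OF fin that(1) N(1)] that(3) True pN dvd_trans by blast
          then have "e * p = card (L \<inter> N) * p" using index[OF that(1,2)] that(3) e by simp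
          then show ?thesis using prime_gt_0_nat[OF p] by simp
        qed
        obtain n where n: "n \<in> N" "conjugate G n (H \<inter> N) = K \<inter> N"
          using IH[OF eN] inter[OF H] inter[OF K] subgroups_Inter_pair[OF H(1) N(1)]
            subgroups_Inter_pair[OF K(1) N(1)] Int_lower2[of H N] Int_lower2[of K N] by blast
        have nM: "n \<in> M" using n N(2) by blast
        let ?H = "conjugate G n H" and ?E = "K \<inter> N"
        have H': "subgroup ?H G" "?H \<subseteq> M" "card ?H = d"
          using conjugate_subgroup[OF H(1), of n] conjugate_subset_subgroup[OF M H(2) nM]
            card_conjugate[OF H.subset, of n] n(1) H(3) by auto
        have E: "subgroup ?E G" by (rule subgroups_Inter_pair[OF K(1) N(1)])
        interpret E: subgroup ?E G by (rule E)
        have HN: "?H \<inter> N = ?E"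
          using n conjugate_Int[OF H.subset N.subset, of n] normal[OF nM] by simp
        \<comment> \<open>\<open>?H\<close> and \<open>K\<close> both normalize their common
          intersection \<open>?E\<close> with \<open>N\<close>. Inside the normalizer their
          subgroups of order \<open>p\<close> are conjugate, and an element of \<open>?T\<close>
          that conjugates them leaves \<open>?E\<close> in place.\<close>
        let ?T = "{m \<in> M. conjugate G m ?E = ?E}"
        have T: "subgroup ?T G" by (rule normalizer_subgroup[OF M E.subset])
        have inT: "L \<subseteq> ?T" if L: "subgroup L G" "L \<subseteq> M" "L \<inter> N = ?E" for L
        proof
          fix x assume x: "x \<in> L"
          then have "conjugate G x (L \<inter> N) = conjugate G x L \<inter> conjugate G x N"
            using subgroup.subset[OF L(1)] by (intro conjugate_Int) auto
          also have "\<dots> = L \<inter> N" using conjugate_self[OF L(1) x] normal[of x] x L(2) by auto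
          finally show "x \<in> ?T" using L x by auto
        qed
        have HT: "?H \<subseteq> ?T" and KT: "K \<subseteq> ?T" using inT[OF H'(1,2) HN] inT[OF K(1,2)] by auto
        obtain Q1 where Q1: "subgroup Q1 G" "Q1 \<subseteq> ?H" "card Q1 = p" using cauchy[OF H'(1)] H'(3) True by auto
        obtain Q2 where Q2: "subgroup Q2 G" "Q2 \<subseteq> K" "card Q2 = p" using cauchy[OF K(1)] K(3) True by auto
        have "\<not> p\<^sup>2 dvd card ?T" using p2 subgroup_card_dvd[OF fin T M] dvd_trans by blast
        then obtain t where t: "t \<in> ?T" "conjugate G t Q1 = Q2"
          using prime_subgroups_conjugate[OF fin T p _ Q1(1) _ Q1(3) Q2(1) _ Q2(3)] Q1(2) Q2(2) HT KT
          by blast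
        have tG: "t \<in> carrier G" using t(1) by auto
        have P: "card (?E <#> Q2) = d"
          using prod[OF E inter[OF K] Q2(1,3)] Q2(2) KT by blast
        have "?E <#> Q2 \<subseteq> K" using Q2(2) by (auto simp: set_mult_def)
        then have K_eq: "?E <#> Q2 = K"
          using P K(3) finite_subset[OF K(2) finM] by (intro card_subset_eq) auto
        have tH: "subgroup (conjugate G t ?H) G" by (rule conjugate_subgroup[OF H'(1) tG])
        have "?E \<subseteq> conjugate G t ?H" using conjugate_mono[of ?E ?H t] HN t(1) by blast
        moreover have "Q2 \<subseteq> conjugate G t ?H" using conjugate_mono[OF Q1(2), of t] t(2) by simp
        ultimately have "?E <#> Q2 \<subseteq> conjugate G t ?H"
          using subgroup.m_closed[OF tH] by (auto simp: set_mult_def)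
        then have "K \<subseteq> conjugate G t ?H" by (simp only: K_eq)
        moreover have "card (conjugate G t ?H) = card K"
          using card_conjugate[OF subgroup.subset[OF H'(1)] tG] H'(3) K(3) by simp
        ultimately have "K = conjugate G t ?H"
          using fin subgroup.subset[OF tH] finite_subset by (intro card_subset_eq) auto
        then have "conjugate G (t \<otimes> n) H = K"
          using conjugate_conjugate[OF H.subset tG, of n] n(1) by simp
        then show "\<exists>m\<in>M. conjugate G m H = K" using t(1) nM by blast
      qed
    qed
  qed
qed

end

section \<open>Fixed points of composites of spans\<close>

locale finite_group = group G for G (structure) +
  assumes fin: "finite (carrier G)"

text \<open>The target point \<open>D\<close> comes first, as in a matrix entry, to match the
  composition of words from right to left. A transfer is a projection of coset spaces, a restriction
  the same relation reversed, and a conjugation a right multiplication, which commutes with the left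
  action of \<open>G\<close>.\<close>

fun span_rel :: "('g, 'm) monoid_scheme \<Rightarrow> 'g mackey_gen \<Rightarrow> 'g set \<Rightarrow> 'g set \<Rightarrow> bool" where
  "span_rel G (Tr K H) D C \<longleftrightarrow> C \<in> lcosets\<^bsub>G\<^esub> H \<and> D \<in> lcosets\<^bsub>G\<^esub> K \<and> C \<subseteq> D"
| "span_rel G (Res K H) D C \<longleftrightarrow> C \<in> lcosets\<^bsub>G\<^esub> K \<and> D \<in> lcosets\<^bsub>G\<^esub> H \<and> D \<subseteq> C"
| "span_rel G (Conj g H) D C \<longleftrightarrow> C \<in> lcosets\<^bsub>G\<^esub> H \<and> D = C #>\<^bsub>G\<^esub> inv\<^bsub>G\<^esub> g"

text \<open>The fixed points of \<open>Q\<close> on the union of all coset spaces. This union is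
  disjoint without any labels, since a coset determines its subgroup
  (\<open>lcoset_subgroup_unique\<close>).\<close>

definition fixed_cosets :: "('g, 'm) monoid_scheme \<Rightarrow> 'g set \<Rightarrow> 'g set set" where
  "fixed_cosets G Q = {C. (\<exists>H. subgroup H G \<and> C \<in> lcosets\<^bsub>G\<^esub> H) \<and> (\<forall>q\<in>Q. q <#\<^bsub>G\<^esub> C = C)}"

text \<open>
  The span attached to a generator is a relation on cosets, but a composite of such spans is not:
  it is counted with multiplicities, separately on the fixed points of every subgroup \<open>Q\<close>.
\<close>

fun paths :: "('g, 'm) monoid_scheme \<Rightarrow> 'g set \<Rightarrow> 'g mackey_gen list \<Rightarrow> 'g set \<Rightarrow> 'g set \<Rightarrow> int" where
  "paths G Q [] D C = of_bool (D = C)"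
| "paths G Q (x # w) D C = (\<Sum>E\<in>fixed_cosets G Q. of_bool (span_rel G x D E) * paths G Q w E C)"

text \<open>The number of \<open>Q\<close>-fixed points of the \<open>G\<close>-set of closed paths
  spelled by \<open>w\<close>: a path is fixed exactly when all its cosets are.\<close>

definition path_trace :: "('g, 'm) monoid_scheme \<Rightarrow> 'g set \<Rightarrow> 'g mackey_gen list \<Rightarrow> int" where
  "path_trace G Q w = (\<Sum>C\<in>fixed_cosets G Q. paths G Q w C C)"

context finite_group begin

lemma finite_subgroup: "subgroup H G \<Longrightarrow> finite H"
  using fin subgroup.subset finite_subset by blast

lemma finite_fixed_cosets [simp]: "finite (fixed_cosets G Q)"
proof (rule finite_subset)
  show "fixed_cosets G Q \<subseteq> Pow (carrier G)"
    unfolding fixed_cosets_def using lcosets_subset_PowG by blast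
qed (use fin in simp)

lemma paths_append:
  assumes "D \<in> fixed_cosets G Q"
  shows "paths G Q (u @ v) D C = (\<Sum>E\<in>fixed_cosets G Q. paths G Q u D E * paths G Q v E C)"
  using assms
proof (induction u arbitrary: D)
  case Nil
  then show ?case by (simp add: of_bool_def if_distrib[of "\<lambda>x. x * _"] sum.delta' cong: if_cong)
next
  case (Cons x u)
  have "paths G Q ((x # u) @ v) D C = (\<Sum>B\<in>fixed_cosets G Q. of_bool (span_rel G x D B) *
      (\<Sum>E\<in>fixed_cosets G Q. paths G Q u B E * paths G Q v E C))"
    using Cons by simp
  also have "\<dots> = (\<Sum>E\<in>fixed_cosets G Q. \<Sum>B\<in>fixed_cosets G Q.
      of_bool (span_rel G x D B) * (paths G Q u B E * paths G Q v E C))"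
    unfolding sum_distrib_left by (rule sum.swap)
  also have "\<dots> = (\<Sum>E\<in>fixed_cosets G Q. paths G Q (x # u) D E * paths G Q v E C)"
    by (simp add: sum_distrib_right mult.assoc)
  finally show ?case .
qed

lemma path_trace_append:
  "path_trace G Q (u @ v) =
    (\<Sum>C\<in>fixed_cosets G Q. \<Sum>E\<in>fixed_cosets G Q. paths G Q u C E * paths G Q v E C)"
  unfolding path_trace_def by (intro sum.cong) (simp_all add: paths_append)

lemma path_trace_commute: "path_trace G Q (u @ v) = path_trace G Q (v @ u)"
  unfolding path_trace_append by (subst sum.swap) (simp add: mult.commute)

lemma paths_single:
  "C \<in> fixed_cosets G Q \<Longrightarrow> paths G Q [x] D C = of_bool (span_rel G x D C)"
  by (simp add: of_bool_def if_distrib[of "\<lambda>x. _ * x"] sum.delta' sum.delta cong: if_cong)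

lemma paths_two:
  "C \<in> fixed_cosets G Q \<Longrightarrow> paths G Q [x, y] D C =
    (\<Sum>E\<in>fixed_cosets G Q. of_bool (span_rel G x D E \<and> span_rel G y E C))"
  unfolding paths.simps(2)[of G Q x] paths_single of_bool_conj ..

text \<open>In most composites of two generators the middle coset is determined by one of the ends,
  so that the matrix entry is 0 or 1.\<close>

lemma paths_unique:
  assumes C: "C \<in> fixed_cosets G Q"
    and unique: "\<And>E. span_rel G x D E \<and> span_rel G y E C \<longleftrightarrow> E = E0 \<and> P"
    and fixed: "P \<Longrightarrow> E0 \<in> fixed_cosets G Q"
  shows "paths G Q [x, y] D C = of_bool P"
proof -
  have "paths G Q [x, y] D C = (\<Sum>E\<in>fixed_cosets G Q. of_bool (span_rel G x D E \<and> span_rel G y E C))"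
    by (rule paths_two[OF C])
  also have "\<dots> = (\<Sum>E\<in>fixed_cosets G Q. if E = E0 then of_bool P else 0)"
    unfolding unique by (intro sum.cong) auto
  also have "\<dots> = of_bool P" using fixed by (cases P) (simp_all add: sum.delta)
  finally show ?thesis .
qed

subsection \<open>Left cosets of different subgroups\<close>

lemma lcosetsI: "a \<in> carrier G \<Longrightarrow> a <# H \<in> lcosets H"
  by (auto simp: LCOSETS_def)

lemma lcosetsE:
  assumes "C \<in> lcosets H"
  obtains a where "a \<in> carrier G" "C = a <# H"
  using assms by (auto simp: LCOSETS_def)

lemma lcoset_carrier: "\<lbrakk>subgroup H G; C \<in> lcosets H\<rbrakk> \<Longrightarrow> C \<subseteq> carrier G"
  using lcosets_subset_PowG by blast

lemma lcoset_repr: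
  assumes "subgroup H G" "C \<in> lcosets H" "a \<in> C"
  shows "a \<in> carrier G" "C = a <# H"
  using assms lcoset_carrier[OF assms(1,2)] l_repr_independence[OF _ _ assms(1)]
  by (auto elim!: lcosetsE)

lemma lcoset_nonempty:
  assumes "subgroup H G" "C \<in> lcosets H"
  obtains a where "a \<in> C"
  using assms lcos_self[OF _ assms(1)] by (elim lcosetsE) blast

lemma lcoset_mem_iff:
  assumes "subgroup H G" "a \<in> carrier G" "b \<in> carrier G"
  shows "b \<in> a <# H \<longleftrightarrow> inv a \<otimes> b \<in> H"
proof
  interpret H: subgroup H G by fact
  show "b \<in> a <# H \<Longrightarrow> inv a \<otimes> b \<in> H" using H.lcos_module_imp[OF group_axioms assms(2)] .
  assume "inv a \<otimes> b \<in> H"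
  then have "a \<otimes> (inv a \<otimes> b) \<in> a <# H" by (auto simp: l_coset_def)
  then show "b \<in> a <# H" using assms by (simp add: inv_mult_cancel_left)
qed

lemma lcoset_subgroup_unique:
  assumes "subgroup H G" "subgroup K G" "C \<in> lcosets H" "C \<in> lcosets K"
  shows "H = K"
proof -
  obtain a where a: "a \<in> C" using lcoset_nonempty[OF assms(1,3)] .
  have "a <# H = a <# K" "a \<in> carrier G"
    using lcoset_repr[OF assms(1,3) a] lcoset_repr[OF assms(2,4) a] by auto
  then have "inv a <# (a <# H) = inv a <# (a <# K)" "a \<in> carrier G" by auto
  then show ?thesis
    using subgroup.subset[OF assms(1)] subgroup.subset[OF assms(2)]
    by (simp add: lcos_m_assoc lcos_mult_one)
qed

lemma lcoset_subset_eq: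
  assumes "subgroup H G" "C \<in> lcosets H" "D \<in> lcosets H"
  shows "C \<subseteq> D \<longleftrightarrow> C = D"
  using lcoset_nonempty[OF assms(1,2)] lcos_disjoint[OF assms] by blast

lemma lcoset_subset_iff:
  assumes "subgroup H G" "subgroup K G" "H \<subseteq> K" "C \<in> lcosets H" "D \<in> lcosets K" "a \<in> C"
  shows "C \<subseteq> D \<longleftrightarrow> D = a <# K"
proof
  assume "C \<subseteq> D" then show "D = a <# K" using lcoset_repr(2)[OF assms(2,5)] assms(6) by blast
next
  assume "D = a <# K" then show "C \<subseteq> D"
    using lcoset_repr(2)[OF assms(1,4,6)] assms(3) by (auto simp: l_coset_def)
qed

lemma lcoset_act: "\<lbrakk>subgroup H G; C \<in> lcosets H; g \<in> carrier G\<rbrakk> \<Longrightarrow> g <# C \<in> lcosets H"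
  using subgroup.subset[of H G] by (auto simp: LCOSETS_def lcos_m_assoc)

lemma fixed_cosetI:
  "\<lbrakk>subgroup H G; C \<in> lcosets H; \<And>q. q \<in> Q \<Longrightarrow> q <# C = C\<rbrakk> \<Longrightarrow> C \<in> fixed_cosets G Q"
  by (auto simp: fixed_cosets_def)

text \<open>Projections of coset spaces are equivariant. This ensures that the middle coset forced
  by a path does occur in the sum over fixed cosets.\<close>

lemma fixed_coset_superset:
  assumes "Q \<subseteq> carrier G" "C \<in> fixed_cosets G Q" "subgroup K G" "D \<in> lcosets K" "C \<subseteq> D"
  shows "D \<in> fixed_cosets G Q"
proof (rule fixed_cosetI[OF assms(3,4)])
  fix q assume q: "q \<in> Q"
  obtain H where H: "subgroup H G" "C \<in> lcosets H" using assms(2) by (auto simp: fixed_cosets_def)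
  obtain a where a: "a \<in> C" using lcoset_nonempty[OF H] .
  then have "q \<otimes> a \<in> q <# C" by (auto simp: l_coset_def)
  then have "q \<otimes> a \<in> D" using assms(2,5) q by (auto simp: fixed_cosets_def)
  moreover have "q \<otimes> a \<in> q <# D" using a assms(5) by (auto simp: l_coset_def)
  ultimately show "q <# D = D"
    using lcos_disjoint[OF assms(3) lcoset_act[OF assms(3,4)] assms(4)] q assms(1) by blast
qed

lemma rcos_inv_cancel:
  assumes "C \<subseteq> carrier G" "g \<in> carrier G"
  shows "(C #> inv g) #> g = C" "(C #> g) #> inv g = C"
  using assms by (simp_all add: coset_mult_assoc coset_mult_one)

lemma lcoset_rmult:
  assumes "subgroup H G" "g \<in> carrier G" "C \<in> lcosets H"
  shows "C #> inv g \<in> lcosets (conjugate G g H)"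
proof -
  obtain a where a: "a \<in> carrier G" "C = a <# H" using assms(3) by (rule lcosetsE)
  have "C #> inv g = (a \<otimes> inv g) <# conjugate G g H"
  proof -
    have eq: "(a \<otimes> h) \<otimes> inv g = (a \<otimes> inv g) \<otimes> (g \<otimes> h \<otimes> inv g)" if "h \<in> H" for h
      using subgroup.mem_carrier[OF assms(1) that] assms(2) a(1)
      by (simp add: m_assoc inv_mult_cancel_left)
    show ?thesis
    proof (intro equalityI subsetI)
      fix y assume "y \<in> C #> inv g"
      then obtain h where "h \<in> H" "y = (a \<otimes> h) \<otimes> inv g" using a by (auto simp: r_coset_def l_coset_def)
      then show "y \<in> (a \<otimes> inv g) <# conjugate G g H"
        using eq by (auto simp: l_coset_def conjugate_def)
    next
      fix y assume "y \<in> (a \<otimes> inv g) <# conjugate G g H"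
      then obtain h where "h \<in> H" "y = (a \<otimes> inv g) \<otimes> (g \<otimes> h \<otimes> inv g)"
        by (auto simp: l_coset_def conjugate_def)
      then show "y \<in> C #> inv g"
        using eq a by (auto simp: l_coset_def r_coset_def)
    qed
  qed
  then show ?thesis using a assms(2) by (auto intro: lcosetsI)
qed

lemma lcoset_rmult':
  assumes "subgroup H G" "g \<in> carrier G" "C \<in> lcosets (conjugate G g H)"
  shows "C #> g \<in> lcosets H"
  using lcoset_rmult[OF conjugate_subgroup[OF assms(1,2)] inv_closed[OF assms(2)] assms(3)] assms
  by (simp add: conjugate_inv_cancel subgroup.subset)

lemma rcos_mono: "C \<subseteq> D \<Longrightarrow> C #> g \<subseteq> D #> g"
  by (auto simp: r_coset_def)

lemma rcos_subset_iff:
  assumes "C \<subseteq> carrier G" "D \<subseteq> carrier G" "g \<in> carrier G"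
  shows "C #> inv g \<subseteq> D \<longleftrightarrow> C \<subseteq> D #> g" "C \<subseteq> D #> inv g \<longleftrightarrow> C #> g \<subseteq> D"
  using assms rcos_mono rcos_inv_cancel by metis+

lemma fixed_coset_rmult:
  assumes "Q \<subseteq> carrier G" "C \<in> fixed_cosets G Q" "g \<in> carrier G"
  shows "C #> g \<in> fixed_cosets G Q"
proof -
  obtain H where H: "subgroup H G" "C \<in> lcosets H" using assms(2) by (auto simp: fixed_cosets_def)
  have C: "C \<subseteq> carrier G" using lcoset_carrier[OF H] .
  show ?thesis
  proof (rule fixed_cosetI)
    show "subgroup (conjugate G (inv g) H) G" using conjugate_subgroup[OF H(1)] assms(3) by simp
    show "C #> g \<in> lcosets (conjugate G (inv g) H)"
      using lcoset_rmult[OF H(1) _ H(2), of "inv g"] assms(3) by simp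
    fix q assume "q \<in> Q"
    then show "q <# (C #> g) = C #> g"
      using assms C coset_assoc[of q g C] by (auto simp: fixed_cosets_def)
  qed
qed

lemma fixed_coset_carrier: "C \<in> fixed_cosets G Q \<Longrightarrow> C \<subseteq> carrier G"
  using lcoset_carrier by (auto simp: fixed_cosets_def)

lemma span_rel_source: "span_rel G x D C \<Longrightarrow> C \<in> lcosets (source x)"
  by (cases x) auto

lemma span_rel_target:
  "\<lbrakk>span_rel G x D C; x \<in> mackey_gens G\<rbrakk> \<Longrightarrow> D \<in> lcosets (target G x)"
  by (cases x) (auto simp: mackey_gens_def intro: lcoset_rmult)

lemma source_subgroup: "x \<in> mackey_gens G \<Longrightarrow> subgroup (source x) G"
  by (auto simp: mackey_gens_def)

lemma target_subgroup: "x \<in> mackey_gens G \<Longrightarrow> subgroup (target G x) G"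
  by (auto simp: mackey_gens_def conjugate_subgroup)

lemma lcoset_fixed: "C \<in> fixed_cosets G Q \<Longrightarrow> q \<in> Q \<Longrightarrow> q <# C = C"
  by (simp add: fixed_cosets_def)

lemma paths_tr_tr:
  assumes Q: "Q \<subseteq> carrier G" and "subgroup H G" "subgroup K G" "subgroup L G" "H \<subseteq> K" "K \<subseteq> L"
    and C: "C \<in> fixed_cosets G Q"
  shows "paths G Q [Tr L K, Tr K H] D C = of_bool (C \<in> lcosets H \<and> D \<in> lcosets L \<and> C \<subseteq> D)"
proof (cases "C \<in> lcosets H")
  case True
  obtain a where a: "a \<in> C" using lcoset_nonempty[OF assms(2) True] .
  have aG: "a \<in> carrier G" using fixed_coset_carrier[OF C] a by blast
  have aK: "a <# K \<in> lcosets K" "C \<subseteq> a <# K"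
    using lcoset_subset_iff[OF assms(2,3,5) True _ a] lcosetsI[OF aG] by auto
  have HL: "H \<subseteq> L" using assms by blast
  have aaK: "a \<in> a <# K" using aK a by blast
  show ?thesis
  proof (rule paths_unique[OF C, where ?E0.0 = "a <# K"])
    fix E
    have "C \<subseteq> D \<longleftrightarrow> a <# K \<subseteq> D" if "D \<in> lcosets L"
      using lcoset_subset_iff[OF assms(2,4) HL True that a]
        lcoset_subset_iff[OF assms(3,4,6) aK(1) that aaK] by simp
    then show "span_rel G (Tr L K) D E \<and> span_rel G (Tr K H) E C \<longleftrightarrow>
        E = a <# K \<and> C \<in> lcosets H \<and> D \<in> lcosets L \<and> C \<subseteq> D"
      using lcoset_subset_iff[OF assms(2,3,5) True _ a, of E] aK True by auto
  qed (use fixed_coset_superset[OF Q C assms(3) aK] in auto)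
qed (simp add: paths_unique[OF C, where P = False])

text \<open>Restrictions are transposed transfers; this reduces transitivity of restriction to
  transitivity of transfer.\<close>

lemma paths_res_res_transpose:
  assumes "C \<in> fixed_cosets G Q" "D \<in> fixed_cosets G Q"
  shows "paths G Q [Res K H, Res L K] D C = paths G Q [Tr L K, Tr K H] C D"
  unfolding paths_two[OF assms(1)] paths_two[OF assms(2)] by (intro sum.cong refl) auto

lemma paths_conj_conj:
  assumes Q: "Q \<subseteq> carrier G" and "subgroup H G" "g \<in> carrier G" "g' \<in> carrier G"
    and C: "C \<in> fixed_cosets G Q"
  shows "paths G Q [Conj g' (conjugate G g H), Conj g H] D C =
    of_bool (span_rel G (Conj (g' \<otimes> g) H) D C)"
proof (rule paths_unique[OF C, where ?E0.0 = "C #> inv g"])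
  have "(C #> inv g) #> inv g' = C #> inv (g' \<otimes> g)"
    using fixed_coset_carrier[OF C] assms by (simp add: coset_mult_assoc inv_mult_group)
  then show "span_rel G (Conj g' (conjugate G g H)) D E \<and> span_rel G (Conj g H) E C \<longleftrightarrow>
      E = C #> inv g \<and> span_rel G (Conj (g' \<otimes> g) H) D C" for E
    using lcoset_rmult[OF assms(2,3)] by auto
qed (use fixed_coset_rmult[OF Q C] assms in auto)

lemma paths_tr_conj:
  assumes Q: "Q \<subseteq> carrier G" and "subgroup H G" "subgroup K G" "g \<in> carrier G"
    and C: "C \<in> fixed_cosets G Q" and D: "D \<in> fixed_cosets G Q"
  shows "paths G Q [Tr (conjugate G g K) (conjugate G g H), Conj g H] D C =
    of_bool (C \<in> lcosets H \<and> D \<in> lcosets (conjugate G g K) \<and> C #> inv g \<subseteq> D)"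
    "paths G Q [Conj g K, Tr K H] D C =
    of_bool (C \<in> lcosets H \<and> D \<in> lcosets (conjugate G g K) \<and> C #> inv g \<subseteq> D)"
proof -
  show "paths G Q [Tr (conjugate G g K) (conjugate G g H), Conj g H] D C =
    of_bool (C \<in> lcosets H \<and> D \<in> lcosets (conjugate G g K) \<and> C #> inv g \<subseteq> D)"
    by (rule paths_unique[OF C, where ?E0.0 = "C #> inv g"])
      (use fixed_coset_rmult[OF Q C] lcoset_rmult[OF assms(2,4)] assms(4) in auto)
  show "paths G Q [Conj g K, Tr K H] D C =
    of_bool (C \<in> lcosets H \<and> D \<in> lcosets (conjugate G g K) \<and> C #> inv g \<subseteq> D)"
  proof (rule paths_unique[OF C, where ?E0.0 = "D #> g"])
    fix E
    have sub: "C \<subseteq> carrier G" "D \<subseteq> carrier G" using C D fixed_coset_carrier by auto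
    have "span_rel G (Conj g K) D E \<and> span_rel G (Tr K H) E C \<longleftrightarrow>
        E \<in> lcosets K \<and> D = E #> inv g \<and> C \<in> lcosets H \<and> C \<subseteq> E" by auto
    also have "\<dots> \<longleftrightarrow> E = D #> g \<and> D #> g \<in> lcosets K \<and> C \<in> lcosets H \<and> C \<subseteq> D #> g"
      using rcos_inv_cancel[OF sub(2) assms(4)] rcos_inv_cancel[OF lcoset_carrier[OF assms(3)] assms(4)]
      by auto
    also have "\<dots> \<longleftrightarrow> E = D #> g \<and> C \<in> lcosets H \<and> D \<in> lcosets (conjugate G g K) \<and> C #> inv g \<subseteq> D"
      using lcoset_rmult'[OF assms(3,4), of D] lcoset_rmult[OF assms(3,4), of "D #> g"]
        rcos_inv_cancel[OF sub(2) assms(4)] rcos_subset_iff(1)[OF sub assms(4)] by auto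
    finally show "span_rel G (Conj g K) D E \<and> span_rel G (Tr K H) E C \<longleftrightarrow>
        E = D #> g \<and> C \<in> lcosets H \<and> D \<in> lcosets (conjugate G g K) \<and> C #> inv g \<subseteq> D" .
  qed (use fixed_coset_rmult[OF Q D assms(4)] in simp)
qed

lemma paths_res_conj:
  assumes Q: "Q \<subseteq> carrier G" and "subgroup H G" "subgroup K G" "g \<in> carrier G"
    and C: "C \<in> fixed_cosets G Q" and D: "D \<in> fixed_cosets G Q"
  shows "paths G Q [Res (conjugate G g K) (conjugate G g H), Conj g K] D C =
    of_bool (C \<in> lcosets K \<and> D \<in> lcosets (conjugate G g H) \<and> D #> g \<subseteq> C)"
    "paths G Q [Conj g H, Res K H] D C =
    of_bool (C \<in> lcosets K \<and> D \<in> lcosets (conjugate G g H) \<and> D #> g \<subseteq> C)"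
proof -
  have sub: "C \<subseteq> carrier G" "D \<subseteq> carrier G" using C D fixed_coset_carrier by auto
  show "paths G Q [Res (conjugate G g K) (conjugate G g H), Conj g K] D C =
    of_bool (C \<in> lcosets K \<and> D \<in> lcosets (conjugate G g H) \<and> D #> g \<subseteq> C)"
    by (rule paths_unique[OF C, where ?E0.0 = "C #> inv g"])
      (use fixed_coset_rmult[OF Q C] lcoset_rmult[OF assms(3,4)] assms(4)
        rcos_subset_iff(2)[OF sub(2,1) assms(4)] in auto)
  show "paths G Q [Conj g H, Res K H] D C =
    of_bool (C \<in> lcosets K \<and> D \<in> lcosets (conjugate G g H) \<and> D #> g \<subseteq> C)"
  proof (rule paths_unique[OF C, where ?E0.0 = "D #> g"])
    fix E
    have "span_rel G (Conj g H) D E \<and> span_rel G (Res K H) E C \<longleftrightarrow>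
        E \<in> lcosets H \<and> D = E #> inv g \<and> C \<in> lcosets K \<and> E \<subseteq> C" by auto
    also have "\<dots> \<longleftrightarrow> E = D #> g \<and> D #> g \<in> lcosets H \<and> C \<in> lcosets K \<and> D #> g \<subseteq> C"
      using rcos_inv_cancel[OF sub(2) assms(4)] rcos_inv_cancel[OF lcoset_carrier[OF assms(2)] assms(4)]
      by auto
    also have "\<dots> \<longleftrightarrow> E = D #> g \<and> C \<in> lcosets K \<and> D \<in> lcosets (conjugate G g H) \<and> D #> g \<subseteq> C"
      using lcoset_rmult'[OF assms(2,4), of D] lcoset_rmult[OF assms(2,4), of "D #> g"]
        rcos_inv_cancel[OF sub(2) assms(4)] by auto
    finally show "span_rel G (Conj g H) D E \<and> span_rel G (Res K H) E C \<longleftrightarrow>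
        E = D #> g \<and> C \<in> lcosets K \<and> D \<in> lcosets (conjugate G g H) \<and> D #> g \<subseteq> C" .
  qed (use fixed_coset_rmult[OF Q D assms(4)] in simp)
qed

lemma span_rel_self:
  assumes "subgroup H G"
  shows "span_rel G (Tr H H) D C \<longleftrightarrow> C \<in> lcosets H \<and> D = C"
    "span_rel G (Res H H) D C \<longleftrightarrow> C \<in> lcosets H \<and> D = C"
    "h \<in> H \<Longrightarrow> span_rel G (Conj h H) D C \<longleftrightarrow> C \<in> lcosets H \<and> D = C"
proof -
  show "span_rel G (Tr H H) D C \<longleftrightarrow> C \<in> lcosets H \<and> D = C"
    "span_rel G (Res H H) D C \<longleftrightarrow> C \<in> lcosets H \<and> D = C"
    using lcoset_subset_eq[OF assms] by auto
  assume h: "h \<in> H"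
  interpret H: subgroup H G by fact
  have "C #> inv h = C" if C: "C \<in> lcosets H"
  proof -
    obtain a where a: "a \<in> carrier G" "C = a <# H" using C by (rule lcosetsE)
    then have "C #> inv h = a <# (H #> inv h)" using coset_assoc[of a "inv h" H] h H.subset by simp
    also have "H #> inv h = H" using coset_join2[of "inv h" H] h assms by simp
    finally show ?thesis using a by simp
  qed
  then show "span_rel G (Conj h H) D C \<longleftrightarrow> C \<in> lcosets H \<and> D = C" by auto
qed

section \<open>The Mackey formula as the decomposition of a fibre product of coset spaces\<close>

lemma paths_mackey_left:
  assumes Q: "Q \<subseteq> carrier G" and "subgroup H G" "subgroup K G" "subgroup L G" "K \<subseteq> H" "L \<subseteq> H"
    and C: "C \<in> fixed_cosets G Q" "C = a <# K" "a \<in> carrier G"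
    and D: "D = b <# L" "b \<in> carrier G"
  shows "paths G Q [Res H L, Tr H K] D C = of_bool (inv b \<otimes> a \<in> H)"
proof (rule paths_unique[OF C(1), where ?E0.0 = "a <# H"])
  have C': "C \<in> lcosets K" "a \<in> C" using C lcosetsI lcos_self[OF _ assms(3)] by auto
  have D': "D \<in> lcosets L" "b \<in> D" using D lcosetsI lcos_self[OF _ assms(4)] by auto
  fix E
  have "span_rel G (Res H L) D E \<and> span_rel G (Tr H K) E C \<longleftrightarrow> E \<in> lcosets H \<and> E = a <# H \<and> E = b <# H"
    using lcoset_subset_iff[OF assms(3,2,5) C'(1) _ C'(2), of E]
      lcoset_subset_iff[OF assms(4,2,6) D'(1) _ D'(2), of E] C' D' by auto
  also have "\<dots> \<longleftrightarrow> E = a <# H \<and> a <# H = b <# H" using lcosetsI[OF C(3), of H] by auto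
  also have "a <# H = b <# H \<longleftrightarrow> a \<in> b <# H"
    using lcos_self[OF C(3) assms(2)] l_repr_independence[OF _ D(2) assms(2), of a] by auto
  also have "a \<in> b <# H \<longleftrightarrow> inv b \<otimes> a \<in> H" by (rule lcoset_mem_iff[OF assms(2) D(2) C(3)])
  finally show "span_rel G (Res H L) D E \<and> span_rel G (Tr H K) E C \<longleftrightarrow> E = a <# H \<and> inv b \<otimes> a \<in> H" .
next
  have "C \<subseteq> a <# H" using assms(5) C(2) by (auto simp: l_coset_def)
  then show "a <# H \<in> fixed_cosets G Q"
    using fixed_coset_superset[OF Q C(1) assms(2) lcosetsI[OF C(3)]] by simp
qed

lemma conjugate_conjugate_right_Int:
  assumes "subgroup K G" "subgroup L G" "h \<in> carrier G"
  shows "conjugate G h (conjugate_right G L h \<inter> K) = L \<inter> conjugate G h K"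
  using assms conjugate_inv_cancel(2)[OF subgroup.subset[OF assms(2)] assms(3)]
    conjugate_Int[of "conjugate G (inv h) L" K h]
    conjugate_closed[OF subgroup.subset[OF assms(2)]] subgroup.subset[OF assms(1)]
  by (simp add: conjugate_right_eq)

lemma conjugate_right_Int_subgroup:
  "\<lbrakk>subgroup K G; subgroup L G; h \<in> carrier G\<rbrakk> \<Longrightarrow> subgroup (conjugate_right G L h \<inter> K) G"
  by (simp add: conjugate_right_eq subgroups_Inter_pair conjugate_subgroup)

lemma lcoset_Int:
  assumes "subgroup H G" "subgroup K G" "C \<in> lcosets H" "D \<in> lcosets K"
  shows "E \<in> lcosets (H \<inter> K) \<and> E \<subseteq> C \<and> E \<subseteq> D \<longleftrightarrow> E = C \<inter> D \<and> C \<inter> D \<noteq> {}"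
proof -
  have HK: "subgroup (H \<inter> K) G" using subgroups_Inter_pair[OF assms(1,2)] .
  have eq: "a <# (H \<inter> K) = C \<inter> D" if "a \<in> C \<inter> D" for a
  proof -
    have a: "a \<in> carrier G" "C = a <# H" "D = a <# K"
      using lcoset_repr[OF assms(1,3)] lcoset_repr[OF assms(2,4)] that by auto
    show ?thesis
    proof (intro equalityI subsetI)
      fix y assume y: "y \<in> C \<inter> D"
      then have yG: "y \<in> carrier G" using lcoset_carrier[OF assms(1,3)] by blast
      show "y \<in> a <# (H \<inter> K)"
        using y a yG lcoset_mem_iff[OF HK a(1) yG] lcoset_mem_iff[OF assms(1) a(1) yG]
          lcoset_mem_iff[OF assms(2) a(1) yG] by auto
    qed (use a in \<open>auto simp: l_coset_def\<close>)
  qed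
  show ?thesis
  proof
    assume E: "E \<in> lcosets (H \<inter> K) \<and> E \<subseteq> C \<and> E \<subseteq> D"
    then obtain a where "a \<in> E" using lcoset_nonempty[OF HK] by blast
    then show "E = C \<inter> D \<and> C \<inter> D \<noteq> {}"
      using eq[of a] lcoset_repr(2)[OF HK, of E a] E by auto
  next
    assume E: "E = C \<inter> D \<and> C \<inter> D \<noteq> {}"
    then obtain a where a: "a \<in> C \<inter> D" by blast
    then have "a \<in> carrier G" using lcoset_carrier[OF assms(1,3)] by blast
    then show "E \<in> lcosets (H \<inter> K) \<and> E \<subseteq> C \<and> E \<subseteq> D" using E eq[OF a] lcosetsI[of a "H \<inter> K"] by auto
  qed
qed

lemma lcoset_Int_inv:
  assumes "q \<in> carrier G" "C \<subseteq> carrier G" "D \<subseteq> carrier G"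
  shows "q <# (C \<inter> D) = (q <# C) \<inter> (q <# D)"
proof -
  have "inj_on (\<lambda>y. q \<otimes> y) (carrier G)" using assms(1) by (rule inj_on_cmult)
  then have "(\<lambda>y. q \<otimes> y) ` (C \<inter> D) = (\<lambda>y. q \<otimes> y) ` C \<inter> (\<lambda>y. q \<otimes> y) ` D"
    using assms by (intro inj_on_image_Int) auto
  then show ?thesis by (simp add: l_coset_def UNION_singleton_eq_range)
qed

text \<open>A path through this word is determined by the coset reached just before the transfer. It
  is contained in \<open>D\<close> and in the translate of \<open>C\<close>, and by
  \<open>lcoset_Int\<close> it can only be their intersection.\<close>

lemma paths_mackey_right:
  assumes Q: "Q \<subseteq> carrier G" and "subgroup K G" "subgroup L G" "h \<in> carrier G"
    and C: "C \<in> fixed_cosets G Q" "C \<in> lcosets K"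
    and D: "D \<in> fixed_cosets G Q" "D \<in> lcosets L"
  shows "paths G Q [Tr L (L \<inter> conjugate G h K), Conj h (conjugate_right G L h \<inter> K),
      Res K (conjugate_right G L h \<inter> K)] D C = of_bool (D \<inter> (C #> inv h) \<noteq> {})"
proof -
  let ?J = "conjugate_right G L h \<inter> K" and ?E = "D \<inter> (C #> inv h)"
  have J: "subgroup ?J G" by (rule conjugate_right_Int_subgroup[OF assms(2-4)])
  have hJ: "conjugate G h ?J = L \<inter> conjugate G h K" by (rule conjugate_conjugate_right_Int[OF assms(2-4)])
  have hK: "subgroup (conjugate G h K) G" by (rule conjugate_subgroup[OF assms(2,4)])
  have Ch: "C #> inv h \<in> lcosets (conjugate G h K)" by (rule lcoset_rmult[OF assms(2,4) C(2)])
  have CG: "C \<subseteq> carrier G" and DG: "D \<subseteq> carrier G" using C D fixed_coset_carrier by auto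
  have two: "paths G Q [Conj h ?J, Res K ?J] E C = of_bool (E \<in> lcosets (L \<inter> conjugate G h K) \<and> E \<subseteq> C #> inv h)"
    if E: "E \<in> fixed_cosets G Q" for E
    using paths_res_conj(2)[OF Q J assms(2,4) C(1) E] C(2) hJ
      rcos_subset_iff(2)[OF fixed_coset_carrier[OF E] CG assms(4)] by (simp del: paths.simps)
  have "paths G Q [Tr L (L \<inter> conjugate G h K), Conj h ?J, Res K ?J] D C =
      (\<Sum>E\<in>fixed_cosets G Q. of_bool (span_rel G (Tr L (L \<inter> conjugate G h K)) D E) *
        paths G Q [Conj h ?J, Res K ?J] E C)" by (rule paths.simps(2))
  also have "\<dots> = (\<Sum>E\<in>fixed_cosets G Q. if E = ?E then of_bool (?E \<noteq> {}) else 0)"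
  proof (rule sum.cong[OF refl])
    fix E assume E: "E \<in> fixed_cosets G Q"
    have "of_bool (span_rel G (Tr L (L \<inter> conjugate G h K)) D E) * paths G Q [Conj h ?J, Res K ?J] E C =
        of_bool (E \<in> lcosets (L \<inter> conjugate G h K) \<and> E \<subseteq> D \<and> E \<subseteq> C #> inv h)"
      unfolding two[OF E] using D(2) by auto
    also have "\<dots> = of_bool (E = ?E \<and> ?E \<noteq> {})"
      using lcoset_Int[OF assms(3) hK D(2) Ch, of E] by simp
    finally show "of_bool (span_rel G (Tr L (L \<inter> conjugate G h K)) D E) * paths G Q [Conj h ?J, Res K ?J] E C =
        (if E = ?E then of_bool (?E \<noteq> {}) else 0)" by simp
  qed
  also have "\<dots> = of_bool (?E \<noteq> {})"
  proof (cases "?E = {}")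
    case False
    have "?E \<in> lcosets (L \<inter> conjugate G h K)"
      using lcoset_Int[OF assms(3) hK D(2) Ch, of ?E] False by auto
    then have "?E \<in> fixed_cosets G Q"
    proof (rule fixed_cosetI[OF subgroups_Inter_pair[OF assms(3) hK]])
      fix q assume q: "q \<in> Q"
      have "C #> inv h \<in> fixed_cosets G Q" using fixed_coset_rmult[OF Q C(1)] assms(4) by simp
      then show "q <# ?E = ?E"
        using lcoset_Int_inv[of q D "C #> inv h"] q Q DG lcoset_carrier[OF hK Ch]
          lcoset_fixed[OF D(1) q] lcoset_fixed[of "C #> inv h" Q q] by auto
    qed
    then show ?thesis by (simp add: sum.delta)
  qed simp
  finally show ?thesis .
qed

lemma mem_double_coset:
  assumes "subgroup L G" "subgroup K G" "x \<in> carrier G"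
  shows "d \<in> (L #> x) <#> K \<longleftrightarrow> (\<exists>l\<in>L. \<exists>k\<in>K. d = l \<otimes> x \<otimes> k)"
  by (auto simp: r_coset_def set_mult_def)

text \<open>The summand at \<open>h\<close> is 1 exactly when \<open>h\<close> lies in the double
  coset of \<open>inv b \<otimes> a\<close>. The representatives meet every double coset inside
  \<open>H\<close> once, and none outside \<open>H\<close>.\<close>

lemma mackey_double_coset:
  assumes "subgroup H G" "subgroup K G" "subgroup L G" "K \<subseteq> H" "L \<subseteq> H" "double_coset_reps G L H K R"
    and "a \<in> carrier G" "b \<in> carrier G"
  shows "(\<Sum>h\<in>R. of_bool ((b <# L) \<inter> ((a <# K) #> inv h) \<noteq> {})) = (of_bool (inv b \<otimes> a \<in> H) :: int)"
proof -
  interpret H: subgroup H G by fact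
  interpret K: subgroup K G by fact
  interpret L: subgroup L G by fact
  let ?x = "inv b \<otimes> a"
  have RH: "R \<subseteq> H" and ex1: "\<And>x. x \<in> H \<Longrightarrow> \<exists>!d. d \<in> R \<and> d \<in> (L #> x) <#> K"
    using assms(6) by (auto simp: double_coset_reps_def)
  have finR: "finite R" using RH finite_subgroup[OF assms(1)] finite_subset by blast
  have iff: "(b <# L) \<inter> ((a <# K) #> inv h) \<noteq> {} \<longleftrightarrow> h \<in> (L #> ?x) <#> K" if h: "h \<in> R" for h
  proof -
    have hG: "h \<in> carrier G" using h RH by auto
    have "(b <# L) \<inter> ((a <# K) #> inv h) \<noteq> {} \<longleftrightarrow> (\<exists>l\<in>L. \<exists>k\<in>K. b \<otimes> l = a \<otimes> k \<otimes> inv h)"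
      by (auto simp: l_coset_def r_coset_def)
    also have "\<dots> \<longleftrightarrow> (\<exists>l\<in>L. \<exists>k\<in>K. h = inv l \<otimes> ?x \<otimes> k)"
    proof (intro bex_cong refl)
      fix l k assume l: "l \<in> L" and k: "k \<in> K"
      have lk: "l \<in> carrier G" "k \<in> carrier G" using l k by auto
      show "b \<otimes> l = a \<otimes> k \<otimes> inv h \<longleftrightarrow> h = inv l \<otimes> ?x \<otimes> k"
      proof
        assume "b \<otimes> l = a \<otimes> k \<otimes> inv h"
        then have "inv l \<otimes> inv b \<otimes> (b \<otimes> l) \<otimes> h = inv l \<otimes> inv b \<otimes> (a \<otimes> k \<otimes> inv h) \<otimes> h" by simp
        then show "h = inv l \<otimes> ?x \<otimes> k"
          using lk hG assms(7,8) by (simp add: m_assoc inv_mult_cancel_left)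
      next
        assume "h = inv l \<otimes> ?x \<otimes> k"
        then show "b \<otimes> l = a \<otimes> k \<otimes> inv h"
          using lk assms(7,8) by (simp add: m_assoc inv_mult_group inv_mult_cancel_left)
      qed
    qed
    also have "\<dots> \<longleftrightarrow> (\<exists>l\<in>L. \<exists>k\<in>K. h = l \<otimes> ?x \<otimes> k)"
      by (metis L.m_inv_closed L.mem_carrier inv_inv)
    finally show ?thesis using mem_double_coset[OF assms(3,2)] assms(7,8) by simp
  qed
  show ?thesis
  proof (cases "?x \<in> H")
    case True
    from ex1[OF True] obtain d where d: "d \<in> R" "d \<in> (L #> ?x) <#> K"
      and u: "\<And>e. e \<in> R \<Longrightarrow> e \<in> (L #> ?x) <#> K \<Longrightarrow> e = d" by blast
    have "(\<Sum>h\<in>R. of_bool ((b <# L) \<inter> ((a <# K) #> inv h) \<noteq> {})) = (\<Sum>h\<in>R. if h = d then 1 else 0 :: int)"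
    proof (intro sum.cong refl)
      fix h assume h: "h \<in> R"
      then have "h \<in> (L #> ?x) <#> K \<longleftrightarrow> h = d" using d u by blast
      then show "of_bool ((b <# L) \<inter> ((a <# K) #> inv h) \<noteq> {}) = (if h = d then 1 else 0 :: int)"
        unfolding iff[OF h] by simp
    qed
    then show ?thesis using finR d True by (simp add: sum.delta)
  next
    case False
    have "\<not> h \<in> (L #> ?x) <#> K" if h: "h \<in> R" for h
    proof
      assume "h \<in> (L #> ?x) <#> K"
      then obtain l k where lk: "l \<in> L" "k \<in> K" "h = l \<otimes> ?x \<otimes> k"
        using mem_double_coset[OF assms(3,2)] assms(7,8) by auto
      then have "?x = inv l \<otimes> h \<otimes> inv k" using assms(7,8) by (simp add: m_assoc inv_mult_cancel_left)
      moreover have "l \<in> H" "k \<in> H" "h \<in> H" using lk h RH assms(4,5) by blast+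
      ultimately have "?x \<in> H" by (simp only: H.m_closed H.m_inv_closed)
      then show False using False by blast
    qed
    then show ?thesis using iff False by (simp add: sum.neutral)
  qed
qed

end

section \<open>Unitriangular forms on integral modules\<close>

lemma finsum_additive:
  fixes \<phi> :: "'a \<Rightarrow> int"
  assumes "abelian_group M" "finite D" "\<And>i. i \<in> D \<Longrightarrow> h i \<in> carrier M"
    and add: "\<And>x y. \<lbrakk>x \<in> carrier M; y \<in> carrier M\<rbrakk> \<Longrightarrow> \<phi> (x \<oplus>\<^bsub>M\<^esub> y) = \<phi> x + \<phi> y"
  shows "\<phi> (\<Oplus>\<^bsub>M\<^esub>i\<in>D. h i) = (\<Sum>i\<in>D. \<phi> (h i))"
proof -
  interpret abelian_group M by fact
  have zero: "\<phi> \<zero>\<^bsub>M\<^esub> = 0" using add[of "\<zero>\<^bsub>M\<^esub>" "\<zero>\<^bsub>M\<^esub>"] by simp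
  show ?thesis
    using assms(2,3)
  proof (induction D rule: finite_induct)
    case (insert i D)
    then have "finsum M h (insert i D) = h i \<oplus>\<^bsub>M\<^esub> finsum M h D" by (intro finsum_insert) auto
    moreover have "finsum M h D \<in> carrier M" using insert by (intro finsum_closed) auto
    ultimately show ?case using insert add by simp
  qed (simp add: zero)
qed

locale int_module = module \<Z> M for M :: "(int, 'a, 'n) module_scheme" (structure)
begin

definition int_span :: "'a set \<Rightarrow> 'a set" where
  "int_span B = {x. \<exists>c. x = (\<Oplus>b\<in>B. c b \<odot> b)}"

lemma int_smult_closed [simp]: "x \<in> carrier M \<Longrightarrow> (a::int) \<odot> x \<in> carrier M"
  by (rule smult_closed) auto

lemma int_smult_distr:
  "x \<in> carrier M \<Longrightarrow> (a + b) \<odot> x = a \<odot> x \<oplus> b \<odot> x"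
  "\<lbrakk>x \<in> carrier M; y \<in> carrier M\<rbrakk> \<Longrightarrow> a \<odot> (x \<oplus> y) = a \<odot> x \<oplus> a \<odot> y"
  "x \<in> carrier M \<Longrightarrow> a \<odot> (b \<odot> x) = (a * b) \<odot> x"
  "x \<in> carrier M \<Longrightarrow> (0::int) \<odot> x = \<zero>"
  "x \<in> carrier M \<Longrightarrow> (1::int) \<odot> x = x"
  "a \<odot> \<zero> = \<zero>"
  using smult_l_distr[of a b x] smult_r_distr[of a x y] smult_assoc1[of a b x] smult_l_null[of x]
    smult_one[of x] smult_r_null[of a] by simp_all

lemma finsum_smult_closed: "B \<subseteq> carrier M \<Longrightarrow> (\<Oplus>b\<in>B. c b \<odot> b) \<in> carrier M"
  by (intro M.finsum_closed) auto

lemma finsum_smult_add: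
  assumes "B \<subseteq> carrier M"
  shows "(\<Oplus>b\<in>B. (c b + d b) \<odot> b) = (\<Oplus>b\<in>B. c b \<odot> b) \<oplus> (\<Oplus>b\<in>B. d b \<odot> b)"
proof -
  have "(\<Oplus>b\<in>B. (c b + d b) \<odot> b) = (\<Oplus>b\<in>B. c b \<odot> b \<oplus> d b \<odot> b)"
    using assms by (intro M.finsum_cong') (auto simp: int_smult_distr)
  also have "\<dots> = (\<Oplus>b\<in>B. c b \<odot> b) \<oplus> (\<Oplus>b\<in>B. d b \<odot> b)"
    using assms by (intro M.finsum_addf) auto
  finally show ?thesis .
qed

lemma finsum_smult_smult:
  assumes "B \<subseteq> carrier M" "finite B"
  shows "(\<Oplus>b\<in>B. (a * c b) \<odot> b) = a \<odot> (\<Oplus>b\<in>B. c b \<odot> b)"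
  using assms(2,1)
proof (induction B rule: finite_induct)
  case (insert x B)
  then have "(\<Oplus>b\<in>insert x B. (a * c b) \<odot> b) = (a * c x) \<odot> x \<oplus> (\<Oplus>b\<in>B. (a * c b) \<odot> b)"
    by (intro M.finsum_insert) auto
  moreover have "(\<Oplus>b\<in>insert x B. c b \<odot> b) = c x \<odot> x \<oplus> (\<Oplus>b\<in>B. c b \<odot> b)"
    using insert by (intro M.finsum_insert) auto
  ultimately show ?case
    using insert finsum_smult_closed[of B c] by (simp add: int_smult_distr)
qed (simp add: int_smult_distr)

lemma int_span_add:
  "\<lbrakk>B \<subseteq> carrier M; x \<in> int_span B; y \<in> int_span B\<rbrakk> \<Longrightarrow> x \<oplus> y \<in> int_span B"
proof -
  assume B: "B \<subseteq> carrier M" and "x \<in> int_span B" "y \<in> int_span B"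
  then obtain c d where "x = (\<Oplus>b\<in>B. c b \<odot> b)" "y = (\<Oplus>b\<in>B. d b \<odot> b)"
    unfolding int_span_def by auto
  then have "x \<oplus> y = (\<Oplus>b\<in>B. (c b + d b) \<odot> b)" using finsum_smult_add[OF B] by simp
  then show ?thesis unfolding int_span_def by (intro CollectI exI)
qed

lemma int_span_smult:
  "\<lbrakk>B \<subseteq> carrier M; finite B; x \<in> int_span B\<rbrakk> \<Longrightarrow> a \<odot> x \<in> int_span B"
proof -
  assume B: "B \<subseteq> carrier M" "finite B" and "x \<in> int_span B"
  then obtain c where "x = (\<Oplus>b\<in>B. c b \<odot> b)" unfolding int_span_def by auto
  then have "a \<odot> x = (\<Oplus>b\<in>B. (a * c b) \<odot> b)" using finsum_smult_smult[OF B] by simp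
  then show ?thesis unfolding int_span_def by (intro CollectI exI)
qed

lemma int_span_base:
  assumes "B \<subseteq> carrier M" "finite B" "x \<in> B"
  shows "x \<in> int_span B"
proof -
  have "(\<Oplus>b\<in>B. of_bool (b = x) \<odot> b) = (\<Oplus>b\<in>B. if x = b then b else \<zero>)"
    using assms by (intro M.finsum_cong') (auto simp: int_smult_distr)
  also have "\<dots> = x" using assms by (intro M.finsum_singleton) auto
  finally show ?thesis unfolding int_span_def by (intro CollectI exI) (rule sym)
qed

lemma int_span_zero: "\<lbrakk>B \<subseteq> carrier M\<rbrakk> \<Longrightarrow> \<zero> \<in> int_span B"
proof -
  assume "B \<subseteq> carrier M"
  then have "(\<Oplus>b\<in>B. 0 \<odot> b) = \<zero>" by (intro M.add.finprod_one_eqI) (auto simp: int_smult_distr)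
  then show ?thesis unfolding int_span_def by (intro CollectI exI) (rule sym)
qed

lemma int_span_finsum:
  assumes "B \<subseteq> carrier M" "finite B" "\<And>i. i \<in> D \<Longrightarrow> h i \<in> int_span B"
  shows "(\<Oplus>i\<in>D. h i) \<in> int_span B"
  using assms(3)
proof (induction D rule: infinite_finite_induct)
  case (insert i D)
  have "int_span B \<subseteq> carrier M" unfolding int_span_def using finsum_smult_closed[OF assms(1)] by auto
  then have "(\<Oplus>i\<in>insert i D. h i) = h i \<oplus> (\<Oplus>i\<in>D. h i)"
    using insert by (intro M.finsum_insert) auto
  then show ?case using insert int_span_add[OF assms(1)] by auto
qed (use int_span_zero[OF assms(1)] in auto)

text \<open>The matrix of \<open>\<beta>\<close> between \<open>B\<close> and its images under
  \<open>d\<close> is unitriangular with respect to \<open>rank\<close>, so linear systems are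
  solved over the integers by recursion on the rank. Solvability makes the form unimodular, and
  uniqueness makes \<open>B\<close> a basis, from which projectivity follows.\<close>

lemma unitriangular_form:
  fixes \<beta> :: "'a \<Rightarrow> 'a \<Rightarrow> int" and d :: "'a \<Rightarrow> 'a" and rank :: "'a \<Rightarrow> nat"
  assumes fin: "finite B" and B: "B \<subseteq> carrier M" and dB: "d ` B \<subseteq> carrier M"
    and span: "carrier M \<subseteq> int_span B" and span': "carrier M \<subseteq> int_span (d ` B)"
    and add: "\<And>x y z. \<lbrakk>x \<in> carrier M; y \<in> carrier M; z \<in> carrier M\<rbrakk> \<Longrightarrow> \<beta> (x \<oplus> y) z = \<beta> x z + \<beta> y z"
    and smult: "\<And>a x z. \<lbrakk>x \<in> carrier M; z \<in> carrier M\<rbrakk> \<Longrightarrow> \<beta> (a \<odot> x) z = a * \<beta> x z"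
    and sym: "\<And>x y. \<lbrakk>x \<in> carrier M; y \<in> carrier M\<rbrakk> \<Longrightarrow> \<beta> x y = \<beta> y x"
    and diag: "\<And>x. x \<in> B \<Longrightarrow> \<beta> x (d x) = 1"
    and tri: "\<And>x y. \<lbrakk>x \<in> B; y \<in> B; x \<noteq> y; rank x \<ge> rank y\<rbrakk> \<Longrightarrow> \<beta> x (d y) = 0"
  shows "bilinear_form \<Z> M \<beta>" "nondegenerate_form \<Z> M \<beta>"
    "finitely_generated_module \<Z> M" "projective_module \<Z> M"
proof -
  let ?L = "\<lambda>c. \<Oplus>b\<in>B. c b \<odot> b"
  have L_closed: "?L c \<in> carrier M" for c by (rule finsum_smult_closed[OF B])
  have add': "\<beta> z (x \<oplus> y) = \<beta> z x + \<beta> z y" if "x \<in> carrier M" "y \<in> carrier M" "z \<in> carrier M" for x y z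
    using add[OF that] sym that by simp
  have smult': "\<beta> z (a \<odot> x) = a * \<beta> z x" if "x \<in> carrier M" "z \<in> carrier M" for a x z
    using smult[OF that] sym that by simp
  show bil: "bilinear_form \<Z> M \<beta>"
    unfolding bilinear_form_def module_hom_def regular_module_def
    by (auto simp: add smult add' smult')
  have \<beta>_L: "\<beta> (?L c) z = (\<Sum>b\<in>B. c b * \<beta> b z)" if "z \<in> carrier M" for c z
    using finsum_additive[OF M.abelian_group_axioms fin, of "\<lambda>b. c b \<odot> b" "\<lambda>x. \<beta> x z"] B that
    by (auto simp: add smult subset_iff)
  have tri_sum: "\<beta> (?L c) (d y) = c y + (\<Sum>b\<in>{b\<in>B. rank b < rank y}. c b * \<beta> b (d y))"
    if y: "y \<in> B" for c y
  proof -
    have "\<beta> (?L c) (d y) = (\<Sum>b\<in>B. c b * \<beta> b (d y))" using \<beta>_L dB y by blast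
    also have "\<dots> = (\<Sum>b\<in>insert y {b\<in>B. rank b < rank y}. c b * \<beta> b (d y))"
      using fin y tri[OF _ y] by (intro sum.mono_neutral_right) auto
    also have "\<dots> = c y + (\<Sum>b\<in>{b\<in>B. rank b < rank y}. c b * \<beta> b (d y))"
      using fin diag[OF y] by simp
    finally show ?thesis .
  qed
  have inj: "c y = 0" if "\<And>y. y \<in> B \<Longrightarrow> \<beta> (?L c) (d y) = 0" "y \<in> B" for c y
    using that(2)
  proof (induction "rank y" arbitrary: y rule: less_induct)
    case less
    then have "(\<Sum>b\<in>{b\<in>B. rank b < rank y}. c b * \<beta> b (d y)) = 0" by (intro sum.neutral) auto
    then show ?case using tri_sum[OF less.prems, of c] that(1)[OF less.prems] by simp
  qed
  have surj: "\<exists>c. \<forall>y\<in>B. \<beta> (?L c) (d y) = f y" for f :: "'a \<Rightarrow> int"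
  proof -
    \<comment> \<open>Forward substitution: the coefficient at \<open>y\<close> is read off from
      those of smaller rank.\<close>
    have "\<exists>c. \<forall>y. c y = f y - (\<Sum>b\<in>{b\<in>B. rank b < rank y}. c b * \<beta> b (d y))"
      by (rule dependent_wf_choice[OF wf_measure[of rank]]) (auto intro!: sum.cong)
    then obtain c where c: "\<And>y. c y = f y - (\<Sum>b\<in>{b\<in>B. rank b < rank y}. c b * \<beta> b (d y))" by blast

    have "\<beta> (?L c) (d y) = f y" if "y \<in> B" for y
      using tri_sum[OF that, of c] c[of y] by linarith
    then show ?thesis by blast
  qed
  \<comment> \<open>Linear functions are compared on the images of \<open>d\<close> only, which
    suffices because these span.\<close>
  have ext: "f z = g z" if z': "z \<in> carrier M" and "\<And>y. y \<in> B \<Longrightarrow> f (d y) = g (d y)"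
    "\<And>x y. \<lbrakk>x \<in> carrier M; y \<in> carrier M\<rbrakk> \<Longrightarrow> f (x \<oplus> y) = f x + f y"
    "\<And>x y. \<lbrakk>x \<in> carrier M; y \<in> carrier M\<rbrakk> \<Longrightarrow> g (x \<oplus> y) = g x + g y"
    "\<And>a x. x \<in> carrier M \<Longrightarrow> f (a \<odot> x) = a * f x"
    "\<And>a x. x \<in> carrier M \<Longrightarrow> g (a \<odot> x) = a * g x" for f g :: "'a \<Rightarrow> int" and z
  proof -
    obtain c where z: "z = (\<Oplus>b\<in>d ` B. c b \<odot> b)" using subsetD[OF span' z'] unfolding int_span_def by auto
    have closed: "\<And>b. b \<in> d ` B \<Longrightarrow> c b \<odot> b \<in> carrier M" using dB by auto
    have "f z = (\<Sum>b\<in>d ` B. f (c b \<odot> b))"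
      unfolding z by (rule finsum_additive[OF M.abelian_group_axioms finite_imageI[OF fin] closed that(3)])
    moreover have "g z = (\<Sum>b\<in>d ` B. g (c b \<odot> b))"
      unfolding z by (rule finsum_additive[OF M.abelian_group_axioms finite_imageI[OF fin] closed that(4)])
    moreover have "f (c b \<odot> b) = g (c b \<odot> b)" if "b \<in> d ` B" for b
      using that dB \<open>\<And>y. y \<in> B \<Longrightarrow> f (d y) = g (d y)\<close>
        \<open>\<And>a x. x \<in> carrier M \<Longrightarrow> f (a \<odot> x) = a * f x\<close>
        \<open>\<And>a x. x \<in> carrier M \<Longrightarrow> g (a \<odot> x) = a * g x\<close> by auto
    ultimately show ?thesis by simp
  qed
  \<comment> \<open>Linear independence of \<open>B\<close>. It is what makes the chosen coordinates
    \<open>co\<close> below additive.\<close>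
  have coord_unique: "c b = c' b" if "?L c = ?L c'" "b \<in> B" for c c' b
  proof -
    have "?L (\<lambda>b. c b + (- 1) * c' b) = ?L c \<oplus> (- 1) \<odot> ?L c'"
      unfolding finsum_smult_add[OF B] finsum_smult_smult[OF B fin] ..
    also have "\<dots> = \<zero>"
      using that(1) L_closed[of c'] int_smult_distr(1)[of "?L c'" 1 "- 1"] by (simp add: int_smult_distr)
    finally have "\<beta> (?L (\<lambda>b. c b + (- 1) * c' b)) (d y) = 0" if "y \<in> B" for y
      using smult[of "\<zero>" "d y" 0] dB that by (auto simp: int_smult_distr)
    from inj[OF this that(2)] show ?thesis by simp
  qed
  have hom: "(\<lambda>y\<in>carrier M. \<beta> x y) \<in> module_hom \<Z> M (regular_module \<Z>)" if "x \<in> carrier M" for x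
    using bil that by (simp add: bilinear_form_def)
  show "nondegenerate_form \<Z> M \<beta>"
    unfolding nondegenerate_form_def module_iso_def
  proof (intro CollectI conjI)
    let ?T = "\<lambda>x\<in>carrier M. \<lambda>y\<in>carrier M. \<beta> x y"
    show "?T \<in> module_hom \<Z> M (hom_module \<Z> M (regular_module \<Z>))"
      unfolding module_hom_def[of _ _ "hom_module \<Z> M (regular_module \<Z>)"]
      using hom by (auto simp: hom_module_def regular_module_def add smult fun_eq_iff restrict_def)
    show "bij_betw ?T (carrier M) (carrier (hom_module \<Z> M (regular_module \<Z>)))"
    proof (rule bij_betwI')
      fix x y assume x: "x \<in> carrier M" and y: "y \<in> carrier M"
      obtain c c' where c: "x = ?L c" "y = ?L c'" using subsetD[OF span x] subsetD[OF span y] unfolding int_span_def by auto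
      show "?T x = ?T y \<longleftrightarrow> x = y"
      proof
        assume eq: "?T x = ?T y"
        have "\<beta> (?L (\<lambda>b. c b + (- 1) * c' b)) (d z) = 0" if z: "z \<in> B" for z
        proof -
          have dz: "d z \<in> carrier M" using dB z by blast
          have "\<beta> x (d z) = \<beta> y (d z)" using fun_cong[OF eq, of "d z"] x y dz by simp
          then show ?thesis
            unfolding finsum_smult_add[OF B] finsum_smult_smult[OF B fin] c[symmetric]
            using add[OF x _ dz] smult[OF y dz] y by simp
        qed
        then have "c b = c' b" if "b \<in> B" for b using inj[OF _ that, of "\<lambda>b. c b + (- 1) * c' b"] by simp
        then show "x = y" unfolding c using B by (intro M.finsum_cong') auto
      qed simp
    next
      fix x assume "x \<in> carrier M"
      then show "?T x \<in> carrier (hom_module \<Z> M (regular_module \<Z>))"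
        using hom by (simp add: hom_module_def)
    next
      fix f assume "f \<in> carrier (hom_module \<Z> M (regular_module \<Z>))"
      then have f: "f \<in> extensional (carrier M)"
        "\<And>x y. \<lbrakk>x \<in> carrier M; y \<in> carrier M\<rbrakk> \<Longrightarrow> f (x \<oplus> y) = f x + f y"
        "\<And>a x. x \<in> carrier M \<Longrightarrow> f (a \<odot> x) = a * f x"
        by (auto simp: hom_module_def module_hom_def regular_module_def PiE_def)
      obtain c where c: "\<And>y. y \<in> B \<Longrightarrow> \<beta> (?L c) (d y) = f (d y)" using surj[of "\<lambda>y. f (d y)"] by blast
      have "f z = \<beta> (?L c) z" if z: "z \<in> carrier M" for z
        by (rule ext[OF z]) (use c f add' smult' L_closed in auto)
      then have "f = ?T (?L c)"
        using f(1) L_closed by (auto simp: fun_eq_iff extensional_def)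
      then show "\<exists>x\<in>carrier M. f = ?T x" using L_closed by blast
    qed
  qed
  show "finitely_generated_module \<Z> M"
    unfolding finitely_generated_module_def
    using fin B span unfolding int_span_def by (auto intro!: exI[of _ B])
  show "projective_module \<Z> M"
    unfolding projective_module_def
  proof (intro exI bexI)
    define co where "co x = (SOME c. x = ?L c)" for x
    have co: "?L (co x) = x" if "x \<in> carrier M" for x
    proof -
      have "\<exists>c. x = ?L c" using subsetD[OF span that] unfolding int_span_def by simp
      then have "x = ?L (co x)" unfolding co_def by (rule someI_ex)
      then show ?thesis ..
    qed
    let ?i = "\<lambda>x\<in>carrier M. \<lambda>b. if b \<in> B then co x b else 0"
    let ?p = "\<lambda>f\<in>carrier (free_module \<Z> B). ?L f"
    have free: "carrier (free_module \<Z> B) = {f. finite {b. f b \<noteq> 0} \<and> {b. f b \<noteq> 0} \<subseteq> B}"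
      by (auto simp: free_module_def)
    have cut: "?L (\<lambda>b. if b \<in> B then c b else 0) = ?L c" for c
      using B by (intro M.finsum_cong') auto
    have i_closed: "(\<lambda>b. if b \<in> B then co x b else 0) \<in> carrier (free_module \<Z> B)" for x
      unfolding free using fin by (auto intro: finite_subset)
    show "?i \<in> module_hom \<Z> M (free_module \<Z> B)"
      unfolding module_hom_def
    proof (intro CollectI conjI ballI)
      fix x y assume x: "x \<in> carrier M" and y: "y \<in> carrier M"
      have "?L (co (x \<oplus> y)) = ?L (\<lambda>b. co x b + co y b)"
        unfolding finsum_smult_add[OF B] using x y by (simp add: co)
      from coord_unique[OF this] show "?i (x \<oplus> y) = ?i x \<oplus>\<^bsub>free_module \<Z> B\<^esub> ?i y"
        using x y by (auto simp: free_module_def)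
    next
      fix a x assume x: "x \<in> carrier M"
      have "?L (co (a \<odot> x)) = ?L (\<lambda>b. a * co x b)"
        unfolding finsum_smult_smult[OF B fin] using x by (simp add: co)
      from coord_unique[OF this] show "?i (a \<odot> x) = a \<odot>\<^bsub>free_module \<Z> B\<^esub> ?i x"
        using x by (auto simp: free_module_def)
    qed (use i_closed in auto)
    show "?p \<in> module_hom \<Z> (free_module \<Z> B) M"
      unfolding module_hom_def
    proof (intro CollectI conjI ballI)
      fix f g assume fg: "f \<in> carrier (free_module \<Z> B)" "g \<in> carrier (free_module \<Z> B)"
      have "finite {b. f b + g b \<noteq> 0}" using fg finite_support_add[of f g] by (simp add: free)
      moreover have "{b. f b + g b \<noteq> 0} \<subseteq> B" using fg unfolding free by (auto simp: subset_iff) (metis add_0)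
      ultimately have "(\<lambda>b. f b + g b) \<in> carrier (free_module \<Z> B)" by (simp add: free)
      then show "?p (f \<oplus>\<^bsub>free_module \<Z> B\<^esub> g) = ?p f \<oplus> ?p g"
        using fg finsum_smult_add[OF B] by (simp add: free_module_def)
    next
      fix a f assume f: "f \<in> carrier (free_module \<Z> B)"
      have "(\<lambda>b. a * f b) \<in> carrier (free_module \<Z> B)" using f by (auto simp: free)
      then show "?p (a \<odot>\<^bsub>free_module \<Z> B\<^esub> f) = a \<odot> ?p f"
        using f finsum_smult_smult[OF B fin] by (simp add: free_module_def)
    qed (use L_closed in auto)
    show "\<forall>x\<in>carrier M. ?p (?i x) = x" using i_closed cut co by simp
  qed
qed

end

lemma linear_extension_sum:
  "linear_extension (\<lambda>w. \<Sum>i\<in>I. F i w) f = (\<Sum>i\<in>I. linear_extension (F i) f)"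
  unfolding linear_extension_def sum_distrib_left by (rule sum.swap)

lemma linear_extension_mult_right:
  "linear_extension (\<lambda>w. F w * c) f = linear_extension F f * c"
  unfolding linear_extension_def by (simp add: sum_distrib_right mult.assoc)

lemma linear_extension_finsum_word:
  assumes "finite D" "\<And>i. i \<in> D \<Longrightarrow> v i \<in> lists S"
  shows "linear_extension F (\<Oplus>\<^bsub>free_algebra \<Z> S\<^esub>i\<in>D. word \<Z> (v i)) = (\<Sum>i\<in>D. F (v i))"
proof -
  have "linear_extension F (\<Oplus>\<^bsub>free_algebra \<Z> S\<^esub>i\<in>D. word \<Z> (v i)) =
      (\<Sum>i\<in>D. linear_extension F (word \<Z> (v i)))"
    by (rule finsum_additive[OF free_algebra_abelian_group assms(1) word_in_free_algebra[OF assms(2)]])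
      (simp_all add: int_free_algebra_simps(1,5) linear_extension_add)
  then show ?thesis by simp
qed

section \<open>Trace forms on the Mackey algebra\<close>

context finite_group begin

lemma mackey_gens_iff:
  "Tr K H \<in> mackey_gens G \<longleftrightarrow> subgroup H G \<and> subgroup K G \<and> H \<subseteq> K"
  "Res K H \<in> mackey_gens G \<longleftrightarrow> subgroup H G \<and> subgroup K G \<and> H \<subseteq> K"
  "Conj g H \<in> mackey_gens G \<longleftrightarrow> g \<in> carrier G \<and> subgroup H G"
  by (auto simp: mackey_gens_def)

lemma finite_subgroups: "finite {H. subgroup H G}"
  by (rule finite_subset[of _ "Pow (carrier G)"]) (use fin subgroup.subset in auto)

lemma double_coset_reps_finite:
  "\<lbrakk>subgroup H G; double_coset_reps G L H K D\<rbrakk> \<Longrightarrow> finite D"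
  using finite_subgroup finite_subset by (auto simp: double_coset_reps_def)

lemma mackey_word_in_lists:
  assumes "subgroup H G" "subgroup K G" "subgroup L G" "L \<subseteq> H" "K \<subseteq> H" "double_coset_reps G L H K D"
    "h \<in> D"
  shows "[Tr L (L \<inter> conjugate G h K), Conj h (conjugate_right G L h \<inter> K),
    Res K (conjugate_right G L h \<inter> K)] \<in> lists (mackey_gens G)"
proof -
  have h: "h \<in> carrier G"
    using assms(6,7) subgroup.subset[OF assms(1)] by (auto simp: double_coset_reps_def)
  then show ?thesis
    using assms conjugate_right_Int_subgroup[OF assms(2,3) h]
    by (auto simp: mackey_gens_iff subgroups_Inter_pair conjugate_subgroup)
qed

lemma mackey_relations_closed:
  "mackey_relations \<Z> G \<subseteq> carrier (free_algebra \<Z> (mackey_gens G)) \<times> carrier (free_algebra \<Z> (mackey_gens G))"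
proof -
  interpret F: assoc_algebra \<Z> "free_algebra \<Z> (mackey_gens G)" by (rule free_algebra_assoc_algebra)
  have "x \<in> carrier (free_algebra \<Z> (mackey_gens G)) \<and> y \<in> carrier (free_algebra \<Z> (mackey_gens G))"
    if "(x, y) \<in> mackey_relations \<Z> G" for x y
    using that
  proof (induction rule: mackey_relations.induct)
    case unit
    then show ?case
      by (auto intro!: F.finsum_closed word_in_free_algebra simp: mackey_gens_iff)
  next
    case (mackey_formula H K L D)
    then show ?case
      using mackey_word_in_lists[OF mackey_formula(1-6)]
      by (intro conjI F.finsum_closed Pi_I word_in_free_algebra) (auto simp: mackey_gens_iff)
  next
    case (conj_self H h)
    then show ?case using subgroup.mem_carrier[of H G h]
      by (intro conjI word_in_free_algebra) (auto simp: mackey_gens_iff)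
  next
    case (tr_conj H K g)
    then show ?case using conjugate_mono[of H K g]
      by (intro conjI word_in_free_algebra) (auto simp: mackey_gens_iff conjugate_subgroup)
  next
    case (res_conj H K g)
    then show ?case using conjugate_mono[of H K g]
      by (intro conjI word_in_free_algebra) (auto simp: mackey_gens_iff conjugate_subgroup)
  qed (auto intro!: word_in_free_algebra simp: mackey_gens_iff conjugate_subgroup)
  then show ?thesis by auto
qed

text \<open>The check is made for single matrix entries, so every \<open>Q\<close> yields a
  representation of the algebra by integer matrices indexed by the fixed cosets. Contexts and traces
  then follow by linearity.\<close>

lemma paths_relation:
  assumes rel: "(x, y) \<in> mackey_relations \<Z> G" and Q: "Q \<subseteq> carrier G"
    and C: "C \<in> fixed_cosets G Q" and D: "D \<in> fixed_cosets G Q"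
  shows "linear_extension (\<lambda>w. paths G Q w D C) x = linear_extension (\<lambda>w. paths G Q w D C) y"
  using rel
proof cases
  case unit
  obtain H0 where H0: "subgroup H0 G" "C \<in> lcosets H0" using C by (auto simp: fixed_cosets_def)
  have "linear_extension (\<lambda>w. paths G Q w D C) x =
      (\<Sum>H\<in>{H. subgroup H G}. paths G Q [Tr H H] D C)"
    unfolding unit(1)
    by (rule linear_extension_finsum_word) (use finite_subgroups in \<open>auto simp: mackey_gens_iff\<close>)
  \<comment> \<open>The coset \<open>C\<close> belongs to one subgroup only, and the transfer of
    that subgroup to itself fixes \<open>C\<close>.\<close>
  also have "\<dots> = (\<Sum>H\<in>{H. subgroup H G}. if H = H0 then of_bool (D = C) else 0)"
  proof (rule sum.cong[OF refl])
    fix H assume "H \<in> {H. subgroup H G}"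
    then have H: "subgroup H G" by simp
    have "C \<in> lcosets H \<longleftrightarrow> H = H0" using lcoset_subgroup_unique[OF H H0(1)] H0(2) by blast
    then show "paths G Q [Tr H H] D C = (if H = H0 then of_bool (D = C) else 0)"
      unfolding paths_single[OF C] span_rel_self(1)[OF H] by simp
  qed
  also have "\<dots> = linear_extension (\<lambda>w. paths G Q w D C) y"
    unfolding unit(2) int_free_algebra_simps(3) using finite_subgroups H0(1) by (simp add: sum.delta)
  finally show ?thesis .
next
  case (tr_self H)
  then show ?thesis by (simp only: linear_extension_word paths_single[OF C] span_rel_self)
next
  case (conj_self H h)
  then show ?thesis by (simp only: linear_extension_word paths_single[OF C] span_rel_self)
next
  case (tr_tr H K L)
  then show ?thesis
    by (simp only: linear_extension_word paths_single[OF C] paths_tr_tr[OF Q _ _ _ _ _ C] span_rel.simps)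
next
  case (res_res H K L)
  then show ?thesis
    by (simp only: linear_extension_word paths_single[OF C] paths_res_res_transpose[OF C D]
        paths_tr_tr[OF Q _ _ _ _ _ D] span_rel.simps) auto
next
  case (conj_conj H g g')
  then show ?thesis
    by (simp only: linear_extension_word paths_single[OF C] paths_conj_conj[OF Q _ _ _ C])
next
  case (tr_conj H K g)
  then show ?thesis by (simp only: linear_extension_word paths_tr_conj[OF Q _ _ _ C D])
next
  case (res_conj H K g)
  then show ?thesis by (simp only: linear_extension_word paths_res_conj[OF Q _ _ _ C D])
next
  case (mackey_formula H K L R)
  have R: "finite R" using double_coset_reps_finite[OF mackey_formula(3,8)] .
  have hG: "h \<in> carrier G" if "h \<in> R" for h
    using that mackey_formula(8) subgroup.subset[OF mackey_formula(3)] by (auto simp: double_coset_reps_def)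
  have "linear_extension (\<lambda>w. paths G Q w D C) y = (\<Sum>h\<in>R. paths G Q [Tr L (L \<inter> conjugate G h K),
      Conj h (conjugate_right G L h \<inter> K), Res K (conjugate_right G L h \<inter> K)] D C)"
    unfolding mackey_formula(2)
    by (rule linear_extension_finsum_word[OF R]) (rule mackey_word_in_lists[OF mackey_formula(3-8)])
  also have "\<dots> = paths G Q [Res H L, Tr H K] D C"
  proof (cases "C \<in> lcosets K \<and> D \<in> lcosets L")
    case True
    then obtain a b where a: "a \<in> carrier G" "C = a <# K" and b: "b \<in> carrier G" "D = b <# L"
      by (auto elim!: lcosetsE)
    have "(\<Sum>h\<in>R. paths G Q [Tr L (L \<inter> conjugate G h K),
        Conj h (conjugate_right G L h \<inter> K), Res K (conjugate_right G L h \<inter> K)] D C) =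
        (\<Sum>h\<in>R. of_bool ((b <# L) \<inter> ((a <# K) #> inv h) \<noteq> {}))"
      unfolding a(2)[symmetric] b(2)[symmetric]
      by (intro sum.cong refl paths_mackey_right[OF Q mackey_formula(4,5) _ C _ D]) (use hG True in auto)
    also have "\<dots> = of_bool (inv b \<otimes> a \<in> H)"
      by (rule mackey_double_coset[OF mackey_formula(3-5,7,6,8) a(1) b(1)])
    also have "\<dots> = paths G Q [Res H L, Tr H K] D C"
      using paths_mackey_left[OF Q mackey_formula(3-5,7,6) C a(2,1) b(2,1)] by simp
    finally show ?thesis .
  next
    case False
    have left: "paths G Q [Res H L, Tr H K] D C = 0"
      unfolding paths_two[OF C] using False by (intro sum.neutral) auto
    have right: "paths G Q [Tr L J, Conj h J', Res K J''] D C = 0" for h J J' J''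
    proof (cases "D \<in> lcosets L")
      case True
      then have "C \<notin> lcosets K" using False by simp
      then have "paths G Q [Conj h J', Res K J''] E C = 0" for E
        unfolding paths_two[OF C] by (intro sum.neutral) auto
      then show ?thesis unfolding paths.simps(2)[of G Q "Tr L J"] by simp
    qed (simp add: paths.simps(2)[of G Q "Tr L J"] del: paths.simps(2))
    show ?thesis unfolding left right by simp
  qed
  finally show ?thesis unfolding mackey_formula(1) by (simp only: linear_extension_word)
next
  case (non_composable a b)
  have "paths G Q [a, b] D C = 0"
    unfolding paths_two[OF C]
  proof (intro sum.neutral ballI)
    fix E
    have "\<not> (span_rel G a D E \<and> span_rel G b E C)"
      using span_rel_source[of a D E] span_rel_target[of b E C] non_composable(3-5)
        lcoset_subgroup_unique[OF source_subgroup target_subgroup] by blast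
    then show "of_bool (span_rel G a D E \<and> span_rel G b E C) = (0::int)" by simp
  qed
  then show ?thesis
    unfolding non_composable(1,2) int_free_algebra_simps(4)
    by (simp only: linear_extension_word linear_extension_zero)
qed

sublocale P: int_presentation "mackey_gens G" "mackey_relations \<Z> G"
  by unfold_locales (rule mackey_relations_closed)

abbreviation \<mu> :: "(int, ('a mackey_gen list \<Rightarrow> int) set) module" where
  "\<mu> \<equiv> presented_algebra \<Z> (mackey_gens G) (mackey_relations \<Z> G)"

lemma mackey_algebra_eq: "mackey_algebra \<Z> G = \<mu>"
  by (simp add: mackey_algebra_def)

sublocale \<mu>: int_module \<mu>
  by (rule int_module.intro, rule P.A.module_axioms)

definition central_form :: "(('a mackey_gen list \<Rightarrow> int) set \<Rightarrow> int) \<Rightarrow> bool" where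
  "central_form \<phi> \<longleftrightarrow>
    (\<forall>x\<in>carrier \<mu>. \<forall>y\<in>carrier \<mu>. \<phi> (x \<oplus>\<^bsub>\<mu>\<^esub> y) = \<phi> x + \<phi> y) \<and>
    (\<forall>a. \<forall>x\<in>carrier \<mu>. \<phi> (a \<odot>\<^bsub>\<mu>\<^esub> x) = a * \<phi> x) \<and>
    (\<forall>x\<in>carrier \<mu>. \<forall>y\<in>carrier \<mu>. \<phi> (x \<otimes>\<^bsub>\<mu>\<^esub> y) = \<phi> (y \<otimes>\<^bsub>\<mu>\<^esub> x))"

text \<open>By cyclic invariance a context around \<open>w\<close> can be moved to one side of it.
  The trace is then linear in the matrix of \<open>w\<close>, and \<open>paths_relation\<close>
  applies entrywise.\<close>

lemma exists_trace_form:
  assumes Q: "Q \<subseteq> carrier G"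
  shows "\<exists>\<phi>. central_form \<phi> \<and> (\<forall>w\<in>lists (mackey_gens G). \<phi> (P.wd w) = path_trace G Q w)"
proof -
  have rel: "linear_extension (\<lambda>w. path_trace G Q (u @ w @ v)) x = linear_extension (\<lambda>w. path_trace G Q (u @ w @ v)) y"
    if "(x, y) \<in> mackey_relations \<Z> G" for x y u v
  proof -
    have eq: "path_trace G Q (u @ w @ v) =
        (\<Sum>C\<in>fixed_cosets G Q. \<Sum>E\<in>fixed_cosets G Q. paths G Q w C E * paths G Q (v @ u) E C)" for w
      using path_trace_commute[of Q u "w @ v"] path_trace_append[of Q w "v @ u"]
      by (simp only: append_assoc)
    show ?thesis
      unfolding eq linear_extension_sum linear_extension_mult_right
      by (intro sum.cong refl) (simp only: paths_relation[OF that Q])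
  qed
  obtain \<phi> where add: "\<And>x y. \<lbrakk>x \<in> carrier \<mu>; y \<in> carrier \<mu>\<rbrakk> \<Longrightarrow> \<phi> (x \<oplus>\<^bsub>\<mu>\<^esub> y) = \<phi> x + \<phi> y"
    and smult: "\<And>a x. x \<in> carrier \<mu> \<Longrightarrow> \<phi> (a \<odot>\<^bsub>\<mu>\<^esub> x) = a * \<phi> x"
    and wd: "\<And>w. w \<in> lists (mackey_gens G) \<Longrightarrow> \<phi> (P.wd w) = path_trace G Q w"
    using P.functional_exists[of "path_trace G Q", OF rel] by blast
  have words: "\<phi> (P.wd u \<otimes>\<^bsub>\<mu>\<^esub> P.wd v) = \<phi> (P.wd v \<otimes>\<^bsub>\<mu>\<^esub> P.wd u)"
    if "u \<in> lists (mackey_gens G)" "v \<in> lists (mackey_gens G)" for u v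
    using that wd[of "u @ v"] wd[of "v @ u"] path_trace_commute[of Q u v]
    by (simp add: P.wd_append del: in_lists_conv_set)
  have left: "\<phi> (P.wd u \<otimes>\<^bsub>\<mu>\<^esub> y) = \<phi> (y \<otimes>\<^bsub>\<mu>\<^esub> P.wd u)"
    if u: "u \<in> lists (mackey_gens G)" and y: "y \<in> carrier \<mu>" for u y
    using y
  proof (induction y rule: P.presented_induct)
    case (word v)
    then show ?case using words u by blast
  next
    case (add x y)
    then show ?case using P.wd_closed[OF u] \<open>\<And>x y. \<lbrakk>x \<in> carrier \<mu>; y \<in> carrier \<mu>\<rbrakk> \<Longrightarrow> \<phi> (x \<oplus>\<^bsub>\<mu>\<^esub> y) = \<phi> x + \<phi> y\<close>
      by (simp add: P.A.r_distr P.A.l_distr)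
  next
    case (smult a x)
    then show ?case using P.wd_closed[OF u] \<open>\<And>a x. x \<in> carrier \<mu> \<Longrightarrow> \<phi> (a \<odot>\<^bsub>\<mu>\<^esub> x) = a * \<phi> x\<close>
      by (simp add: P.A.smult_mult_left P.A.smult_mult_right)
  qed
  have "\<phi> (x \<otimes>\<^bsub>\<mu>\<^esub> y) = \<phi> (y \<otimes>\<^bsub>\<mu>\<^esub> x)" if x: "x \<in> carrier \<mu>" and y: "y \<in> carrier \<mu>" for x y
    using x
  proof (induction x rule: P.presented_induct)
    case (word u)
    then show ?case using left y by blast
  next
    case (add x z)
    then show ?case using y \<open>\<And>x y. \<lbrakk>x \<in> carrier \<mu>; y \<in> carrier \<mu>\<rbrakk> \<Longrightarrow> \<phi> (x \<oplus>\<^bsub>\<mu>\<^esub> y) = \<phi> x + \<phi> y\<close>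
      by (simp add: P.A.r_distr P.A.l_distr)
  next
    case (smult a x)
    then show ?case using y \<open>\<And>a x. x \<in> carrier \<mu> \<Longrightarrow> \<phi> (a \<odot>\<^bsub>\<mu>\<^esub> x) = a * \<phi> x\<close>
      by (simp add: P.A.smult_mult_left P.A.smult_mult_right)
  qed
  then show ?thesis using add smult wd unfolding central_form_def by (intro exI[of _ \<phi>]) blast
qed

text \<open>A closed path is determined by its middle coset \<open>E\<close>: its end has to be the
  coset of \<open>H\<close> containing \<open>E\<close>, and the path closes exactly when right
  translation by \<open>g\<close> stays inside that coset.\<close>

lemma path_trace_basis_word:
  assumes Q: "Q \<subseteq> carrier G" and "subgroup H G" "subgroup K G" "subgroup L G" "g \<in> carrier G"
    "L \<subseteq> K" "conjugate G g L \<subseteq> H"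
  shows "path_trace G Q [Tr H (conjugate G g L), Conj g L, Res K L] =
    of_bool (H = K \<and> g \<in> H) * int (card {E \<in> lcosets (conjugate G g L). \<forall>q\<in>Q. q <# E = E})"
proof -
  let ?L = "conjugate G g L" and ?X = "fixed_cosets G Q"
  have gL: "subgroup ?L G" by (rule conjugate_subgroup[OF assms(4,5)])
  have "path_trace G Q [Tr H ?L, Conj g L, Res K L] =
      (\<Sum>C\<in>?X. \<Sum>E\<in>?X. of_bool (span_rel G (Tr H ?L) C E) * paths G Q [Conj g L, Res K L] E C)"
    unfolding path_trace_def paths.simps(2)[of G Q "Tr H ?L"] ..
  also have "\<dots> = (\<Sum>C\<in>?X. \<Sum>E\<in>?X. of_bool (E \<in> lcosets ?L) *
      of_bool (C \<in> lcosets H \<and> C \<in> lcosets K \<and> E \<subseteq> C \<and> E #> g \<subseteq> C))"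
    by (intro sum.cong refl) (auto simp: paths_res_conj(2)[OF Q assms(4,3,5)] simp del: paths.simps)
  also have "\<dots> = (\<Sum>E\<in>?X. of_bool (E \<in> lcosets ?L) *
      (\<Sum>C\<in>?X. of_bool (C \<in> lcosets H \<and> C \<in> lcosets K \<and> E \<subseteq> C \<and> E #> g \<subseteq> C)))"
    by (subst sum.swap) (simp only: sum_distrib_left)
  also have "\<dots> = (\<Sum>E\<in>?X. of_bool (E \<in> lcosets ?L) * of_bool (H = K \<and> g \<in> H))"
  proof (intro sum.cong refl)
    fix E assume E: "E \<in> ?X"
    have "(\<Sum>C\<in>?X. of_bool (C \<in> lcosets H \<and> C \<in> lcosets K \<and> E \<subseteq> C \<and> E #> g \<subseteq> C)) =
        (of_bool (H = K \<and> g \<in> H) :: int)" if EL: "E \<in> lcosets ?L"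
    proof -
      obtain e where e: "e \<in> E" using lcoset_nonempty[OF gL EL] .
      then have eG: "e \<in> carrier G" using fixed_coset_carrier[OF E] by blast
      have eH: "E \<subseteq> e <# H" "e <# H \<in> lcosets H"
        using lcoset_subset_iff[OF gL assms(2,7) EL _ e] lcosetsI[OF eG] by auto
      then have eX: "e <# H \<in> ?X" using fixed_coset_superset[OF Q E assms(2)] by blast
      have "C \<in> lcosets H \<and> C \<in> lcosets K \<and> E \<subseteq> C \<and> E #> g \<subseteq> C \<longleftrightarrow> C = e <# H \<and> H = K \<and> g \<in> H" for C
      proof
        assume *: "C \<in> lcosets H \<and> C \<in> lcosets K \<and> E \<subseteq> C \<and> E #> g \<subseteq> C"
        then have C: "C = e <# H" using lcoset_subset_iff[OF gL assms(2,7) EL _ e] by blast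
        have "e \<otimes> g \<in> E #> g" using e by (auto simp: r_coset_def)
        then have "e \<otimes> g \<in> e <# H" using * C by blast
        then have "g \<in> H"
          using lcoset_mem_iff[OF assms(2) eG, of "e \<otimes> g"] eG assms(5) by (simp add: inv_mult_cancel_left)
        then show "C = e <# H \<and> H = K \<and> g \<in> H"
          using C * lcoset_subgroup_unique[OF assms(2,3)] by blast
      next
        assume *: "C = e <# H \<and> H = K \<and> g \<in> H"
        have "E #> g \<subseteq> (e <# H) #> g" using rcos_mono eH(1) by blast
        also have "(e <# H) #> g = e <# H"
          using coset_assoc[OF eG assms(5) subgroup.subset[OF assms(2)]] coset_join2[OF assms(5,2)] *
          by metis
        finally show "C \<in> lcosets H \<and> C \<in> lcosets K \<and> E \<subseteq> C \<and> E #> g \<subseteq> C" using * eH by blast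
      qed
      then have "(\<Sum>C\<in>?X. of_bool (C \<in> lcosets H \<and> C \<in> lcosets K \<and> E \<subseteq> C \<and> E #> g \<subseteq> C)) =
          (\<Sum>C\<in>?X. if C = e <# H then of_bool (H = K \<and> g \<in> H) else (0::int))"
        by (intro sum.cong refl) auto
      then show ?thesis using eX by (simp add: sum.delta)
    qed
    then show "of_bool (E \<in> lcosets ?L) *
        (\<Sum>C\<in>?X. of_bool (C \<in> lcosets H \<and> C \<in> lcosets K \<and> E \<subseteq> C \<and> E #> g \<subseteq> C)) =
        of_bool (E \<in> lcosets ?L) * (of_bool (H = K \<and> g \<in> H) :: int)" by auto
  qed
  also have "\<dots> = of_bool (H = K \<and> g \<in> H) * int (card {E \<in> ?X. E \<in> lcosets ?L})"
    by (cases "H = K \<and> g \<in> H") (simp_all add: Int_def)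
  also have "{E \<in> ?X. E \<in> lcosets ?L} = {E \<in> lcosets ?L. \<forall>q\<in>Q. q <# E = E}"
    using gL by (auto simp: fixed_cosets_def)
  finally show ?thesis .
qed

section \<open>A generating set of the Mackey algebra\<close>

definition basis_word :: "'a set \<Rightarrow> 'a set \<Rightarrow> 'a \<Rightarrow> 'a set \<Rightarrow> 'a mackey_gen list" where
  "basis_word H K g L = [Tr H (conjugate G g L), Conj g L, Res K L]"

definition bas :: "'a set \<Rightarrow> 'a set \<Rightarrow> 'a \<Rightarrow> 'a set \<Rightarrow> ('a mackey_gen list \<Rightarrow> int) set" where
  "bas H K g L = P.wd (basis_word H K g L)"

definition admissible :: "'a set \<Rightarrow> 'a set \<Rightarrow> 'a \<Rightarrow> 'a set \<Rightarrow> bool" where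
  "admissible H K g L \<longleftrightarrow> subgroup H G \<and> subgroup K G \<and> subgroup L G \<and> g \<in> carrier G \<and>
    L \<subseteq> K \<and> conjugate G g L \<subseteq> H"

text \<open>For arbitrary \<open>G\<close> this set is only shown to span. Different parameters may
  give the same element.\<close>

definition basis_set :: "('a mackey_gen list \<Rightarrow> int) set set" where
  "basis_set = {bas H K g L | H K g L. admissible H K g L}"

lemma basis_word_in_lists: "admissible H K g L \<Longrightarrow> basis_word H K g L \<in> lists (mackey_gens G)"
  by (simp add: basis_word_def admissible_def mackey_gens_iff conjugate_subgroup)

lemma bas_closed: "admissible H K g L \<Longrightarrow> bas H K g L \<in> carrier \<mu>"
  unfolding bas_def by (intro P.wd_closed basis_word_in_lists)

lemma basis_set_closed: "basis_set \<subseteq> carrier \<mu>"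
  by (auto simp: basis_set_def bas_closed)

lemma basis_setI: "admissible H K g L \<Longrightarrow> bas H K g L \<in> basis_set"
  unfolding basis_set_def by blast

lemma finite_basis_set: "finite basis_set"
proof -
  let ?S = "{H. subgroup H G}"
  have "basis_set \<subseteq> (\<lambda>(H, K, g, L). bas H K g L) ` (?S \<times> ?S \<times> carrier G \<times> ?S)"
    by (auto simp: basis_set_def admissible_def)
  moreover have "finite (?S \<times> ?S \<times> carrier G \<times> ?S)" using finite_subgroups fin by simp
  ultimately show ?thesis by (meson finite_imageI finite_subset)
qed

lemma wd_context:
  assumes "P.wd u = P.wd v" and lists: "p \<in> lists (mackey_gens G)" "u \<in> lists (mackey_gens G)"
    "v \<in> lists (mackey_gens G)" "q \<in> lists (mackey_gens G)"
  shows "P.wd (p @ u @ q) = P.wd (p @ v @ q)"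
proof -
  have "P.wd (p @ u @ q) = P.wd p \<otimes>\<^bsub>\<mu>\<^esub> (P.wd u \<otimes>\<^bsub>\<mu>\<^esub> P.wd q)"
    "P.wd (p @ v @ q) = P.wd p \<otimes>\<^bsub>\<mu>\<^esub> (P.wd v \<otimes>\<^bsub>\<mu>\<^esub> P.wd q)"
    using lists by (simp_all add: P.wd_append append_in_lists_conv del: in_lists_conv_set)
  then show ?thesis using assms(1) by simp
qed

lemma word_relation:
  "(word \<Z> u, word \<Z> v) \<in> mackey_relations \<Z> G \<Longrightarrow> P.wd u = P.wd v"
  unfolding P.wd_def by (rule P.relation_cls)

lemma wd_self:
  assumes "subgroup H G"
  shows "P.wd [Res H H] = P.wd [Tr H H]" "h \<in> H \<Longrightarrow> P.wd [Conj h H] = P.wd [Tr H H]"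
  using word_relation[OF mackey_relations.tr_self[OF assms]]
    word_relation[OF mackey_relations.conj_self[OF assms]] by auto

lemma wd_non_composable:
  assumes "x \<in> mackey_gens G" "y \<in> mackey_gens G" "source x \<noteq> target G y" "w \<in> lists (mackey_gens G)"
  shows "P.wd (x # y # w) = \<zero>\<^bsub>\<mu>\<^esub>"
proof -
  have "P.cls (word \<Z> [x, y]) = P.cls \<zero>\<^bsub>free_algebra \<Z> (mackey_gens G)\<^esub>"
    by (rule P.relation_cls[OF mackey_relations.non_composable[OF assms(1-3)]])
  then have "P.wd [x, y] = \<zero>\<^bsub>\<mu>\<^esub>" by (simp add: P.wd_def P.cls_zero)
  moreover have "P.wd (x # y # w) = P.wd [x, y] \<otimes>\<^bsub>\<mu>\<^esub> P.wd w"
    using assms by (subst P.wd_append) (simp_all del: in_lists_conv_set)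
  ultimately show ?thesis using P.wd_closed[OF assms(4)] by simp
qed

lemma tr_bas:
  assumes "admissible H K g L" "subgroup H' G" "H \<subseteq> H'"
  shows "P.wd (Tr H' H # basis_word H K g L) = bas H' K g L"
proof -
  have L: "subgroup (conjugate G g L) G" using assms(1) by (simp add: admissible_def conjugate_subgroup)
  have "P.wd ([] @ [Tr H' H, Tr H (conjugate G g L)] @ [Conj g L, Res K L]) =
      P.wd ([] @ [Tr H' (conjugate G g L)] @ [Conj g L, Res K L])"
    by (rule wd_context[OF word_relation[OF mackey_relations.tr_tr]])
      (use assms L in \<open>auto simp: admissible_def mackey_gens_iff\<close>)
  then show ?thesis by (simp add: bas_def basis_word_def)
qed

lemma conj_bas:
  assumes "admissible H K g L" "x \<in> carrier G"
  shows "P.wd (Conj x H # basis_word H K g L) = bas (conjugate G x H) K (x \<otimes> g) L"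
    "admissible (conjugate G x H) K (x \<otimes> g) L"
proof -
  let ?L = "conjugate G g L"
  have sub: "subgroup H G" "subgroup K G" "subgroup L G" "g \<in> carrier G" "L \<subseteq> K" "?L \<subseteq> H"
    and gL: "subgroup ?L G"
    using assms(1) by (auto simp: admissible_def conjugate_subgroup)
  have xL: "conjugate G x ?L = conjugate G (x \<otimes> g) L" "subgroup (conjugate G x ?L) G"
    "subgroup (conjugate G x H) G" "conjugate G x ?L \<subseteq> conjugate G x H"
    using conjugate_conjugate[OF subgroup.subset[OF sub(3)] assms(2) sub(4)]
      conjugate_subgroup[OF gL assms(2)] conjugate_subgroup[OF sub(1) assms(2)]
      conjugate_mono[OF sub(6), of x] by simp_all
  have gens: "Conj x H \<in> mackey_gens G" "Tr H ?L \<in> mackey_gens G" "Conj g L \<in> mackey_gens G"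
    "Res K L \<in> mackey_gens G" "Tr (conjugate G x H) (conjugate G x ?L) \<in> mackey_gens G"
    "Conj x ?L \<in> mackey_gens G" "Conj (x \<otimes> g) L \<in> mackey_gens G"
    using sub xL gL assms(2) by (auto simp: mackey_gens_iff)
  have "P.wd ([] @ [Conj x H, Tr H ?L] @ [Conj g L, Res K L]) =
      P.wd ([] @ [Tr (conjugate G x H) (conjugate G x ?L), Conj x ?L] @ [Conj g L, Res K L])"
    by (rule wd_context[OF word_relation[OF mackey_relations.tr_conj, symmetric]])
      (use sub gL gens assms(2) in auto)
  also have "\<dots> = P.wd ([Tr (conjugate G x H) (conjugate G x ?L)] @ [Conj x ?L, Conj g L] @ [Res K L])"
    by simp
  also have "\<dots> = P.wd ([Tr (conjugate G x H) (conjugate G x ?L)] @ [Conj (x \<otimes> g) L] @ [Res K L])"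
    by (rule wd_context[OF word_relation[OF mackey_relations.conj_conj]])
      (use sub gens assms(2) in auto)
  finally show "P.wd (Conj x H # basis_word H K g L) = bas (conjugate G x H) K (x \<otimes> g) L"
    by (simp add: bas_def basis_word_def xL)
  show "admissible (conjugate G x H) K (x \<otimes> g) L"
    using sub xL assms(2) by (auto simp: admissible_def)
qed

text \<open>A conjugation by an element of \<open>H\<close> is absorbed by the outer transfer.
  Together with \<open>bas_right\<close> this makes \<open>bas\<close> depend on the double coset of
  \<open>g\<close> only, up to conjugating \<open>L\<close> inside \<open>K\<close>.\<close>

lemma bas_left:
  assumes "admissible H K g L" "h \<in> H"
  shows "bas H K (h \<otimes> g) L = bas H K g L" "admissible H K (h \<otimes> g) L"
proof -
  have sub: "subgroup H G" "subgroup K G" "subgroup L G" "g \<in> carrier G" "L \<subseteq> K"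
    using assms(1) by (auto simp: admissible_def)
  have h: "h \<in> carrier G" using subgroup.mem_carrier[OF sub(1) assms(2)] .
  have hH: "conjugate G h H = H" by (rule conjugate_self[OF sub(1) assms(2)])
  have "bas H K (h \<otimes> g) L = P.wd ([] @ [Conj h H] @ basis_word H K g L)"
    using conj_bas(1)[OF assms(1) h] hH by simp
  also have "\<dots> = P.wd ([] @ [Tr H H] @ basis_word H K g L)"
    by (rule wd_context[OF wd_self(2)[OF sub(1) assms(2)]])
      (use h sub(1) basis_word_in_lists[OF assms(1)] in \<open>simp_all add: mackey_gens_iff del: in_lists_conv_set\<close>)
  also have "\<dots> = bas H K g L" using tr_bas[OF assms(1) sub(1)] by simp
  finally show "bas H K (h \<otimes> g) L = bas H K g L" .
  show "admissible H K (h \<otimes> g) L" using conj_bas(2)[OF assms(1) h] hH by simp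
qed

text \<open>The conjugation by \<open>k\<close> is moved to the right through the restriction, which
  conjugates \<open>L\<close>, until it acts on \<open>K\<close> itself and becomes trivial.\<close>

lemma bas_right:
  assumes "admissible H K (g \<otimes> k) L" "g \<in> carrier G" "k \<in> K"
  shows "bas H K (g \<otimes> k) L = bas H K g (conjugate G k L)" "admissible H K g (conjugate G k L)"
proof -
  have sub: "subgroup H G" "subgroup K G" "subgroup L G" "L \<subseteq> K" "conjugate G (g \<otimes> k) L \<subseteq> H"
    using assms(1) by (auto simp: admissible_def)
  have k: "k \<in> carrier G" using subgroup.mem_carrier[OF sub(2) assms(3)] .
  have kK: "conjugate G k K = K" by (rule conjugate_self[OF sub(2) assms(3)])
  have kL: "subgroup (conjugate G k L) G" "conjugate G k L \<subseteq> K"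
    using conjugate_subgroup[OF sub(3) k] conjugate_mono[OF sub(4), of k] kK by auto
  have gk: "conjugate G (g \<otimes> k) L = conjugate G g (conjugate G k L)"
    using conjugate_conjugate[OF subgroup.subset[OF sub(3)] assms(2) k] by simp
  have g': "subgroup (conjugate G g (conjugate G k L)) G" by (rule conjugate_subgroup[OF kL(1) assms(2)])
  let ?T = "Tr H (conjugate G g (conjugate G k L))"
  have gens: "?T \<in> mackey_gens G" "Conj g (conjugate G k L) \<in> mackey_gens G" "Conj k L \<in> mackey_gens G"
    "Res K L \<in> mackey_gens G" "Conj (g \<otimes> k) L \<in> mackey_gens G" "Res K (conjugate G k L) \<in> mackey_gens G"
    "Conj k K \<in> mackey_gens G" "Res K K \<in> mackey_gens G"
    using sub gk g' kL k assms(2) by (auto simp: mackey_gens_iff)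
  have "bas H K (g \<otimes> k) L = P.wd ([?T] @ [Conj (g \<otimes> k) L] @ [Res K L])"
    by (simp add: bas_def basis_word_def gk)
  also have "\<dots> = P.wd ([?T] @ [Conj g (conjugate G k L), Conj k L] @ [Res K L])"
    by (rule wd_context[OF word_relation[OF mackey_relations.conj_conj, symmetric]])
      (use sub gens assms(2) k in auto)
  also have "\<dots> = P.wd ([?T, Conj g (conjugate G k L)] @ [Conj k L, Res K L] @ [])" by simp
  also have "\<dots> = P.wd ([?T, Conj g (conjugate G k L)] @ [Res (conjugate G k K) (conjugate G k L), Conj k K] @ [])"
    by (rule wd_context[OF word_relation[OF mackey_relations.res_conj, symmetric]])
      (use sub gens k kK in auto)
  also have "\<dots> = P.wd ([?T, Conj g (conjugate G k L), Res K (conjugate G k L)] @ [Conj k K] @ [])"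
    by (simp add: kK)
  also have "\<dots> = P.wd ([?T, Conj g (conjugate G k L), Res K (conjugate G k L)] @ [Res K K] @ [])"
    by (rule wd_context) (use wd_self[OF sub(2)] assms(3) gens in auto)
  also have "\<dots> = P.wd ([?T, Conj g (conjugate G k L)] @ [Res K (conjugate G k L), Res K K] @ [])" by simp
  also have "\<dots> = P.wd ([?T, Conj g (conjugate G k L)] @ [Res K (conjugate G k L)] @ [])"
    by (rule wd_context[OF word_relation[OF mackey_relations.res_res]]) (use sub gens kL in auto)
  finally show "bas H K (g \<otimes> k) L = bas H K g (conjugate G k L)"
    by (simp add: bas_def basis_word_def)
  show "admissible H K g (conjugate G k L)" using sub kL gk assms(2) by (auto simp: admissible_def)
qed

text \<open>In the Mackey formula the inner restriction has to be moved to the right past the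
  conjugation by \<open>g'\<close>; its target subgroup then becomes \<open>E\<close>.\<close>

lemma mackey_conjugate_Int:
  assumes "admissible K H' g' J" "subgroup L G" "h \<in> carrier G"
  defines "E \<equiv> conjugate G (inv g') (conjugate_right G L h \<inter> conjugate G g' J)"
  shows "admissible L H' (h \<otimes> g') E" "conjugate G g' E = conjugate_right G L h \<inter> conjugate G g' J"
    "conjugate G (h \<otimes> g') E = L \<inter> conjugate G h (conjugate G g' J)" "E \<subseteq> J"
proof -
  have sub: "subgroup H' G" "subgroup J G" "g' \<in> carrier G" "J \<subseteq> H'"
    using assms(1) by (auto simp: admissible_def)
  have gJ: "subgroup (conjugate G g' J) G" by (rule conjugate_subgroup[OF sub(2,3)])
  have I: "subgroup (conjugate_right G L h \<inter> conjugate G g' J) G"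
    by (rule conjugate_right_Int_subgroup[OF gJ assms(2,3)])
  have E: "subgroup E G" unfolding E_def by (rule conjugate_subgroup[OF I]) (use sub in simp)
  show gE: "conjugate G g' E = conjugate_right G L h \<inter> conjugate G g' J"
    unfolding E_def by (rule conjugate_inv_cancel(2)[OF subgroup.subset[OF I] sub(3)])
  show hE: "conjugate G (h \<otimes> g') E = L \<inter> conjugate G h (conjugate G g' J)"
    using conjugate_conjugate[OF subgroup.subset[OF E] assms(3) sub(3)] gE
      conjugate_conjugate_right_Int[OF gJ assms(2,3)] by simp
  have "E \<subseteq> conjugate G (inv g') (conjugate G g' J)" unfolding E_def by (rule conjugate_mono) simp
  then show EJ: "E \<subseteq> J" using conjugate_inv_cancel(1)[OF subgroup.subset[OF sub(2)] sub(3)] by simp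
  show "admissible L H' (h \<otimes> g') E"
    using sub E EJ hE assms(2,3) by (auto simp: admissible_def)
qed

text \<open>The Mackey formula rewrites the two leftmost letters. The letters of each summand are
  then brought into the order transfer, conjugation, restriction, and merged.\<close>

lemma res_bas:
  assumes adm: "admissible K H' g' J" and L: "subgroup L G" "L \<subseteq> K"
    and D: "double_coset_reps G L K (conjugate G g' J) D"
  shows "P.wd (Res K L # basis_word K H' g' J) =
    (\<Oplus>\<^bsub>\<mu>\<^esub>h\<in>D. bas L H' (h \<otimes> g') (conjugate G (inv g') (conjugate_right G L h \<inter> conjugate G g' J)))"
proof -
  let ?J = "conjugate G g' J" and ?I = "\<lambda>h. conjugate_right G L h \<inter> conjugate G g' J"
  let ?E = "\<lambda>h. conjugate G (inv g') (conjugate_right G L h \<inter> conjugate G g' J)"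
  let ?w = "\<lambda>h. [Tr L (L \<inter> conjugate G h ?J), Conj h (?I h), Res ?J (?I h)]"
  have sub: "subgroup K G" "subgroup H' G" "subgroup J G" "g' \<in> carrier G" "J \<subseteq> H'" "?J \<subseteq> K"
    and gJ: "subgroup ?J G"
    using adm by (auto simp: admissible_def conjugate_subgroup)
  have finD: "finite D" using double_coset_reps_finite[OF sub(1) D] .
  have DG: "h \<in> carrier G" if "h \<in> D" for h
    using that D subgroup.subset[OF sub(1)] by (auto simp: double_coset_reps_def)
  have w: "?w h \<in> lists (mackey_gens G)" if "h \<in> D" for h
    by (rule mackey_word_in_lists[OF sub(1) gJ L sub(6) D that])
  let ?q = "[Conj g' J, Res H' J]"
  have q: "?q \<in> lists (mackey_gens G)" "P.wd ?q \<in> carrier \<mu>"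
    using sub by (auto simp: mackey_gens_iff intro!: P.wd_closed)
  have rel: "P.wd [Res K L, Tr K ?J] = (\<Oplus>\<^bsub>\<mu>\<^esub>h\<in>D. P.wd (?w h))"
    unfolding P.wd_def
      P.relation_cls[OF mackey_relations.mackey_formula[OF sub(1) gJ L(1) L(2) sub(6) D]]
    by (rule P.cls_finsum) (intro Pi_I word_in_free_algebra w)
  have "P.wd (Res K L # basis_word K H' g' J) = P.wd [Res K L, Tr K ?J] \<otimes>\<^bsub>\<mu>\<^esub> P.wd ?q"
    unfolding basis_word_def
    by (subst P.wd_append) (use sub gJ L q in \<open>auto simp: mackey_gens_iff\<close>)
  also have "\<dots> = (\<Oplus>\<^bsub>\<mu>\<^esub>h\<in>D. P.wd (?w h) \<otimes>\<^bsub>\<mu>\<^esub> P.wd ?q)"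
    unfolding rel
    by (rule P.A.finsum_ldistr[OF finD q(2)]) (intro Pi_I P.wd_closed w)
  also have "\<dots> = (\<Oplus>\<^bsub>\<mu>\<^esub>h\<in>D. bas L H' (h \<otimes> g') (?E h))"
  proof (rule P.A.finsum_cong'[OF refl])
    show "(\<lambda>h. bas L H' (h \<otimes> g') (?E h)) \<in> D \<rightarrow> carrier \<mu>"
      using mackey_conjugate_Int(1)[OF adm L(1) DG] bas_closed by blast
    fix h assume h: "h \<in> D"
    note E = mackey_conjugate_Int[OF adm L(1) DG[OF h]]
    have Es: "subgroup (?E h) G" using E(1) by (simp add: admissible_def)
    have gens: "Tr L (conjugate G (h \<otimes> g') (?E h)) \<in> mackey_gens G" "Conj h (conjugate G g' (?E h)) \<in> mackey_gens G"
      "Res ?J (conjugate G g' (?E h)) \<in> mackey_gens G" "Conj g' J \<in> mackey_gens G" "Res H' J \<in> mackey_gens G"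
      "Conj g' (?E h) \<in> mackey_gens G" "Res J (?E h) \<in> mackey_gens G" "Conj (h \<otimes> g') (?E h) \<in> mackey_gens G"
      "Res H' (?E h) \<in> mackey_gens G"
      using w[OF h] E sub Es gJ DG[OF h] by (auto simp: mackey_gens_iff admissible_def)
    have "P.wd (?w h) \<otimes>\<^bsub>\<mu>\<^esub> P.wd ?q = P.wd (?w h @ ?q)" by (rule P.wd_append[OF w[OF h] q(1)])
    also have "\<dots> = P.wd ([Tr L (conjugate G (h \<otimes> g') (?E h)), Conj h (conjugate G g' (?E h))] @
        [Res ?J (conjugate G g' (?E h)), Conj g' J] @ [Res H' J])"
      using E(2,3) by simp
    also have "\<dots> = P.wd ([Tr L (conjugate G (h \<otimes> g') (?E h)), Conj h (conjugate G g' (?E h))] @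
        [Conj g' (?E h), Res J (?E h)] @ [Res H' J])"
      by (rule wd_context[OF word_relation[OF mackey_relations.res_conj]]) (use sub Es E gens in auto)
    also have "\<dots> = P.wd ([Tr L (conjugate G (h \<otimes> g') (?E h))] @
        [Conj h (conjugate G g' (?E h)), Conj g' (?E h)] @ [Res J (?E h), Res H' J])" by simp
    also have "\<dots> = P.wd ([Tr L (conjugate G (h \<otimes> g') (?E h))] @
        [Conj (h \<otimes> g') (?E h)] @ [Res J (?E h), Res H' J])"
      by (rule wd_context[OF word_relation[OF mackey_relations.conj_conj]]) (use sub Es DG[OF h] gens in auto)
    also have "\<dots> = P.wd ([Tr L (conjugate G (h \<otimes> g') (?E h)), Conj (h \<otimes> g') (?E h)] @
        [Res J (?E h), Res H' J] @ [])" by simp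
    also have "\<dots> = P.wd ([Tr L (conjugate G (h \<otimes> g') (?E h)), Conj (h \<otimes> g') (?E h)] @
        [Res H' (?E h)] @ [])"
      by (rule wd_context[OF word_relation[OF mackey_relations.res_res]]) (use sub Es E gens in auto)
    also have "\<dots> = bas L H' (h \<otimes> g') (?E h)" by (simp add: bas_def basis_word_def)
    finally show "P.wd (?w h) \<otimes>\<^bsub>\<mu>\<^esub> P.wd ?q = bas L H' (h \<otimes> g') (?E h)" .
  qed
  finally show ?thesis .
qed

lemma bas_mult:
  assumes a: "admissible H K g L" and b: "admissible K H' g' J"
    and D: "double_coset_reps G L K (conjugate G g' J) D"
  shows "bas H K g L \<otimes>\<^bsub>\<mu>\<^esub> bas K H' g' J =
    (\<Oplus>\<^bsub>\<mu>\<^esub>h\<in>D. bas H H' (g \<otimes> (h \<otimes> g')) (conjugate G (inv g') (conjugate_right G L h \<inter> conjugate G g' J)))"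
    "\<And>h. h \<in> D \<Longrightarrow>
      admissible H H' (g \<otimes> (h \<otimes> g')) (conjugate G (inv g') (conjugate_right G L h \<inter> conjugate G g' J))"
proof -
  let ?E = "\<lambda>h. conjugate G (inv g') (conjugate_right G L h \<inter> conjugate G g' J)"
  have sub: "subgroup H G" "subgroup K G" "subgroup L G" "g \<in> carrier G" "L \<subseteq> K" "conjugate G g L \<subseteq> H"
    and gL: "subgroup (conjugate G g L) G"
    using a by (auto simp: admissible_def conjugate_subgroup)
  have g': "g' \<in> carrier G" using b by (simp add: admissible_def)
  have finD: "finite D" using double_coset_reps_finite[OF sub(2) D] .
  have DG: "h \<in> carrier G" if "h \<in> D" for h
    using that D subgroup.subset[OF sub(2)] by (auto simp: double_coset_reps_def)
  have E: "admissible L H' (h \<otimes> g') (?E h)" if "h \<in> D" for h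
    using mackey_conjugate_Int(1)[OF b sub(3) DG[OF that]] .
  let ?p = "[Tr H (conjugate G g L), Conj g L]"
  have p: "?p \<in> lists (mackey_gens G)" "[Res K L] \<in> lists (mackey_gens G)"
    using sub gL by (auto simp: mackey_gens_iff)
  note bw = basis_word_in_lists[OF b]
  have "bas H K g L \<otimes>\<^bsub>\<mu>\<^esub> bas K H' g' J = P.wd (?p @ ([Res K L] @ basis_word K H' g' J))"
    unfolding bas_def basis_word_def[of H K g L]
    by (subst P.wd_append) (use p bw in \<open>auto simp del: in_lists_conv_set\<close>)
  also have "\<dots> = P.wd ?p \<otimes>\<^bsub>\<mu>\<^esub> P.wd (Res K L # basis_word K H' g' J)"
    using p bw by (subst P.wd_append) (auto simp del: in_lists_conv_set)
  also have "\<dots> = (\<Oplus>\<^bsub>\<mu>\<^esub>h\<in>D. P.wd ?p \<otimes>\<^bsub>\<mu>\<^esub> bas L H' (h \<otimes> g') (?E h))"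
    unfolding res_bas[OF b sub(3,5) D]
    by (rule P.A.finsum_rdistr[OF finD P.wd_closed[OF p(1)]]) (use E bas_closed in blast)
  also have step: "P.wd ?p \<otimes>\<^bsub>\<mu>\<^esub> bas L H' (h \<otimes> g') (?E h) = bas H H' (g \<otimes> (h \<otimes> g')) (?E h) \<and>
      admissible H H' (g \<otimes> (h \<otimes> g')) (?E h)" if h: "h \<in> D" for h
  proof -
    let ?b = "basis_word L H' (h \<otimes> g') (?E h)"
    note c = conj_bas[OF E[OF h] sub(4)]
    have b1: "?b \<in> lists (mackey_gens G)" by (rule basis_word_in_lists[OF E[OF h]])
    have b2: "basis_word (conjugate G g L) H' (g \<otimes> (h \<otimes> g')) (?E h) \<in> lists (mackey_gens G)"
      by (rule basis_word_in_lists[OF c(2)])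
    have "P.wd ?p \<otimes>\<^bsub>\<mu>\<^esub> bas L H' (h \<otimes> g') (?E h) = P.wd ([Tr H (conjugate G g L)] @ (Conj g L # ?b) @ [])"
      unfolding bas_def using p b1 by (subst P.wd_append) (auto simp del: in_lists_conv_set)
    also have "\<dots> = P.wd ([Tr H (conjugate G g L)] @ basis_word (conjugate G g L) H' (g \<otimes> (h \<otimes> g')) (?E h) @ [])"
      by (rule wd_context[OF c(1)[unfolded bas_def]]) (use p b1 b2 in \<open>auto simp del: in_lists_conv_set\<close>)
    also have "\<dots> = bas H H' (g \<otimes> (h \<otimes> g')) (?E h)"
      using tr_bas[OF c(2) sub(1,6)] by simp
    finally show ?thesis using c(2) sub(1,6) by (auto simp: admissible_def)
  qed
  then have "(\<Oplus>\<^bsub>\<mu>\<^esub>h\<in>D. P.wd ?p \<otimes>\<^bsub>\<mu>\<^esub> bas L H' (h \<otimes> g') (?E h)) =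
      (\<Oplus>\<^bsub>\<mu>\<^esub>h\<in>D. bas H H' (g \<otimes> (h \<otimes> g')) (?E h))"
    by (intro P.A.finsum_cong') (use bas_closed in auto)
  finally show "bas H K g L \<otimes>\<^bsub>\<mu>\<^esub> bas K H' g' J = (\<Oplus>\<^bsub>\<mu>\<^esub>h\<in>D. bas H H' (g \<otimes> (h \<otimes> g')) (?E h))" .
  show "\<And>h. h \<in> D \<Longrightarrow> admissible H H' (g \<otimes> (h \<otimes> g')) (?E h)" using step by blast
qed

lemma bas_mult_non_composable:
  assumes a: "admissible H K g L" and b: "admissible K' H' g' J" and "K \<noteq> K'"
  shows "bas H K g L \<otimes>\<^bsub>\<mu>\<^esub> bas K' H' g' J = \<zero>\<^bsub>\<mu>\<^esub>"
proof -
  let ?p = "[Tr H (conjugate G g L), Conj g L]"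
  let ?w = "Res K L # Tr K' (conjugate G g' J) # [Conj g' J, Res H' J]"
  have lists: "?p \<in> lists (mackey_gens G)" "?w \<in> lists (mackey_gens G)"
    using basis_word_in_lists[OF a] basis_word_in_lists[OF b] by (auto simp: basis_word_def)
  have "P.wd ?w = \<zero>\<^bsub>\<mu>\<^esub>" by (rule wd_non_composable) (use lists assms(3) in auto)
  moreover have "bas H K g L \<otimes>\<^bsub>\<mu>\<^esub> bas K' H' g' J = P.wd ?p \<otimes>\<^bsub>\<mu>\<^esub> P.wd ?w"
    unfolding bas_def
    using basis_word_in_lists[OF a] basis_word_in_lists[OF b] lists
    by (simp only: P.wd_append) (simp add: basis_word_def)
  ultimately show ?thesis using P.wd_closed[OF lists(1)] by simp
qed

lemma exists_double_coset_reps: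
  assumes "subgroup H G" "subgroup K G" "subgroup L G" "K \<subseteq> H" "L \<subseteq> H"
  shows "\<exists>D. double_coset_reps G L H K D"
proof -
  interpret H: subgroup H G by fact
  interpret K: subgroup K G by fact
  interpret L: subgroup L G by fact
  let ?dc = "\<lambda>x. (L #> x) <#> K"
  have mem: "d \<in> ?dc x \<longleftrightarrow> (\<exists>l\<in>L. \<exists>k\<in>K. d = l \<otimes> x \<otimes> k)" if "x \<in> carrier G" for d x
    using mem_double_coset[OF assms(3,2) that] .
  have self: "x \<in> ?dc x" if "x \<in> H" for x
    using that mem[of x x] by (auto intro!: bexI[of _ \<one>])
  have sub: "?dc x \<subseteq> ?dc y" if xy: "x \<in> ?dc y" "y \<in> H" for x y
  proof
    fix z assume z: "z \<in> ?dc x"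
    obtain l k where lk: "l \<in> L" "k \<in> K" "x = l \<otimes> y \<otimes> k" using xy mem[of y x] by auto
    then have "x \<in> carrier G" using xy by simp
    then obtain l' k' where lk': "l' \<in> L" "k' \<in> K" "z = l' \<otimes> x \<otimes> k'" using z mem[of x z] by auto
    have "z = (l' \<otimes> l) \<otimes> y \<otimes> (k \<otimes> k')" using lk lk' that by (simp add: m_assoc)
    then show "z \<in> ?dc y" using lk lk' that mem[of y z] by auto
  qed
  have sym: "y \<in> ?dc x" if xy: "x \<in> ?dc y" "y \<in> H" for x y
  proof -
    obtain l k where lk: "l \<in> L" "k \<in> K" "x = l \<otimes> y \<otimes> k" using xy mem[of y x] by auto
    then have "y = inv l \<otimes> x \<otimes> inv k" using that by (simp add: m_assoc inv_mult_cancel_left)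
    then show ?thesis using lk that mem[of x y] by auto
  qed
  define rep where "rep Y = (SOME x. x \<in> Y \<and> x \<in> H)" for Y
  have rep: "rep (?dc x) \<in> ?dc x \<and> rep (?dc x) \<in> H" if "x \<in> H" for x
    unfolding rep_def by (rule someI[of _ x], rule conjI[OF self[OF that] that])
  have reps: "(\<lambda>x. rep (?dc x)) ` H \<subseteq> H" using rep by auto
  have "double_coset_reps G L H K ((\<lambda>x. rep (?dc x)) ` H)"
    unfolding double_coset_reps_def
  proof (rule conjI[OF reps], rule ballI, rule ex1I)
    fix x assume x: "x \<in> H"
    then show "rep (?dc x) \<in> (\<lambda>x. rep (?dc x)) ` H \<and> rep (?dc x) \<in> ?dc x" using rep by auto
    fix d assume d: "d \<in> (\<lambda>x. rep (?dc x)) ` H \<and> d \<in> ?dc x"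
    then obtain y where y: "y \<in> H" "d = rep (?dc y)" by auto
    have dH: "d \<in> H" and dy: "d \<in> ?dc y" using rep[OF y(1)] y(2) by auto
    have dx: "d \<in> ?dc x" using d by blast
    have "?dc d = ?dc y" using sub[OF dy y(1)] sub[OF sym[OF dy y(1)] dH] by (rule equalityI)
    moreover have "?dc d = ?dc x" using sub[OF dx x] sub[OF sym[OF dx x] dH] by (rule equalityI)
    ultimately show "d = rep (?dc x)" using y(2) by simp
  qed
  then show ?thesis by blast
qed

lemma bas_identity:
  assumes "subgroup H G"
  shows "admissible H H \<one> H" "bas H H \<one> H = P.wd [Tr H H]"
proof -
  have H1: "conjugate G \<one> H = H" by (rule conjugate_one[OF subgroup.subset[OF assms]])
  show "admissible H H \<one> H" using assms H1 by (simp add: admissible_def)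
  have gens: "Tr H H \<in> mackey_gens G" "Conj \<one> H \<in> mackey_gens G" "Res H H \<in> mackey_gens G"
    using assms by (auto simp: mackey_gens_iff)
  have "bas H H \<one> H = P.wd ([Tr H H] @ [Conj \<one> H] @ [Res H H])"
    by (simp add: bas_def basis_word_def H1)
  also have "\<dots> = P.wd ([Tr H H] @ [Tr H H] @ [Res H H])"
    by (rule wd_context[OF wd_self(2)[OF assms subgroup.one_closed[OF assms]]]) (use gens in auto)
  also have "\<dots> = P.wd ([Tr H H, Tr H H] @ [Res H H] @ [])" by simp
  also have "\<dots> = P.wd ([Tr H H, Tr H H] @ [Tr H H] @ [])"
    by (rule wd_context[OF wd_self(1)[OF assms]]) (use gens in auto)
  also have "\<dots> = P.wd ([Tr H H] @ [Tr H H, Tr H H] @ [])" by simp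
  also have "\<dots> = P.wd ([Tr H H] @ [Tr H H] @ [])"
    by (rule wd_context[OF word_relation[OF mackey_relations.tr_tr]]) (use gens assms in auto)
  also have "\<dots> = P.wd ([] @ [Tr H H, Tr H H] @ [])" by simp
  also have "\<dots> = P.wd ([] @ [Tr H H] @ [])"
    by (rule wd_context[OF word_relation[OF mackey_relations.tr_tr]]) (use gens assms in auto)
  finally show "bas H H \<one> H = P.wd [Tr H H]" by simp
qed

lemma one_eq: "\<one>\<^bsub>\<mu>\<^esub> = (\<Oplus>\<^bsub>\<mu>\<^esub>H\<in>{H. subgroup H G}. bas H H \<one> H)"
proof -
  have "\<one>\<^bsub>\<mu>\<^esub> = P.cls (\<Oplus>\<^bsub>free_algebra \<Z> (mackey_gens G)\<^esub>H\<in>{H. subgroup H G}. word \<Z> [Tr H H])"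
    using P.relation_cls[OF mackey_relations.unit] P.cls_one by simp
  also have "\<dots> = (\<Oplus>\<^bsub>\<mu>\<^esub>H\<in>{H. subgroup H G}. P.wd [Tr H H])"
    unfolding P.wd_def
    by (rule P.cls_finsum) (auto intro!: word_in_free_algebra simp: mackey_gens_iff)
  also have "\<dots> = (\<Oplus>\<^bsub>\<mu>\<^esub>H\<in>{H. subgroup H G}. bas H H \<one> H)"
    by (rule P.A.finsum_cong'[OF refl])
      (use bas_identity bas_closed[OF bas_identity(1)] in auto)
  finally show ?thesis .
qed

lemma gen_mult_basis:
  assumes x: "x \<in> mackey_gens G" and b: "b \<in> basis_set"
  shows "P.wd [x] \<otimes>\<^bsub>\<mu>\<^esub> b \<in> \<mu>.int_span basis_set"
proof -
  note base = \<mu>.int_span_base[OF basis_set_closed finite_basis_set]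
  note zero = \<mu>.int_span_zero[OF basis_set_closed]
  obtain H K g L where adm: "admissible H K g L" and b_eq: "b = bas H K g L"
    using b by (auto simp: basis_set_def)
  note bw = basis_word_in_lists[OF adm]
  have prod: "P.wd [x] \<otimes>\<^bsub>\<mu>\<^esub> b = P.wd (x # basis_word H K g L)"
    unfolding b_eq bas_def using x bw by (subst P.wd_append) (simp_all del: in_lists_conv_set)
  show ?thesis
  proof (cases "source x = H")
    case False
    have "P.wd (x # basis_word H K g L) = \<zero>\<^bsub>\<mu>\<^esub>"
      unfolding basis_word_def
      by (rule wd_non_composable) (use x bw False in \<open>auto simp: basis_word_def\<close>)
    then show ?thesis using prod zero by simp
  next
    case True
    show ?thesis
    proof (cases x)
      case (Tr K' H')
      then have "subgroup K' G" "H \<subseteq> K'" "x = Tr K' H" using x True by (auto simp: mackey_gens_iff)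
      moreover from this have "admissible K' K g L" using adm by (auto simp: admissible_def)
      ultimately show ?thesis using prod tr_bas[OF adm] base[OF basis_setI] by simp
    next
      case (Conj y H')
      then have "y \<in> carrier G" "x = Conj y H" using x True by (auto simp: mackey_gens_iff)
      then show ?thesis using prod conj_bas[OF adm] base[OF basis_setI] by simp
    next
      case (Res K' J)
      then have J: "subgroup J G" "J \<subseteq> H" "x = Res H J" using x True by (auto simp: mackey_gens_iff)
      have gL: "subgroup H G" "subgroup (conjugate G g L) G" "conjugate G g L \<subseteq> H"
        using adm by (auto simp: admissible_def conjugate_subgroup)
      obtain D where D: "double_coset_reps G J H (conjugate G g L) D"
        using exists_double_coset_reps[OF gL(1,2) J(1) gL(3) J(2)] by blast
      have "bas J K (h \<otimes> g) (conjugate G (inv g) (conjugate_right G J h \<inter> conjugate G g L)) \<in> \<mu>.int_span basis_set"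
        if "h \<in> D" for h
      proof -
        have "h \<in> carrier G" using that D subgroup.subset[OF gL(1)] by (auto simp: double_coset_reps_def)
        from mackey_conjugate_Int(1)[OF adm J(1) this] show ?thesis by (intro base basis_setI)
      qed
      then show ?thesis
        unfolding J(3) prod[unfolded J(3)] res_bas[OF adm J(1,2) D]
        by (rule \<mu>.int_span_finsum[OF basis_set_closed finite_basis_set])
    qed
  qed
qed

text \<open>The span contains \<open>\<one>\<close>, the sum of the identities of all subgroups, and
  is closed under left multiplication by generators; hence it contains all words.\<close>

lemma basis_set_spans: "carrier \<mu> \<subseteq> \<mu>.int_span basis_set"
proof
  have mult: "P.wd [x] \<otimes>\<^bsub>\<mu>\<^esub> y \<in> \<mu>.int_span basis_set"
    if x: "x \<in> mackey_gens G" and y: "y \<in> \<mu>.int_span basis_set" for x y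
  proof -
    obtain c where c: "y = (\<Oplus>\<^bsub>\<mu>\<^esub>b\<in>basis_set. c b \<odot>\<^bsub>\<mu>\<^esub> b)" using y by (auto simp: \<mu>.int_span_def)
    have xw: "P.wd [x] \<in> carrier \<mu>" using x by (intro P.wd_closed) simp
    have "P.wd [x] \<otimes>\<^bsub>\<mu>\<^esub> y = (\<Oplus>\<^bsub>\<mu>\<^esub>b\<in>basis_set. P.wd [x] \<otimes>\<^bsub>\<mu>\<^esub> (c b \<odot>\<^bsub>\<mu>\<^esub> b))"
      unfolding c by (rule P.A.finsum_rdistr[OF finite_basis_set xw]) (use basis_set_closed in auto)
    also have "\<dots> \<in> \<mu>.int_span basis_set"
    proof (rule \<mu>.int_span_finsum[OF basis_set_closed finite_basis_set])
      fix b assume b: "b \<in> basis_set"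
      then have "P.wd [x] \<otimes>\<^bsub>\<mu>\<^esub> (c b \<odot>\<^bsub>\<mu>\<^esub> b) = c b \<odot>\<^bsub>\<mu>\<^esub> (P.wd [x] \<otimes>\<^bsub>\<mu>\<^esub> b)"
        using xw basis_set_closed by (intro P.A.smult_mult_right) auto
      then show "P.wd [x] \<otimes>\<^bsub>\<mu>\<^esub> (c b \<odot>\<^bsub>\<mu>\<^esub> b) \<in> \<mu>.int_span basis_set"
        using \<mu>.int_span_smult[OF basis_set_closed finite_basis_set gen_mult_basis[OF x b]] by simp
    qed
    finally show ?thesis .
  qed
  have words: "P.wd w \<in> \<mu>.int_span basis_set" if "w \<in> lists (mackey_gens G)" for w
    using that
  proof (induction w)
    case Nil
    show ?case
      unfolding P.wd_Nil one_eq
      by (rule \<mu>.int_span_finsum[OF basis_set_closed finite_basis_set],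
          rule \<mu>.int_span_base[OF basis_set_closed finite_basis_set])
        (use bas_identity(1) basis_setI in auto)
  next
    case (Cons x w)
    then have "P.wd (x # w) = P.wd [x] \<otimes>\<^bsub>\<mu>\<^esub> P.wd w"
      by (subst P.wd_append) (simp_all del: in_lists_conv_set)
    then show ?case using mult Cons by simp
  qed
  fix x assume "x \<in> carrier \<mu>"
  then show "x \<in> \<mu>.int_span basis_set"
  proof (induction x rule: P.presented_induct)
    case (word w)
    then show ?case by (rule words)
  next
    case (add x y)
    then show ?case by (intro \<mu>.int_span_add[OF basis_set_closed])
  next
    case (smult a x)
    then show ?case by (intro \<mu>.int_span_smult[OF basis_set_closed finite_basis_set])
  qed
qed

section \<open>Counting orbits of one type by Moebius inversion\<close>

lemma exists_moebius:
  assumes L: "subgroup L G"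
  shows "\<exists>m :: 'a set \<Rightarrow> int. \<forall>R. subgroup R G \<longrightarrow> L \<subseteq> R \<longrightarrow>
    (\<Sum>Q\<in>{Q. subgroup Q G \<and> L \<subseteq> Q \<and> Q \<subseteq> R}. m Q) = of_bool (R = L)"
proof -
  \<comment> \<open>The Moebius function of the subgroups above \<open>L\<close>, defined by
    recursion on the order of the subgroup.\<close>
  have "\<exists>m :: 'a set \<Rightarrow> int. \<forall>R. m R = of_bool (R = L) -
      (\<Sum>Q\<in>{Q. subgroup Q G \<and> L \<subseteq> Q \<and> Q \<subseteq> R \<and> card Q < card R}. m Q)"
    by (rule dependent_wf_choice[OF wf_measure[of card]]) (auto intro!: sum.cong)
  then obtain m :: "'a set \<Rightarrow> int" where m: "\<And>R. m R = of_bool (R = L) -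
      (\<Sum>Q\<in>{Q. subgroup Q G \<and> L \<subseteq> Q \<and> Q \<subseteq> R \<and> card Q < card R}. m Q)" by blast
  have "(\<Sum>Q\<in>{Q. subgroup Q G \<and> L \<subseteq> Q \<and> Q \<subseteq> R}. m Q) = of_bool (R = L)"
    if R: "subgroup R G" "L \<subseteq> R" for R
  proof -
    let ?S = "{Q. subgroup Q G \<and> L \<subseteq> Q \<and> Q \<subseteq> R \<and> card Q < card R}"
    have "{Q. subgroup Q G \<and> L \<subseteq> Q \<and> Q \<subseteq> R} = insert R ?S"
      using R psubset_card_mono[OF finite_subgroup[OF R(1)]] by auto
    moreover have "finite ?S" by (rule finite_subset[OF _ finite_subgroups]) auto
    ultimately show ?thesis using m[of R] by simp
  qed
  then show ?thesis by blast
qed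

lemma coset_stabilizer:
  assumes "subgroup J G" "a \<in> carrier G"
  shows "{x \<in> carrier G. x <# (a <# J) = a <# J} = conjugate G a J"
proof -
  interpret J: subgroup J G by fact
  have "x <# (a <# J) = a <# J \<longleftrightarrow> x \<in> conjugate G a J" if x: "x \<in> carrier G" for x
  proof -
    have "x <# (a <# J) = (x \<otimes> a) <# J" using x assms J.subset by (simp add: lcos_m_assoc)
    moreover have "(x \<otimes> a) <# J = a <# J \<longleftrightarrow> x \<otimes> a \<in> a <# J"
      using lcos_self[of "x \<otimes> a" J] l_repr_independence[of "x \<otimes> a" a J] assms x by auto
    moreover have "x \<otimes> a \<in> a <# J \<longleftrightarrow> inv a \<otimes> (x \<otimes> a) \<in> J"
      using lcoset_mem_iff[OF assms(1,2), of "x \<otimes> a"] x assms(2) by simp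
    ultimately show ?thesis using mem_conjugate[OF J.subset assms(2) x] x assms(2) by (simp add: m_assoc)
  qed
  then show ?thesis using conjugate_closed[OF J.subset assms(2)] by auto
qed

text \<open>If \<open>J\<close> is conjugate to \<open>L\<close> there are |N(L) : L| such points,
  the same number for every such \<open>J\<close>; otherwise there are none.\<close>

definition orbit_points :: "'a set \<Rightarrow> 'a set \<Rightarrow> 'a set set" where
  "orbit_points L J = {E \<in> lcosets J. {x \<in> carrier G. x <# E = E} = L}"

lemma orbit_points_empty:
  assumes "subgroup J G" "\<And>a. a \<in> carrier G \<Longrightarrow> conjugate G a J \<noteq> L"
  shows "orbit_points L J = {}"
proof (rule equals0I)
  fix E assume E: "E \<in> orbit_points L J"
  then obtain a where "a \<in> carrier G" "E = a <# J" by (auto simp: orbit_points_def elim: lcosetsE)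
  then show False using E assms(2)[of a] coset_stabilizer[OF assms(1)] by (simp add: orbit_points_def)
qed

lemma card_orbit_points_conjugate:
  assumes J: "subgroup J G" and a: "a \<in> carrier G"
  shows "card (orbit_points L (conjugate G a J)) = card (orbit_points L J)"
proof -
  have stab: "{x \<in> carrier G. x <# (E #> y) = E #> y} = {x \<in> carrier G. x <# E = E}"
    if E: "E \<subseteq> carrier G" and y: "y \<in> carrier G" for E y
  proof -
    have "x <# (E #> y) = E #> y \<longleftrightarrow> x <# E = E" if x: "x \<in> carrier G" for x
    proof -
      have sub: "x <# E \<subseteq> carrier G" using E x by (rule l_coset_subset_G)
      have "x <# (E #> y) = (x <# E) #> y" by (rule coset_assoc[OF x y E])
      moreover have "(x <# E) #> y = E #> y \<longleftrightarrow> x <# E = E"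
        using rcos_inv_cancel(2)[OF sub y] rcos_inv_cancel(2)[OF E y] by metis
      ultimately show ?thesis by simp
    qed
    then show ?thesis by blast
  qed
  have "bij_betw (\<lambda>E. E #> inv a) (orbit_points L J) (orbit_points L (conjugate G a J))"
  proof (rule bij_betwI[where g = "\<lambda>E. E #> a"])
    show "(\<lambda>E. E #> inv a) \<in> orbit_points L J \<rightarrow> orbit_points L (conjugate G a J)"
      using lcoset_rmult[OF J a] stab[OF lcoset_carrier[OF J] inv_closed[OF a]]
      by (auto simp: orbit_points_def)
    show "(\<lambda>E. E #> a) \<in> orbit_points L (conjugate G a J) \<rightarrow> orbit_points L J"
      using lcoset_rmult'[OF J a] stab[OF lcoset_carrier[OF conjugate_subgroup[OF J a]] a]
      by (auto simp: orbit_points_def)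
  qed (use lcoset_carrier[OF J] lcoset_carrier[OF conjugate_subgroup[OF J a]] a in
      \<open>auto simp: orbit_points_def rcos_inv_cancel\<close>)
  then show ?thesis by (rule bij_betw_same_card[symmetric])
qed

lemma finite_lcosets: "subgroup J G \<Longrightarrow> finite (lcosets J)"
  by (rule finite_subset[OF lcosets_subset_PowG]) (use fin in auto)

text \<open>After exchanging the sums, every point is weighted by the sum of \<open>m Q\<close> over
  the \<open>Q\<close> between \<open>L\<close> and its stabilizer, and this weight is 1 if the
  stabilizer is \<open>L\<close> and 0 otherwise.\<close>

lemma moebius_fixed_points:
  assumes L: "subgroup L G" and J: "subgroup J G"
    and m: "\<And>R. \<lbrakk>subgroup R G; L \<subseteq> R\<rbrakk> \<Longrightarrow>
      (\<Sum>Q\<in>{Q. subgroup Q G \<and> L \<subseteq> Q \<and> Q \<subseteq> R}. m Q) = (of_bool (R = L) :: int)"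
  shows "(\<Sum>Q\<in>{Q. subgroup Q G \<and> L \<subseteq> Q}. m Q * int (card {E \<in> lcosets J. \<forall>q\<in>Q. q <# E = E})) =
    int (card (orbit_points L J))"
proof -
  let ?Q = "{Q. subgroup Q G \<and> L \<subseteq> Q}" and ?st = "\<lambda>E. {x \<in> carrier G. x <# E = E}"
  note finL = finite_lcosets[OF J]
  have finQ: "finite ?Q" by (rule finite_subset[OF _ finite_subgroups]) auto
  have "(\<Sum>Q\<in>?Q. m Q * int (card {E \<in> lcosets J. \<forall>q\<in>Q. q <# E = E})) =
      (\<Sum>Q\<in>?Q. \<Sum>E\<in>lcosets J. m Q * of_bool (Q \<subseteq> ?st E))"
  proof (rule sum.cong[OF refl])
    fix Q assume "Q \<in> ?Q"
    then have "Q \<subseteq> carrier G" using subgroup.subset by auto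
    then have "{E \<in> lcosets J. \<forall>q\<in>Q. q <# E = E} = {E \<in> lcosets J. Q \<subseteq> ?st E}" by auto
    then show "m Q * int (card {E \<in> lcosets J. \<forall>q\<in>Q. q <# E = E}) =
        (\<Sum>E\<in>lcosets J. m Q * of_bool (Q \<subseteq> ?st E))"
      using finL by (simp add: sum_distrib_left[symmetric] Int_def)
  qed
  also have "\<dots> = (\<Sum>E\<in>lcosets J. \<Sum>Q\<in>?Q. m Q * of_bool (Q \<subseteq> ?st E))" by (rule sum.swap)
  also have "\<dots> = (\<Sum>E\<in>lcosets J. of_bool (?st E = L))"
  proof (rule sum.cong[OF refl])
    fix E assume "E \<in> lcosets J"
    then obtain a where "a \<in> carrier G" "E = a <# J" by (rule lcosetsE)
    then have st: "subgroup (?st E) G" using coset_stabilizer[OF J] conjugate_subgroup[OF J] by simp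
    have "(\<Sum>Q\<in>?Q. m Q * of_bool (Q \<subseteq> ?st E)) = (\<Sum>Q\<in>{Q. subgroup Q G \<and> L \<subseteq> Q \<and> Q \<subseteq> ?st E}. m Q)"
      by (rule sum.mono_neutral_cong_right[OF finQ]) auto
    also have "\<dots> = of_bool (?st E = L)"
    proof (cases "L \<subseteq> ?st E")
      case True then show ?thesis using m[OF st] by simp
    next
      case False
      then have "{Q. subgroup Q G \<and> L \<subseteq> Q \<and> Q \<subseteq> ?st E} = {}" by blast
      moreover have "?st E \<noteq> L" using False by blast
      ultimately show ?thesis by (simp only: sum.empty of_bool_eq)
    qed
    finally show "(\<Sum>Q\<in>?Q. m Q * of_bool (Q \<subseteq> ?st E)) = of_bool (?st E = L)" .
  qed
  also have "\<dots> = int (card (orbit_points L J))"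
    using finL by (simp add: orbit_points_def Int_def)
  finally show ?thesis .
qed

lemma span_induct [consumes 1, case_names basis add smult zero]:
  assumes "x \<in> carrier \<mu>" "\<And>y. y \<in> basis_set \<Longrightarrow> P y"
    "\<And>y z. \<lbrakk>y \<in> carrier \<mu>; z \<in> carrier \<mu>; P y; P z\<rbrakk> \<Longrightarrow> P (y \<oplus>\<^bsub>\<mu>\<^esub> z)"
    "\<And>a y. \<lbrakk>y \<in> carrier \<mu>; P y\<rbrakk> \<Longrightarrow> P (a \<odot>\<^bsub>\<mu>\<^esub> y)" "P \<zero>\<^bsub>\<mu>\<^esub>"
  shows "P x"
proof -
  obtain c where x: "x = (\<Oplus>\<^bsub>\<mu>\<^esub>b\<in>basis_set. c b \<odot>\<^bsub>\<mu>\<^esub> b)"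
    using subsetD[OF basis_set_spans assms(1)] by (auto simp: \<mu>.int_span_def)
  have "P (\<Oplus>\<^bsub>\<mu>\<^esub>b\<in>B. c b \<odot>\<^bsub>\<mu>\<^esub> b)" if "finite B" "B \<subseteq> basis_set" for B
    using that
  proof (induction B rule: finite_induct)
    case (insert b B)
    have closed: "b \<in> carrier \<mu>" "B \<subseteq> carrier \<mu>"
      using insert.prems basis_set_closed by auto
    then have "(\<Oplus>\<^bsub>\<mu>\<^esub>b\<in>insert b B. c b \<odot>\<^bsub>\<mu>\<^esub> b) = c b \<odot>\<^bsub>\<mu>\<^esub> b \<oplus>\<^bsub>\<mu>\<^esub> (\<Oplus>\<^bsub>\<mu>\<^esub>b\<in>B. c b \<odot>\<^bsub>\<mu>\<^esub> b)"
      using insert closed by (intro P.A.finsum_insert) auto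
    moreover have "(\<Oplus>\<^bsub>\<mu>\<^esub>b\<in>B. c b \<odot>\<^bsub>\<mu>\<^esub> b) \<in> carrier \<mu>"
      using closed(2) by (rule \<mu>.finsum_smult_closed)
    ultimately show ?case
      using insert closed(1) assms(2)[of b] assms(4)[OF closed(1), of "c b"]
        assms(3)[of "c b \<odot>\<^bsub>\<mu>\<^esub> b" "\<Oplus>\<^bsub>\<mu>\<^esub>b\<in>B. c b \<odot>\<^bsub>\<mu>\<^esub> b"] by simp
  qed (use assms(5) in simp)
  from this[OF finite_basis_set order_refl] show ?thesis by (simp add: x)
qed

text \<open>Moebius inversion of the traces yields a form \<open>S\<close> counting points with
  stabilizer \<open>L\<close>. It is \<open>s\<close> times the desired form, where \<open>s\<close>
  is the index of \<open>L\<close> in its normalizer. Divisibility by \<open>s\<close> passes from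
  the spanning set to the whole algebra, so the division is exact and preserves linearity.\<close>

lemma exists_coefficient_form:
  assumes L: "subgroup L G"
  shows "\<exists>\<psi>. central_form \<psi> \<and> (\<forall>H K g J. admissible H K g J \<longrightarrow>
    \<psi> (bas H K g J) = of_bool (H = K \<and> g \<in> H \<and> (\<exists>a\<in>carrier G. conjugate G a J = L)))"
proof -
  let ?Q = "{Q. subgroup Q G \<and> L \<subseteq> Q}"
  obtain m :: "'a set \<Rightarrow> int" where m: "\<And>R. \<lbrakk>subgroup R G; L \<subseteq> R\<rbrakk> \<Longrightarrow>
      (\<Sum>Q\<in>{Q. subgroup Q G \<and> L \<subseteq> Q \<and> Q \<subseteq> R}. m Q) = of_bool (R = L)"
    using exists_moebius[OF L] by blast
  have "\<forall>Q\<in>?Q. \<exists>\<phi>. central_form \<phi> \<and> (\<forall>w\<in>lists (mackey_gens G). \<phi> (P.wd w) = path_trace G Q w)"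
    using exists_trace_form subgroup.subset by blast
  from bchoice[OF this] obtain \<phi> where
    *: "\<forall>Q\<in>?Q. central_form (\<phi> Q) \<and> (\<forall>w\<in>lists (mackey_gens G). \<phi> Q (P.wd w) = path_trace G Q w)"
    by (rule exE)
  have \<phi>: "central_form (\<phi> Q)" if "Q \<in> ?Q" for Q using * that by blast
  have \<phi>_wd: "\<phi> Q (P.wd w) = path_trace G Q w" if "Q \<in> ?Q" "w \<in> lists (mackey_gens G)" for Q w
    using * that by blast
  define S where "S x = (\<Sum>Q\<in>?Q. m Q * \<phi> Q x)" for x
  have S_add: "S (x \<oplus>\<^bsub>\<mu>\<^esub> y) = S x + S y" if "x \<in> carrier \<mu>" "y \<in> carrier \<mu>" for x y
    unfolding S_def sum.distrib[symmetric]
    by (rule sum.cong) (use \<phi> that in \<open>auto simp: central_form_def distrib_left\<close>)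
  have S_smult: "S (a \<odot>\<^bsub>\<mu>\<^esub> x) = a * S x" if "x \<in> carrier \<mu>" for a x
    unfolding S_def sum_distrib_left
    by (rule sum.cong) (use \<phi> that in \<open>auto simp: central_form_def\<close>)
  have S_comm: "S (x \<otimes>\<^bsub>\<mu>\<^esub> y) = S (y \<otimes>\<^bsub>\<mu>\<^esub> x)" if "x \<in> carrier \<mu>" "y \<in> carrier \<mu>" for x y
    unfolding S_def by (rule sum.cong) (use \<phi> that in \<open>auto simp: central_form_def\<close>)
  define s where "s = int (card (orbit_points L L))"
  have "L \<in> orbit_points L L"
    using coset_stabilizer[OF L one_closed] lcos_mult_one[OF subgroup.subset[OF L]]
      conjugate_one[OF subgroup.subset[OF L]] lcosetsI[OF one_closed, of L] by (simp add: orbit_points_def)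
  moreover have "finite (orbit_points L L)" using finite_lcosets[OF L] by (simp add: orbit_points_def)
  ultimately have s: "s > 0" unfolding s_def by (auto simp: card_gt_0_iff)
  have S_bas: "S (bas H K g J) = s * of_bool (H = K \<and> g \<in> H \<and> (\<exists>a\<in>carrier G. conjugate G a J = L))"
    if adm: "admissible H K g J" for H K g J
  proof -
    have sub: "subgroup H G" "subgroup K G" "subgroup J G" "g \<in> carrier G" "J \<subseteq> K" "conjugate G g J \<subseteq> H"
      using adm by (auto simp: admissible_def)
    have "S (bas H K g J) = (\<Sum>Q\<in>?Q. of_bool (H = K \<and> g \<in> H) *
        (m Q * int (card {E \<in> lcosets (conjugate G g J). \<forall>q\<in>Q. q <# E = E})))"
      unfolding S_def
    proof (rule sum.cong[OF refl])
      fix Q assume Q: "Q \<in> ?Q"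
      have "\<phi> Q (bas H K g J) = path_trace G Q (basis_word H K g J)"
        unfolding bas_def by (rule \<phi>_wd[OF Q basis_word_in_lists[OF adm]])
      also have "\<dots> = of_bool (H = K \<and> g \<in> H) * int (card {E \<in> lcosets (conjugate G g J). \<forall>q\<in>Q. q <# E = E})"
        unfolding basis_word_def
        by (rule path_trace_basis_word[OF _ sub]) (use Q subgroup.subset in auto)
      finally show "m Q * \<phi> Q (bas H K g J) = of_bool (H = K \<and> g \<in> H) *
        (m Q * int (card {E \<in> lcosets (conjugate G g J). \<forall>q\<in>Q. q <# E = E}))" by simp
    qed
    also have "\<dots> = of_bool (H = K \<and> g \<in> H) * int (card (orbit_points L (conjugate G g J)))"
      unfolding sum_distrib_left[symmetric]
      using moebius_fixed_points[OF L conjugate_subgroup[OF sub(3,4)] m] by simp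
    also have "int (card (orbit_points L (conjugate G g J))) = s * of_bool (\<exists>a\<in>carrier G. conjugate G a J = L)"
    proof (cases "\<exists>a\<in>carrier G. conjugate G a J = L")
      case True
      then obtain a where a: "a \<in> carrier G" "conjugate G a J = L" by blast
      then show ?thesis
        using card_orbit_points_conjugate[OF sub(3,4), of L] card_orbit_points_conjugate[OF sub(3) a(1), of L]
        by (auto simp: s_def)
    next
      case False
      then have "orbit_points L J = {}" using orbit_points_empty[OF sub(3)] by blast
      then show ?thesis using card_orbit_points_conjugate[OF sub(3,4), of L] False by simp
    qed
    finally show ?thesis by (cases "H = K \<and> g \<in> H") auto
  qed
  have dvd: "s dvd S x" if "x \<in> carrier \<mu>" for x
    using that
  proof (induction x rule: span_induct)
    case (basis y)
    then show ?case using S_bas by (auto simp: basis_set_def)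
  next
    case zero
    then show ?case using S_smult[of "\<zero>\<^bsub>\<mu>\<^esub>" 0] by simp
  qed (auto simp: S_add S_smult)
  show ?thesis
  proof (intro exI conjI allI impI)
    show "central_form (\<lambda>x. S x div s)"
      unfolding central_form_def
      using S_add S_smult S_comm dvd by (auto simp: div_mult_swap div_plus_div_distrib_dvd_left)
    show "S (bas H K g J) div s = of_bool (H = K \<and> g \<in> H \<and> (\<exists>a\<in>carrier G. conjugate G a J = L))"
      if "admissible H K g J" for H K g J
      using S_bas[OF that] s by simp
  qed
qed

section \<open>The symmetrizing form of a squarefree group\<close>

text \<open>The largest subgroup \<open>L\<close> with \<open>admissible H K x L\<close>. Its
  subgroups, up to conjugacy in it, parametrize the spanning elements that belong to the double
  coset of \<open>x\<close>.\<close>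

definition inter_stab :: "'a set \<Rightarrow> 'a set \<Rightarrow> 'a \<Rightarrow> 'a set" where
  "inter_stab H K x = conjugate_right G H x \<inter> K"

lemma inter_stab_subgroup:
  "\<lbrakk>subgroup H G; subgroup K G; x \<in> carrier G\<rbrakk> \<Longrightarrow> subgroup (inter_stab H K x) G"
  unfolding inter_stab_def by (rule conjugate_right_Int_subgroup)

lemma subset_inter_stab_iff:
  assumes "subgroup H G" "x \<in> carrier G" "L \<subseteq> carrier G"
  shows "L \<subseteq> inter_stab H K x \<longleftrightarrow> L \<subseteq> K \<and> conjugate G x L \<subseteq> H"
  using conjugate_subset_iff[OF assms(3) subgroup.subset[OF assms(1)] assms(2)] assms(2)
  by (auto simp: inter_stab_def conjugate_right_eq)

lemma admissible_iff:
  "admissible H K x L \<longleftrightarrow> subgroup H G \<and> subgroup K G \<and> subgroup L G \<and> x \<in> carrier G \<and>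
    L \<subseteq> inter_stab H K x"
  using subset_inter_stab_iff[of H x L K] subgroup.subset[of L G] unfolding admissible_def by auto

lemma mem_inter_stab_iff:
  assumes "subgroup H G" "x \<in> carrier G" "m \<in> carrier G"
  shows "m \<in> inter_stab H K x \<longleftrightarrow> m \<in> K \<and> x \<otimes> m \<otimes> inv x \<in> H"
  using mem_conjugate[OF subgroup.subset[OF assms(1)], of "inv x" m] assms
  by (auto simp: inter_stab_def conjugate_right_eq)

lemma conjugate_inter_stab:
  assumes "subgroup H G" "subgroup K G" "x \<in> carrier G"
  shows "conjugate G x (inter_stab H K x) = inter_stab K H (inv x)"
  using conjugate_conjugate_right_Int[OF assms(2,1,3)] assms(3)
  by (auto simp: inter_stab_def conjugate_right_eq)

text \<open>The element \<open>x \<otimes> m\<close> is also an element of \<open>H\<close> times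
  \<open>x\<close>, so \<open>m\<close> can be absorbed on either side; comparing the two results
  gives the equation.\<close>

lemma bas_conjugate_inter_stab:
  assumes "admissible H K x L" "m \<in> inter_stab H K x"
  shows "bas H K x (conjugate G m L) = bas H K x L"
proof -
  have sub: "subgroup H G" "subgroup K G" "subgroup L G" "x \<in> carrier G"
    using assms(1) by (auto simp: admissible_def)
  have mG: "m \<in> carrier G" using subgroup.mem_carrier[OF inter_stab_subgroup[OF sub(1,2,4)] assms(2)] .
  then have m: "m \<in> K" "x \<otimes> m \<otimes> inv x \<in> H" using mem_inter_stab_iff[OF sub(1,4) mG] assms(2) by auto
  have eq: "(x \<otimes> m \<otimes> inv x) \<otimes> x = x \<otimes> m" using sub mG by (simp add: m_assoc)
  note l = bas_left[OF assms(1) m(2), unfolded eq]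
  show ?thesis using bas_right(1)[OF l(2) sub(4) m(1)] l(1) by simp
qed

lemma bas_representative:
  assumes adm: "admissible H K g L" and x: "x \<in> carrier G" and hk: "h \<in> H" "k \<in> K" "g = h \<otimes> x \<otimes> k"
  shows "\<exists>L'. admissible H K x L' \<and> card L' = card L \<and> bas H K g L = bas H K x L'"
proof -
  have sub: "subgroup H G" "subgroup K G" "subgroup L G" using adm by (auto simp: admissible_def)
  have G: "h \<in> carrier G" "k \<in> carrier G"
    using hk subgroup.mem_carrier[OF sub(1)] subgroup.mem_carrier[OF sub(2)] by auto
  have eq: "inv h \<otimes> g = x \<otimes> k" using G x hk(3) by (simp add: m_assoc inv_mult_cancel_left)
  note l = bas_left[OF adm subgroup.m_inv_closed[OF sub(1) hk(1)], unfolded eq]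
  note r = bas_right[OF l(2) x hk(2)]
  show ?thesis
    using r l card_conjugate[OF subgroup.subset[OF sub(3)] G(2)] by auto
qed

end

locale squarefree_group = finite_group +
  assumes squarefree: "\<forall>p::nat. Factorial_Ring.prime p \<longrightarrow> \<not> p\<^sup>2 dvd order G"
begin

lemma squarefree_subgroup:
  "subgroup M G \<Longrightarrow> \<forall>p::nat. Factorial_Ring.prime p \<longrightarrow> \<not> p\<^sup>2 dvd card M"
  using squarefree subgroup_card_dvd_order[OF fin] dvd_trans by blast

definition hall :: "'a set \<Rightarrow> nat \<Rightarrow> 'a set" where
  "hall M d = (SOME L. subgroup L G \<and> L \<subseteq> M \<and> card L = d)"

lemma hall:
  assumes "subgroup M G" "d dvd card M"
  shows "subgroup (hall M d) G" "hall M d \<subseteq> M" "card (hall M d) = d"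
proof -
  have "\<exists>L. subgroup L G \<and> L \<subseteq> M \<and> card L = d"
    using squarefree_hall[OF fin assms(1) squarefree_subgroup[OF assms(1)] assms(2)] by blast
  then have "subgroup (hall M d) G \<and> hall M d \<subseteq> M \<and> card (hall M d) = d"
    unfolding hall_def by (rule someI_ex)
  then show "subgroup (hall M d) G" "hall M d \<subseteq> M" "card (hall M d) = d" by auto
qed

text \<open>By the conjugacy part of Hall's theorem the order of a subgroup of
  \<open>inter_stab H K x\<close> determines its class there. This reduces the last parameter of a
  spanning element to a divisor \<open>d\<close>.\<close>

lemma bas_eq_card:
  assumes "admissible H K x L" "admissible H K x L'" "card L = card L'"
  shows "bas H K x L = bas H K x L'"
proof -
  have sub: "subgroup H G" "subgroup K G" "x \<in> carrier G" "subgroup L G" "subgroup L' G"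
    "L \<subseteq> inter_stab H K x" "L' \<subseteq> inter_stab H K x"
    using assms(1,2) by (auto simp: admissible_iff)
  let ?M = "inter_stab H K x"
  have M: "subgroup ?M G" by (rule inter_stab_subgroup[OF sub(1-3)])
  have "card L dvd card ?M" by (rule subgroup_card_dvd[OF fin sub(4) M sub(6)])
  then obtain m where "m \<in> ?M" "conjugate G m L = L'"
    using squarefree_hall[OF fin M squarefree_subgroup[OF M], of "card L"] sub assms(3)[symmetric]
    by blast
  then show ?thesis using bas_conjugate_inter_stab[OF assms(1), of m] by simp
qed

definition reps :: "'a set \<Rightarrow> 'a set \<Rightarrow> 'a set" where
  "reps H K = (SOME D. double_coset_reps G H (carrier G) K D)"

lemma reps:
  assumes "subgroup H G" "subgroup K G"
  shows "double_coset_reps G H (carrier G) K (reps H K)"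
  unfolding reps_def
  by (rule someI_ex, rule exists_double_coset_reps[OF subgroup_self assms(2,1)])
    (use assms subgroup.subset in auto)

lemma reps_carrier: "\<lbrakk>subgroup H G; subgroup K G\<rbrakk> \<Longrightarrow> reps H K \<subseteq> carrier G"
  using reps by (auto simp: double_coset_reps_def)

lemma reps_exists:
  assumes "subgroup H G" "subgroup K G" "g \<in> carrier G"
  shows "\<exists>x\<in>reps H K. \<exists>h\<in>H. \<exists>k\<in>K. g = h \<otimes> x \<otimes> k"
proof -
  interpret H: subgroup H G by fact
  interpret K: subgroup K G by fact
  obtain x where x: "x \<in> reps H K" "x \<in> (H #> g) <#> K"
    using reps[OF assms(1,2)] assms(3) by (auto simp: double_coset_reps_def)
  then obtain h k where hk: "h \<in> H" "k \<in> K" "x = h \<otimes> g \<otimes> k"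
    using mem_double_coset[OF assms] by auto
  then have "g = inv h \<otimes> x \<otimes> inv k" using assms(3) by (simp add: m_assoc inv_mult_cancel_left)
  then show ?thesis using x(1) hk by blast
qed

lemma reps_unique:
  assumes "subgroup H G" "subgroup K G" "x \<in> reps H K" "y \<in> reps H K" "h \<in> H" "k \<in> K" "y = h \<otimes> x \<otimes> k"
  shows "x = y"
proof -
  interpret H: subgroup H G by fact
  interpret K: subgroup K G by fact
  have xG: "x \<in> carrier G" using reps_carrier[OF assms(1,2)] assms(3) by blast
  have "\<exists>!d. d \<in> reps H K \<and> d \<in> (H #> x) <#> K"
    using reps[OF assms(1,2)] xG unfolding double_coset_reps_def by blast
  moreover have "x = \<one> \<otimes> x \<otimes> \<one>" using xG by simp
  then have "x \<in> (H #> x) <#> K"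
    unfolding mem_double_coset[OF assms(1,2) xG] using H.one_closed K.one_closed by blast
  moreover have "y \<in> (H #> x) <#> K" unfolding mem_double_coset[OF assms(1,2) xG] using assms(5-7) by blast
  ultimately show ?thesis using assms(3,4) by blast
qed

definition index :: "('a set \<times> 'a set \<times> 'a \<times> nat) set" where
  "index = {(H, K, x, d). subgroup H G \<and> subgroup K G \<and> x \<in> reps H K \<and> d dvd card (inter_stab H K x)}"

fun basis :: "'a set \<times> 'a set \<times> 'a \<times> nat \<Rightarrow> ('a mackey_gen list \<Rightarrow> int) set" where
  "basis (H, K, x, d) = bas H K x (hall (inter_stab H K x) d)"

text \<open>The reversed span with the complementary order: the two orders multiply to that of
  \<open>inter_stab H K x\<close>. Conjugation by \<open>x\<close> carries the chosen subgroup into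
  \<open>inter_stab K H (inv x)\<close>, as the reversed direction requires.\<close>

fun dual :: "'a set \<times> 'a set \<times> 'a \<times> nat \<Rightarrow> ('a mackey_gen list \<Rightarrow> int) set" where
  "dual (H, K, x, d) =
    bas K H (inv x) (conjugate G x (hall (inter_stab H K x) (card (inter_stab H K x) div d)))"

lemma basis_admissible:
  assumes "(H, K, x, d) \<in> index"
  shows "admissible H K x (hall (inter_stab H K x) d)"
proof -
  have *: "subgroup H G" "subgroup K G" "x \<in> carrier G" "d dvd card (inter_stab H K x)"
    using assms reps_carrier by (auto simp: index_def)
  from hall[OF inter_stab_subgroup[OF *(1-3)] *(4)] * show ?thesis by (simp add: admissible_iff)
qed

lemma dual_admissible:
  assumes "(H, K, x, d) \<in> index"
  shows "admissible K H (inv x) (conjugate G x (hall (inter_stab H K x) (card (inter_stab H K x) div d)))"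
    "card (conjugate G x (hall (inter_stab H K x) (card (inter_stab H K x) div d))) = card (inter_stab H K x) div d"
proof -
  let ?M = "inter_stab H K x" let ?L = "hall ?M (card ?M div d)"
  have *: "subgroup H G" "subgroup K G" "x \<in> carrier G" "d dvd card ?M"
    using assms reps_carrier by (auto simp: index_def)
  have M: "subgroup ?M G" by (rule inter_stab_subgroup[OF *(1-3)])
  have "card ?M div d dvd card ?M" using *(4) by (metis dvd_div_mult_self dvd_triv_left)
  note L = hall[OF M this]
  have "conjugate G x ?L \<subseteq> inter_stab K H (inv x)"
    unfolding conjugate_inter_stab[OF *(1-3), symmetric] by (rule conjugate_mono[OF L(2)])
  then show "admissible K H (inv x) (conjugate G x ?L)"
    using * conjugate_subgroup[OF L(1) *(3)] by (simp add: admissible_iff)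
  show "card (conjugate G x ?L) = card ?M div d"
    using card_conjugate[OF subgroup.subset[OF L(1)] *(3)] L(3) by simp
qed

lemma card_dvd_inter_stab:
  "admissible H K x L \<Longrightarrow> card L dvd card (inter_stab H K x)"
  unfolding admissible_iff using subgroup_card_dvd[OF fin] inter_stab_subgroup by blast

lemma basis_set_eq_basis: "basis_set = basis ` index"
proof (intro equalityI subsetI)
  fix y assume "y \<in> basis_set"
  then obtain H K g L where adm: "admissible H K g L" and y: "y = bas H K g L" by (auto simp: basis_set_def)
  have sub: "subgroup H G" "subgroup K G" "g \<in> carrier G" using adm by (auto simp: admissible_def)
  obtain x h k where x: "x \<in> reps H K" "h \<in> H" "k \<in> K" "g = h \<otimes> x \<otimes> k" using reps_exists[OF sub] by blast
  have xG: "x \<in> carrier G" using reps_carrier[OF sub(1,2)] x(1) by blast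
  obtain L' where L': "admissible H K x L'" "y = bas H K x L'"
    using bas_representative[OF adm xG x(2-4)] y by auto
  have i: "(H, K, x, card L') \<in> index" using sub x(1) card_dvd_inter_stab[OF L'(1)] by (simp add: index_def)
  have "basis (H, K, x, card L') = y"
    unfolding L'(2) basis.simps
    by (rule bas_eq_card[OF basis_admissible[OF i] L'(1)])
      (rule hall(3)[OF inter_stab_subgroup[OF sub(1,2) xG] card_dvd_inter_stab[OF L'(1)]])
  then show "y \<in> basis ` index" using i by force
next
  fix y assume "y \<in> basis ` index"
  then obtain H K x d where "(H, K, x, d) \<in> index" "y = basis (H, K, x, d)" by auto
  then show "y \<in> basis_set" using basis_setI[OF basis_admissible] by simp
qed

lemma basis_set_eq_dual: "basis_set = dual ` index"
proof (intro equalityI subsetI)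
  fix y assume "y \<in> basis_set"
  then obtain K H g L where adm: "admissible K H g L" and y: "y = bas K H g L" by (auto simp: basis_set_def)
  have sub: "subgroup H G" "subgroup K G" "g \<in> carrier G" using adm by (auto simp: admissible_def)
  interpret H: subgroup H G by (rule sub(1))
  interpret K: subgroup K G by (rule sub(2))
  \<comment> \<open>Inverses of representatives for \<open>H\<close> and \<open>K\<close> represent
    the double cosets for \<open>K\<close> and \<open>H\<close>, so the representative is looked up
    for \<open>inv g\<close>.\<close>
  obtain x h k where x: "x \<in> reps H K" "h \<in> H" "k \<in> K" "inv g = h \<otimes> x \<otimes> k"
    using reps_exists[OF sub(1,2)] sub(3) by (meson inv_closed)
  have xG: "x \<in> carrier G" using reps_carrier[OF sub(1,2)] x(1) by blast
  have "g = inv (h \<otimes> x \<otimes> k)" using x(4) sub(3) by (metis inv_inv)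
  also have "\<dots> = inv k \<otimes> inv x \<otimes> inv h" using x xG by (simp add: inv_mult_group m_assoc)
  finally have g: "g = inv k \<otimes> inv x \<otimes> inv h" .
  obtain L' where L': "admissible K H (inv x) L'" "y = bas K H (inv x) L'"
    using bas_representative[OF adm inv_closed[OF xG] _ _ g] x y by auto
  let ?M = "inter_stab H K x"
  have M: "subgroup ?M G" by (rule inter_stab_subgroup[OF sub(1,2) xG])
  have posM: "card ?M > 0" using subgroup.finite_imp_card_positive[OF M fin] .
  have dvd: "card L' dvd card ?M"
    using card_dvd_inter_stab[OF L'(1)] conjugate_inter_stab[OF sub(1,2) xG]
      card_conjugate[OF subgroup.subset[OF M] xG] by simp
  \<comment> \<open>Passing to the complementary divisor is an involution, so the order of
    \<open>L'\<close> arises from this divisor.\<close>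
  let ?d = "card ?M div card L'"
  have d: "?d dvd card ?M" "card ?M div ?d = card L'"
    using dvd posM by (metis dvd_div_mult_self dvd_triv_left,
      metis dvd_div_eq_mult div_div_eq_right div_self dvd_refl less_numeral_extra(3) mult_1 nat_neq_iff)
  have i: "(H, K, x, ?d) \<in> index" using sub x(1) d(1) by (simp add: index_def)
  have "dual (H, K, x, ?d) = y"
    unfolding L'(2) dual.simps
    by (rule bas_eq_card[OF dual_admissible(1)[OF i] L'(1)]) (rule trans[OF dual_admissible(2)[OF i] d(2)])
  then show "y \<in> dual ` index" using i by force
next
  fix y assume "y \<in> dual ` index"
  then obtain H K x d where "(H, K, x, d) \<in> index" "y = dual (H, K, x, d)" by auto
  then show "y \<in> basis_set" using basis_setI[OF dual_admissible(1)] by simp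
qed

text \<open>
  The value at the regular orbit counts the double cosets of two subgroups of \<open>M\<close> that intersect
  trivially up to conjugacy: there are none if the product of the orders exceeds that of \<open>M\<close>,
  and exactly one if it equals the order of \<open>M\<close>, which is squarefree.
\<close>

lemma pairing:
  assumes \<psi>: "central_form \<psi>"
    and \<psi>_bas: "\<And>H K g J. admissible H K g J \<Longrightarrow>
      \<psi> (bas H K g J) = of_bool (H = K \<and> g \<in> H \<and> (\<exists>a\<in>carrier G. conjugate G a J = {\<one>}))"
    and i: "(H, K, x, d) \<in> index" and j: "(H', K', y, e) \<in> index"
  shows "(H, K, x, d) = (H', K', y, e) \<Longrightarrow> \<psi> (basis (H, K, x, d) \<otimes>\<^bsub>\<mu>\<^esub> dual (H', K', y, e)) = 1"
    "\<psi> (basis (H, K, x, d) \<otimes>\<^bsub>\<mu>\<^esub> dual (H', K', y, e)) \<noteq> 0 \<Longrightarrow>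
      (H, K, x, d) = (H', K', y, e) \<or> d < e"
proof -
  let ?M = "inter_stab H K x" and ?M' = "inter_stab H' K' y"
  let ?L = "hall ?M d" and ?L' = "hall ?M' (card ?M' div e)"
  have sub: "subgroup H G" "subgroup K G" "x \<in> carrier G" "d dvd card ?M"
    "subgroup H' G" "subgroup K' G" "y \<in> carrier G" "e dvd card ?M'" "x \<in> reps H K" "y \<in> reps H' K'"
    using i j reps_carrier by (auto simp: index_def)
  have M: "subgroup ?M G" "subgroup ?M' G" using inter_stab_subgroup sub by auto
  have e': "card ?M' div e dvd card ?M'" using sub(8) by (metis dvd_div_mult_self dvd_triv_left)
  note L = hall[OF M(1) sub(4)] and L' = hall[OF M(2) e']
  interpret L: subgroup ?L G by (rule L(1))
  interpret L': subgroup ?L' G by (rule L'(1))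
  note a = basis_admissible[OF i] and b = dual_admissible(1)[OF j]
  have zero: "\<psi> \<zero>\<^bsub>\<mu>\<^esub> = 0"
  proof -
    have "\<psi> (0 \<odot>\<^bsub>\<mu>\<^esub> \<zero>\<^bsub>\<mu>\<^esub>) = 0 * \<psi> \<zero>\<^bsub>\<mu>\<^esub>" using \<psi> unfolding central_form_def by blast
    then show ?thesis by (simp add: \<mu>.int_smult_distr)
  qed
  have non_composable: "\<psi> (basis (H, K, x, d) \<otimes>\<^bsub>\<mu>\<^esub> dual (H', K', y, e)) = 0" if "K \<noteq> K'"
    using bas_mult_non_composable[OF a b that] zero by simp
  have LK: "?L' \<subseteq> K'" using L'(2) by (auto simp: inter_stab_def)
  have gJ: "conjugate G (inv y) (conjugate G y ?L') = ?L'"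
    by (rule conjugate_inv_cancel(1)[OF L'.subset sub(7)])
  have prod: "\<psi> (basis (H, K, x, d) \<otimes>\<^bsub>\<mu>\<^esub> dual (H', K', y, e)) =
      (\<Sum>h\<in>D. of_bool (H = H' \<and> x \<otimes> (h \<otimes> inv y) \<in> H \<and> conjugate_right G ?L h \<inter> ?L' = {\<one>}))"
    if KK: "K = K'" and D: "double_coset_reps G ?L K ?L' D" for D
  proof -
    let ?E = "\<lambda>h. conjugate G (inv (inv y)) (conjugate_right G ?L h \<inter> conjugate G (inv y) (conjugate G y ?L'))"
    have D': "double_coset_reps G ?L K (conjugate G (inv y) (conjugate G y ?L')) D"
      unfolding gJ by (rule D)
    have b': "admissible K H' (inv y) (conjugate G y ?L')" using b by (simp only: KK)
    note bm = bas_mult[OF a b' D']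
    have finD: "finite D" by (rule double_coset_reps_finite[OF sub(2) D])
    have "\<psi> (basis (H, K, x, d) \<otimes>\<^bsub>\<mu>\<^esub> dual (H', K', y, e)) =
        \<psi> (\<Oplus>\<^bsub>\<mu>\<^esub>h\<in>D. bas H H' (x \<otimes> (h \<otimes> inv y)) (?E h))"
      using bm(1) by (simp only: basis.simps dual.simps KK)
    also have "\<dots> = (\<Sum>h\<in>D. \<psi> (bas H H' (x \<otimes> (h \<otimes> inv y)) (?E h)))"
      by (rule finsum_additive[OF P.A.abelian_group_axioms finD])
        (use \<psi> bm(2) bas_closed in \<open>auto simp: central_form_def\<close>)
    also have "\<dots> = (\<Sum>h\<in>D. of_bool (H = H' \<and> x \<otimes> (h \<otimes> inv y) \<in> H \<and> conjugate_right G ?L h \<inter> ?L' = {\<one>}))"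
    proof (rule sum.cong[OF refl])
      fix h assume h: "h \<in> D"
      let ?I = "conjugate_right G ?L h \<inter> ?L'"
      have hG: "h \<in> carrier G" using h D subgroup.subset[OF sub(2)] by (auto simp: double_coset_reps_def)
      have I: "subgroup ?I G" by (rule conjugate_right_Int_subgroup[OF L'(1) L(1) hG])
      have E: "?E h = conjugate G y ?I" unfolding gJ using sub(7) by simp
      have "(\<exists>a\<in>carrier G. conjugate G a (conjugate G y ?I) = {\<one>}) \<longleftrightarrow> ?I = {\<one>}"
      proof
        assume "\<exists>a\<in>carrier G. conjugate G a (conjugate G y ?I) = {\<one>}"
        then obtain a where a: "a \<in> carrier G" "conjugate G a (conjugate G y ?I) = {\<one>}" by blast
        have "card (conjugate G a (conjugate G y ?I)) = card ?I"
          using card_conjugate[OF subgroup.subset[OF I] sub(7)]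
            card_conjugate[OF conjugate_closed[OF subgroup.subset[OF I] sub(7)] a(1)] by simp
        then show "?I = {\<one>}" using trivial_card_subgroup[OF I] a(2) by simp
      next
        assume "?I = {\<one>}"
        then have "conjugate G (inv y) (conjugate G y ?I) = {\<one>}"
          using conjugate_inv_cancel(1)[OF subgroup.subset[OF I] sub(7)] by simp
        then show "\<exists>a\<in>carrier G. conjugate G a (conjugate G y ?I) = {\<one>}" using sub(7) by blast
      qed
      then show "\<psi> (bas H H' (x \<otimes> (h \<otimes> inv y)) (?E h)) =
          of_bool (H = H' \<and> x \<otimes> (h \<otimes> inv y) \<in> H \<and> ?I = {\<one>})"
        using \<psi>_bas[OF bm(2)[OF h]] unfolding E by simp
    qed
    finally show ?thesis .
  qed
  have exD: "\<exists>D. double_coset_reps G ?L K ?L' D" if "K = K'"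
    by (rule exists_double_coset_reps[OF sub(2) L'(1) L(1)])
      (use that LK L(2) in \<open>auto simp: inter_stab_def\<close>)
  have posM: "card ?M > 0" using subgroup.finite_imp_card_positive[OF M(1) fin] .
  show "\<psi> (basis (H, K, x, d) \<otimes>\<^bsub>\<mu>\<^esub> dual (H', K', y, e)) \<noteq> 0 \<Longrightarrow>
      (H, K, x, d) = (H', K', y, e) \<or> d < e"
  proof -
    assume nz: "\<psi> (basis (H, K, x, d) \<otimes>\<^bsub>\<mu>\<^esub> dual (H', K', y, e)) \<noteq> 0"
    then have KK: "K = K'" using non_composable by blast
    obtain D where D: "double_coset_reps G ?L K ?L' D" using exD[OF KK] by blast
    obtain h where h: "h \<in> D" "H = H'" "x \<otimes> (h \<otimes> inv y) \<in> H" "conjugate_right G ?L h \<inter> ?L' = {\<one>}"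
    proof -
      from nz obtain h where "h \<in> D"
        "of_bool (H = H' \<and> x \<otimes> (h \<otimes> inv y) \<in> H \<and> conjugate_right G ?L h \<inter> ?L' = {\<one>}) \<noteq> (0::int)"
        unfolding prod[OF KK D] by (rule sum.not_neutral_contains_not_neutral)
      note h = this
      have "H = H' \<and> x \<otimes> (h \<otimes> inv y) \<in> H \<and> conjugate_right G ?L h \<inter> ?L' = {\<one>}"
        using h(2) unfolding of_bool_eq_0_iff not_not .
      then show ?thesis using that[OF h(1)] by blast
    qed
    have hK: "h \<in> K" using h(1) D by (auto simp: double_coset_reps_def)
    have hG: "h \<in> carrier G" using hK subgroup.mem_carrier[OF sub(2)] by blast
    \<comment> \<open>The nonzero summand puts \<open>y\<close> into the double coset of
      \<open>x\<close>, so the two representatives agree.\<close>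
    have "y = inv (x \<otimes> (h \<otimes> inv y)) \<otimes> x \<otimes> h"
      using sub(3,7) hG by (simp add: m_assoc inv_mult_group inv_mult_cancel_left)
    then have xy: "x = y"
      using reps_unique[OF sub(1,2,9) sub(10)[folded KK h(2)] subgroup.m_inv_closed[OF sub(1) h(3)] hK] by blast
    have MM: "?M' = ?M" using KK h(2) xy by simp
    have hM: "h \<in> ?M" using mem_inter_stab_iff[OF sub(1,3) hG] hK h(3) xy sub(3) hG by (simp add: m_assoc)
    let ?C = "conjugate_right G ?L h"
    have C: "subgroup ?C G" "card ?C = d" "?C \<subseteq> ?M"
      using conjugate_subgroup[OF L(1), of "inv h"] card_conjugate[OF L.subset, of "inv h"] hG L(3)
        conjugate_subset_subgroup[OF M(1) L(2) subgroup.m_inv_closed[OF M(1) hM]]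
      by (simp_all add: conjugate_right_eq)
    \<comment> \<open>As the intersection is trivial, the product set has as many elements as the
      orders multiply to, and it lies in \<open>?M\<close>. This bounds \<open>d\<close> by
      \<open>e\<close>.\<close>
    have "card (?C <#> ?L') = d * (card ?M div e)"
      using card_set_mult_disjoint[OF C(1) L'(1) h(4)] C(2) L'(3) MM by simp
    moreover have "?C <#> ?L' \<subseteq> ?M"
      using mono_set_mult[OF C(3), of ?L' ?M G] L'(2) MM subgroup_mult_id[OF M(1)] by simp
    then have "card (?C <#> ?L') \<le> card ?M" using finite_subgroup[OF M(1)] by (rule card_mono[rotated])
    ultimately have le: "d * (card ?M div e) \<le> card ?M" by simp
    have ee: "card ?M div e * e = card ?M" using sub(8) MM by simp
    then have "d * (card ?M div e) \<le> e * (card ?M div e)" using le by (simp add: mult.commute)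
    moreover have "card ?M div e > 0" using ee posM by (metis mult_0 not_gr_zero)
    ultimately have "d \<le> e" by simp
    then show "(H, K, x, d) = (H', K', y, e) \<or> d < e" using KK h(2) xy by auto
  qed
  show "\<psi> (basis (H, K, x, d) \<otimes>\<^bsub>\<mu>\<^esub> dual (H', K', y, e)) = 1" if eq: "(H, K, x, d) = (H', K', y, e)"
  proof -
    from eq have eqs: "H' = H" "K' = K" "y = x" "e = d" by auto
    obtain D where D: "double_coset_reps G ?L K ?L' D" using exD eqs by blast
    have finD: "finite D" by (rule double_coset_reps_finite[OF sub(2) D])
    have DK: "D \<subseteq> K" using D by (simp add: double_coset_reps_def)
    have cards: "card ?L = d" "card ?L' = card ?M div d" "d * (card ?M div d) = card ?M"
      using L(3) L'(3) sub(4) eqs by simp_all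
    \<comment> \<open>A common prime factor of the two complementary orders would have its square
      dividing the order of \<open>?M\<close>.\<close>
    have cop: "coprime d (card ?M div d)"
    proof (rule ccontr)
      assume "\<not> coprime d (card ?M div d)"
      then have "gcd d (card ?M div d) \<noteq> 1" by (simp add: coprime_iff_gcd_eq_1)
      then obtain p where p: "Factorial_Ring.prime p" "p dvd gcd d (card ?M div d)"
        using prime_factor_nat by blast
      then have "p * p dvd d * (card ?M div d)" by (intro mult_dvd_mono) auto
      then show False
        using squarefree_subgroup[OF M(1)] p(1) cards(3) by (auto simp: power2_eq_square)
    qed
    have triv: "conjugate_right G ?L h \<inter> ?L' = {\<one>}" if "h \<in> carrier G" for h
    proof (rule coprime_subgroups_Int[OF fin _ L'(1)])
      show "subgroup (conjugate_right G ?L h) G"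
        using that conjugate_subgroup[OF L(1), of "inv h"] by (simp add: conjugate_right_eq)
      show "coprime (card (conjugate_right G ?L h)) (card ?L')"
        using that card_conjugate[OF L.subset, of "inv h"] cards cop by (simp add: conjugate_right_eq)
    qed
    have "?L \<inter> ?L' = {\<one>}" using coprime_subgroups_Int[OF fin L(1) L'(1)] cards cop by simp
    then have "card (?L <#> ?L') = card ?M" using card_set_mult_disjoint[OF L(1) L'(1)] cards by simp
    moreover have "?L <#> ?L' \<subseteq> ?M"
      using mono_set_mult[OF L(2), of ?L' ?M G] L'(2) eqs subgroup_mult_id[OF M(1)] by simp
    ultimately have LL: "?L <#> ?L' = ?M" using finite_subgroup[OF M(1)] by (intro card_subset_eq)
    \<comment> \<open>\<open>?M\<close> is a single double coset of \<open>?L\<close> and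
      \<open>?L'\<close>, so exactly one representative \<open>h0\<close> lies in it, and only this
      one contributes.\<close>
    have "\<exists>!h. h \<in> D \<and> h \<in> (?L #> \<one>) <#> ?L'"
      using D subgroup.one_closed[OF sub(2)] by (simp add: double_coset_reps_def)
    then have "\<exists>!h. h \<in> D \<and> h \<in> ?M" using LL coset_mult_one[OF L.subset] by simp
    then obtain h0 where h0: "\<And>h. h \<in> D \<Longrightarrow> h \<in> ?M \<longleftrightarrow> h = h0" "h0 \<in> D" by blast
    have "\<psi> (basis (H, K, x, d) \<otimes>\<^bsub>\<mu>\<^esub> dual (H', K', y, e)) = (\<Sum>h\<in>D. if h = h0 then 1 else 0)"
      unfolding prod[OF eqs(2)[symmetric] D]
    proof (rule sum.cong[OF refl])
      fix h assume h: "h \<in> D"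
      then have hG: "h \<in> carrier G" "h \<in> K" using DK subgroup.mem_carrier[OF sub(2)] by auto
      have "x \<otimes> (h \<otimes> inv y) \<in> H \<longleftrightarrow> h \<in> ?M"
        using mem_inter_stab_iff[OF sub(1,3) hG(1), of K] hG eqs sub(3) by (simp add: m_assoc)
      then show "of_bool (H = H' \<and> x \<otimes> (h \<otimes> inv y) \<in> H \<and> conjugate_right G ?L h \<inter> ?L' = {\<one>}) =
          (if h = h0 then 1 else 0 :: int)"
        using triv[OF hG(1)] h0(1)[OF h] eqs(1) by simp
    qed
    also have "\<dots> = 1" using finD h0(2) by (simp add: sum.delta)
    finally show ?thesis .
  qed
qed

lemma mackey_symmetric: "symmetric_algebra \<Z> \<mu>"
proof -
  obtain \<psi> where \<psi>: "central_form \<psi>"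
    and \<psi>_bas: "\<And>H K g J. admissible H K g J \<Longrightarrow>
      \<psi> (bas H K g J) = of_bool (H = K \<and> g \<in> H \<and> (\<exists>a\<in>carrier G. conjugate G a J = {\<one>}))"
    using exists_coefficient_form[OF triv_subgroup] by blast
  define \<beta> where "\<beta> x y = \<psi> (x \<otimes>\<^bsub>\<mu>\<^esub> y)" for x y
  have diag: "\<beta> (basis i) (dual i) = 1" if "i \<in> index" for i
  proof -
    obtain H K x d where "i = (H, K, x, d)" by (cases i)
    then show ?thesis
      unfolding \<beta>_def using pairing(1)[OF \<psi> \<psi>_bas, of H K x d H K x d] that by (simp del: basis.simps dual.simps)
  qed
  let ?rank = "\<lambda>(H, K, x, d). d"
  have tri: "i = j \<or> ?rank i < ?rank j" if "i \<in> index" "j \<in> index" "\<beta> (basis i) (dual j) \<noteq> 0" for i j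
  proof -
    obtain H K x d H' K' y e where "i = (H, K, x, d)" "j = (H', K', y, e)" by (cases i, cases j)
    then show ?thesis
      using pairing(2)[OF \<psi> \<psi>_bas, of H K x d H' K' y e] that unfolding \<beta>_def by (simp del: basis.simps dual.simps)
  qed
  \<comment> \<open>\<open>unitriangular_form\<close> speaks of elements, so \<open>dual\<close> and
    the divisor have to be transported along \<open>basis\<close>. Triangularity itself makes
    \<open>basis\<close> injective: two parameters of the same element would have divisors smaller
    than each other.\<close>
  have inj: "inj_on basis index"
  proof (rule inj_onI, rule ccontr)
    fix i j assume ij: "i \<in> index" "j \<in> index" "basis i = basis j" "i \<noteq> j"
    then have "\<beta> (basis i) (dual j) \<noteq> 0" "\<beta> (basis j) (dual i) \<noteq> 0"
      using diag[of i] diag[of j] by auto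
    then have "?rank i < ?rank j" "?rank j < ?rank i"
      using tri[of i j] tri[of j i] ij by blast+
    then show False by simp
  qed
  define d where "d b = dual (inv_into index basis b)" for b
  define rank where "rank b = ?rank (inv_into index basis b)" for b
  have inv_basis: "inv_into index basis (basis i) = i" if "i \<in> index" for i
    by (rule inv_into_f_f[OF inj that])
  have dB: "d ` basis_set = basis_set"
  proof -
    have "d ` basis_set = dual ` index"
      unfolding basis_set_eq_basis image_image d_def by (rule image_cong) (simp_all add: inv_basis)
    then show ?thesis using basis_set_eq_dual by simp
  qed
  have \<psi>': "\<And>x y. \<lbrakk>x \<in> carrier \<mu>; y \<in> carrier \<mu>\<rbrakk> \<Longrightarrow> \<psi> (x \<oplus>\<^bsub>\<mu>\<^esub> y) = \<psi> x + \<psi> y"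
    "\<And>a x. x \<in> carrier \<mu> \<Longrightarrow> \<psi> (a \<odot>\<^bsub>\<mu>\<^esub> x) = a * \<psi> x"
    "\<And>x y. \<lbrakk>x \<in> carrier \<mu>; y \<in> carrier \<mu>\<rbrakk> \<Longrightarrow> \<psi> (x \<otimes>\<^bsub>\<mu>\<^esub> y) = \<psi> (y \<otimes>\<^bsub>\<mu>\<^esub> x)"
    using \<psi> unfolding central_form_def by blast+
  have form: "bilinear_form \<Z> \<mu> \<beta>" "nondegenerate_form \<Z> \<mu> \<beta>"
    "finitely_generated_module \<Z> \<mu>" "projective_module \<Z> \<mu>"
  proof -
    have add: "\<beta> (x \<oplus>\<^bsub>\<mu>\<^esub> y) z = \<beta> x z + \<beta> y z" if "x \<in> carrier \<mu>" "y \<in> carrier \<mu>" "z \<in> carrier \<mu>" for x y z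
      using that \<psi>'(1) by (simp add: \<beta>_def P.A.l_distr)
    have smult: "\<beta> (a \<odot>\<^bsub>\<mu>\<^esub> x) z = a * \<beta> x z" if "x \<in> carrier \<mu>" "z \<in> carrier \<mu>" for a x z
      using that \<psi>'(2)[of "x \<otimes>\<^bsub>\<mu>\<^esub> z"] by (simp add: \<beta>_def P.A.smult_mult_left)
    have sym: "\<beta> x y = \<beta> y x" if "x \<in> carrier \<mu>" "y \<in> carrier \<mu>" for x y
      using \<psi>'(3)[OF that] by (simp add: \<beta>_def)
    have diag': "\<beta> b (d b) = 1" if "b \<in> basis_set" for b
      using that diag inv_basis by (auto simp: basis_set_eq_basis d_def)
    have tri': "\<beta> b (d c) = 0" if "b \<in> basis_set" "c \<in> basis_set" "b \<noteq> c" "rank b \<ge> rank c" for b c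
    proof (rule ccontr)
      note bc = that
      assume nz: "\<beta> b (d c) \<noteq> 0"
      obtain i j where ij: "i \<in> index" "j \<in> index" "b = basis i" "c = basis j"
        using bc(1,2) by (auto simp: basis_set_eq_basis)
      then have "i = j \<or> ?rank i < ?rank j" using tri[OF ij(1,2)] nz inv_basis by (simp add: d_def)
      then show False using that(3,4) ij inv_basis by (auto simp: rank_def)
    qed
    have dB': "d ` basis_set \<subseteq> carrier \<mu>" "carrier \<mu> \<subseteq> \<mu>.int_span (d ` basis_set)"
      unfolding dB by (rule basis_set_closed, rule basis_set_spans)
    note * = \<mu>.unitriangular_form[where rank = rank, OF finite_basis_set basis_set_closed dB'(1) basis_set_spans dB'(2)
      add smult sym diag' tri']
    show "bilinear_form \<Z> \<mu> \<beta>" "nondegenerate_form \<Z> \<mu> \<beta>"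
      "finitely_generated_module \<Z> \<mu>" "projective_module \<Z> \<mu>" using * by blast+
  qed
  have assoc: "\<beta> (x \<otimes>\<^bsub>\<mu>\<^esub> y) z = \<beta> x (y \<otimes>\<^bsub>\<mu>\<^esub> z)" if "x \<in> carrier \<mu>" "y \<in> carrier \<mu>" "z \<in> carrier \<mu>" for x y z
    using that by (simp add: \<beta>_def P.A.m_assoc)
  have sym: "\<beta> x y = \<beta> y x" if "x \<in> carrier \<mu>" "y \<in> carrier \<mu>" for x y
    using \<psi>'(3)[OF that] by (simp add: \<beta>_def)
  show ?thesis
    unfolding symmetric_algebra_def using P.A.assoc_algebra_axioms form assoc sym by blast
qed

end

section \<open>Groups whose order is not squarefree\<close>

context finite_group begin

text \<open>A cyclic group of order p^2 has one subgroup of order \<open>p\<close>. Otherwise all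
  p^2 - 1 nontrivial elements have order \<open>p\<close> and are partitioned into sets of size p -
  1, which makes p + 1 subgroups.\<close>

lemma card_prime_square_subgroups:
  assumes P: "subgroup P G" "card P = p\<^sup>2" and p: "Factorial_Ring.prime (p::nat)"
  shows "card {Q. subgroup Q G \<and> Q \<subseteq> P \<and> card Q = p} mod p = 1"
proof -
  let ?\<Q> = "{Q. subgroup Q G \<and> Q \<subseteq> P \<and> card Q = p}"
  interpret P: subgroup P G by fact
  have p1: "p > 1" using prime_gt_1_nat[OF p] .
  have finP: "finite P" using finite_subgroup[OF P(1)] .
  have finQ: "finite ?\<Q>" by (rule finite_subset[OF _ finite_subgroups]) auto
  have gen: "subgroup (generate G {x}) G" "generate G {x} \<subseteq> P" "card (generate G {x}) = ord x"
    "x \<in> generate G {x}"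
    if x: "x \<in> P" for x
  proof -
    have xG: "x \<in> carrier G" using x by simp
    show "subgroup (generate G {x}) G" by (rule generate_is_subgroup) (use xG in simp)
    show "generate G {x} \<subseteq> P" by (rule generate_subgroup_incl[OF _ P(1)]) (use x in simp)
    show "card (generate G {x}) = ord x" using generate_pow_card[OF xG] by simp
    show "x \<in> generate G {x}" by (rule generate.incl) simp
  qed
  have ord: "ord x = 1 \<or> ord x = p \<or> ord x = p\<^sup>2" if x: "x \<in> P" for x
  proof -
    have "ord x dvd p\<^sup>2" using subgroup_card_dvd[OF fin gen(1)[OF x] P(1) gen(2)[OF x]] gen(3)[OF x] P(2) by simp
    then obtain i where "i \<le> 2" "ord x = p ^ i" using divides_primepow_nat[OF p] by blast
    then show ?thesis by (cases i) (auto simp: le_Suc_eq power2_eq_square numeral_2_eq_2)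
  qed
  show ?thesis
  proof (cases "\<exists>x\<in>P. ord x = p\<^sup>2")
    case True
    then obtain x where x: "x \<in> P" "ord x = p\<^sup>2" by blast
    have xG: "x \<in> carrier G" using x(1) by simp
    have "generate G {x} = P" using gen[OF x(1)] x(2) P(2) finP by (intro card_subset_eq) auto
    then have P_pow: "\<exists>k::nat. y = x [^] k" if "y \<in> P" for y
      using that generate_pow_on_finite_carrier[OF fin xG] by auto
    \<comment> \<open>The powers of \<open>x\<close> with exponent divisible by \<open>p\<close>.
      Every subgroup of order \<open>p\<close> lies in this set of at most \<open>p\<close>
      elements, hence equals it.\<close>
    let ?R = "(\<lambda>j. x [^] (p * j)) ` {..<p}"
    have QR: "Q \<subseteq> ?R" if Q: "subgroup Q G" "Q \<subseteq> P" "card Q = p" for Q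
    proof
      fix y assume y: "y \<in> Q"
      obtain k :: nat where k: "y = x [^] k" using P_pow y Q(2) by blast
      have yP: "y \<in> P" "generate G {y} \<subseteq> Q"
        using y Q(2) generate_subgroup_incl[OF _ Q(1), of "{y}"] by auto
      have "ord y dvd p" using subgroup_card_dvd[OF fin gen(1)[OF yP(1)] Q(1) yP(2)] gen(3)[OF yP(1)] Q(3) by simp
      then have "y [^] p = \<one>" using pow_eq_id[of y p] yP(1) by simp
      then have "x [^] (k * p) = \<one>" using k xG by (simp add: nat_pow_pow)
      then have "p\<^sup>2 dvd k * p" using pow_eq_id[OF xG] x(2) by simp
      then have "p dvd k" using p1 by (simp add: power2_eq_square)
      then obtain j where j: "k = p * j" by (elim dvdE)
      have "x [^] (p * j) = x [^] (p * (j mod p))"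
      proof -
        have "p * j = p * (j mod p) + p\<^sup>2 * (j div p)"
          by (metis add.commute distrib_left mult.assoc mult_div_mod_eq power2_eq_square)
        then have "x [^] (p * j) = x [^] (p * (j mod p)) \<otimes> (x [^] (p\<^sup>2)) [^] (j div p)"
          using xG by (simp add: nat_pow_mult nat_pow_pow)
        then show ?thesis using pow_ord_eq_1[OF xG] x(2) xG by simp
      qed
      then show "y \<in> ?R" using k j p1 by auto
    qed
    have cR: "card ?R \<le> p" using card_image_le[of "{..<p}"] by force
    have eqR: "Q = ?R" if Q: "subgroup Q G" "Q \<subseteq> P" "card Q = p" for Q
      using QR[OF Q] cR Q(3) by (intro card_seteq) auto
    obtain Q where Q: "subgroup Q G" "Q \<subseteq> P" "card Q = p"
      using exists_subgroup_prime_power[OF fin P(1) p, of 1] P(2) by (auto simp: power2_eq_square)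
    have "?\<Q> = {Q}" using eqR Q by blast
    then show ?thesis using p1 by simp
  next
    case False
    have union: "(\<Union>Q\<in>?\<Q>. Q - {\<one>}) = P - {\<one>}"
    proof (intro equalityI subsetI)
      fix x assume x: "x \<in> P - {\<one>}"
      then have "ord x = p" using ord[of x] False ord_eq_1[of x] by auto
      then have "generate G {x} \<in> ?\<Q>" using gen[of x] x by simp
      then show "x \<in> (\<Union>Q\<in>?\<Q>. Q - {\<one>})" using gen(4)[of x] x by blast
    qed auto
    have "card (\<Union>Q\<in>?\<Q>. Q - {\<one>}) = (\<Sum>Q\<in>?\<Q>. card (Q - {\<one>}))"
    proof (rule card_UN_disjoint[OF finQ])
      show "\<forall>Q\<in>?\<Q>. finite (Q - {\<one>})" using finP finite_subset by blast
      show "\<forall>Q\<in>?\<Q>. \<forall>Q'\<in>?\<Q>. Q \<noteq> Q' \<longrightarrow> (Q - {\<one>}) \<inter> (Q' - {\<one>}) = {}"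
      proof (intro ballI impI)
        fix Q Q' assume Q: "Q \<in> ?\<Q>" "Q' \<in> ?\<Q>" "Q \<noteq> Q'"
        then have "Q \<inter> Q' = {\<one>} \<or> Q \<inter> Q' = Q" "Q \<inter> Q' = {\<one>} \<or> Q \<inter> Q' = Q'"
          using prime_subgroup_cases[OF fin, of Q "Q \<inter> Q'"] prime_subgroup_cases[OF fin, of Q' "Q \<inter> Q'"]
            subgroups_Inter_pair[of Q Q'] p by auto
        then show "(Q - {\<one>}) \<inter> (Q' - {\<one>}) = {}" using Q(3) by blast
      qed
    qed
    also have "\<dots> = (\<Sum>Q\<in>?\<Q>. p - 1)"
      by (rule sum.cong[OF refl])
        (use subgroup.one_closed[of _ G] in \<open>auto simp: card_Diff_singleton\<close>)
    also have "\<dots> = card ?\<Q> * (p - 1)" by simp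
    finally have "card ?\<Q> * (p - 1) = p\<^sup>2 - 1"
      unfolding union using P.one_closed P(2) by (simp add: card_Diff_singleton)
    also have "\<dots> = (p + 1) * (p - 1)" using p1 by (simp add: power2_eq_square algebra_simps)
    finally have "card ?\<Q> = p + 1 \<or> p - 1 = 0" by (simp only: mult_cancel2)
    then have "card ?\<Q> = p + 1" using p1 by linarith
    then show ?thesis using p1 mod_add_self1[of p 1] by simp
  qed
qed

text \<open>The elements of \<open>D\<close> represent the \<open>Q\<close>-orbits on the cosets of
  \<open>J\<close>. As \<open>Q\<close> is trivial or of prime order, an orbit is a fixed point or
  free, and the orbit of \<open>d <# J\<close> is a fixed point exactly when conjugating
  \<open>Q\<close> by the inverse of \<open>d\<close> gives a subgroup of \<open>J\<close>.\<close>

lemma double_coset_orbits: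
  assumes Q: "subgroup Q G" "Q = {\<one>} \<or> Factorial_Ring.prime (card Q)" and J: "subgroup J G"
    and D: "double_coset_reps G Q (carrier G) J D"
  shows "card {C \<in> lcosets J. \<forall>q\<in>Q. q <# C = C} = card {d \<in> D. conjugate_right G Q d \<subseteq> J}"
    "card (lcosets J) = card {d \<in> D. conjugate_right G Q d \<subseteq> J} +
      card Q * card {d \<in> D. \<not> conjugate_right G Q d \<subseteq> J}"
proof -
  interpret Q: subgroup Q G by (rule Q(1))
  interpret J: subgroup J G by (rule J)
  let ?o = "\<lambda>d. (\<lambda>q. q <# (d <# J)) ` Q" and ?fix = "\<lambda>C. \<forall>q\<in>Q. q <# C = C"
  have DG: "D \<subseteq> carrier G" using D by (simp add: double_coset_reps_def)
  have finD: "finite D" by (rule double_coset_reps_finite[OF subgroup_self D])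
  have mem_o: "g <# J \<in> ?o d \<longleftrightarrow> d \<in> (Q #> g) <#> J" if gd: "g \<in> carrier G" "d \<in> carrier G" for g d
  proof
    assume "g <# J \<in> ?o d"
    then obtain q where q: "q \<in> Q" "g <# J = q <# (d <# J)" by auto
    have q: "q \<in> Q" "g <# J = (q \<otimes> d) <# J"
      using q lcos_m_assoc[OF J.subset, of q d] that(2) by simp_all
    have "g \<in> (q \<otimes> d) <# J" unfolding q(2)[symmetric] by (rule lcos_self[OF that(1) J])
    then have "inv (q \<otimes> d) \<otimes> g \<in> J" using lcoset_mem_iff[OF J] q(1) that by simp
    then have "inv (inv (q \<otimes> d) \<otimes> g) \<in> J" by (rule J.m_inv_closed)
    moreover have "d = inv q \<otimes> g \<otimes> inv (inv (q \<otimes> d) \<otimes> g)"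
      using q(1) that by (simp add: inv_mult_group m_assoc inv_mult_cancel_left)
    ultimately show "d \<in> (Q #> g) <#> J"
      unfolding mem_double_coset[OF Q(1) J that(1)] using Q.m_inv_closed[OF q(1)] by blast
  next
    assume "d \<in> (Q #> g) <#> J"
    then obtain q j where qj: "q \<in> Q" "j \<in> J" "d = q \<otimes> g \<otimes> j"
      unfolding mem_double_coset[OF Q(1) J gd(1)] by blast
    then have "inv q \<otimes> d = g \<otimes> j" using that(1) by (simp add: m_assoc inv_mult_cancel_left)
    then have "inv q \<otimes> d \<in> g <# J" using qj(2) by (auto simp: l_coset_def)
    then have "g <# J = (inv q \<otimes> d) <# J" by (rule l_repr_independence[OF _ that(1) J])
    also have "\<dots> = inv q <# (d <# J)" using qj(1) that(2) J.subset by (simp add: lcos_m_assoc)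
    finally show "g <# J \<in> ?o d" using Q.m_inv_closed[OF qj(1)] by blast
  qed
  have union: "lcosets J = (\<Union>d\<in>D. ?o d)"
  proof (intro equalityI subsetI)
    fix C assume "C \<in> lcosets J"
    then obtain g where g: "g \<in> carrier G" "C = g <# J" by (rule lcosetsE)
    obtain d where d: "d \<in> D" "d \<in> (Q #> g) <#> J" using D g(1) unfolding double_coset_reps_def by blast
    then have "C \<in> ?o d" using mem_o[OF g(1) subsetD[OF DG d(1)]] g(2) by simp
    then show "C \<in> (\<Union>d\<in>D. ?o d)" using d(1) by (rule UN_I[rotated])
  next
    fix C assume "C \<in> (\<Union>d\<in>D. ?o d)"
    then obtain d q where "d \<in> D" "q \<in> Q" "C = q <# (d <# J)" by auto
    then show "C \<in> lcosets J" using DG lcoset_act[OF J lcosetsI] by auto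
  qed
  have disj: "?o d \<inter> ?o e = {}" if "d \<in> D" "e \<in> D" "d \<noteq> e" for d e
  proof (rule ccontr)
    assume "?o d \<inter> ?o e \<noteq> {}"
    then obtain C where C: "C \<in> ?o d" "C \<in> ?o e" by blast
    from C(1) that(1) have "C \<in> lcosets J" unfolding union by (rule UN_I[rotated])
    then obtain g where g: "g \<in> carrier G" "C = g <# J" by (rule lcosetsE)
    have "d \<in> (Q #> g) <#> J" "e \<in> (Q #> g) <#> J"
      using mem_o[OF g(1) subsetD[OF DG that(1)]] mem_o[OF g(1) subsetD[OF DG that(2)]] C g(2) by simp_all
    moreover have "\<exists>!x. x \<in> D \<and> x \<in> (Q #> g) <#> J"
      using D g(1) unfolding double_coset_reps_def by (elim conjE) (rule bspec)
    ultimately show False using that by (auto elim!: ex1E)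
  qed
  have fix_iff: "?fix (d <# J) \<longleftrightarrow> conjugate_right G Q d \<subseteq> J" if "d \<in> D" for d
  proof -
    have dG: "d \<in> carrier G" using that DG by blast
    have "?fix (d <# J) \<longleftrightarrow> Q \<subseteq> conjugate G d J"
      using coset_stabilizer[OF J dG] Q.subset by blast
    then show ?thesis
      using conjugate_subset_iff[OF Q.subset J.subset, of "inv d"] dG by (simp add: conjugate_right_eq)
  qed
  have sum: "(\<Sum>C\<in>lcosets J. F C) = (\<Sum>d\<in>D. \<Sum>C\<in>?o d. F C)" for F :: "'a set \<Rightarrow> nat"
    unfolding union
    by (rule sum.UNION_disjoint[OF finD]) (use finite_subgroup[OF Q(1)] disj in auto)
  have orbit: "?o d = {d <# J}" if "?fix (d <# J)" for d
  proof -
    have "?o d = (\<lambda>_. d <# J) ` Q" by (rule image_cong[OF refl]) (use that in blast)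
    moreover have "Q \<noteq> {}" using Q.one_closed by blast
    ultimately show ?thesis by (simp add: image_constant_conv)
  qed
  have nonfix: "card (?o d) = card Q \<and> (\<forall>C\<in>?o d. \<not> ?fix C)" if d: "d \<in> D" and nf: "\<not> ?fix (d <# J)" for d
  proof -
    have dJ: "d <# J \<subseteq> carrier G" using d DG J.subset by (intro l_coset_subset_G) auto
    have st: "subgroup {q \<in> Q. q <# (d <# J) = d <# J} G" by (rule stabilizer_subgroup[OF Q(1) dJ])
    have "Factorial_Ring.prime (card Q)" using Q(2) nf lcos_mult_one[OF dJ] by auto
    then have "{q \<in> Q. q <# (d <# J) = d <# J} = {\<one>}"
      using prime_subgroup_cases[OF fin Q(1) _ st] nf by blast
    then have "card (?o d) = card Q"
      using card_orbit_stabilizer[OF Q(1) finite_subgroup[OF Q(1)] dJ] by simp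
    moreover have "\<not> ?fix (q <# (d <# J))" if q: "q \<in> Q" for q
    proof
      assume f: "?fix (q <# (d <# J))"
      have "inv q <# (q <# (d <# J)) = d <# J" using q dJ by (simp add: lcos_m_assoc lcos_mult_one)
      then have "q <# (d <# J) = d <# J" using f q by auto
      then show False using f nf by simp
    qed
    ultimately show ?thesis by blast
  qed
  have finJ: "finite (lcosets J)" by (rule finite_lcosets[OF J])
  have "card {C \<in> lcosets J. ?fix C} = (\<Sum>C\<in>lcosets J. of_bool (?fix C))" using finJ by (simp add: Int_def)
  also have "\<dots> = (\<Sum>d\<in>D. of_bool (?fix (d <# J)))"
    unfolding sum
  proof (rule sum.cong[OF refl])
    fix d assume d: "d \<in> D"
    show "(\<Sum>C\<in>?o d. of_bool (?fix C)) = (of_bool (?fix (d <# J)) :: nat)"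
    proof (cases "?fix (d <# J)")
      case True
      then show ?thesis unfolding orbit[OF True] by simp
    next
      case False
      have "(\<Sum>C\<in>?o d. of_bool (?fix C)) = (0::nat)"
      proof (rule sum.neutral, rule ballI)
        fix C assume "C \<in> ?o d"
        then have "\<not> ?fix C" using nonfix[OF d False] by (elim conjE) (rule bspec)
        then show "of_bool (?fix C) = (0::nat)" by (simp only: of_bool_eq)
      qed
      then show ?thesis using False by (simp only: of_bool_eq)
    qed
  qed
  also have "\<dots> = (\<Sum>d\<in>D. of_bool (conjugate_right G Q d \<subseteq> J))" by (rule sum.cong[OF refl]) (simp only: fix_iff)
  also have "\<dots> = card {d \<in> D. conjugate_right G Q d \<subseteq> J}" using finD by (simp add: Int_def)
  finally show "card {C \<in> lcosets J. ?fix C} = card {d \<in> D. conjugate_right G Q d \<subseteq> J}" .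
  have "card (lcosets J) = (\<Sum>C\<in>lcosets J. 1)" by simp
  also have "\<dots> = (\<Sum>d\<in>D. of_bool (conjugate_right G Q d \<subseteq> J) + card Q * of_bool (\<not> conjugate_right G Q d \<subseteq> J))"
    unfolding sum
  proof (rule sum.cong[OF refl])
    fix d assume d: "d \<in> D"
    show "(\<Sum>C\<in>?o d. 1) = of_bool (conjugate_right G Q d \<subseteq> J) + card Q * of_bool (\<not> conjugate_right G Q d \<subseteq> J)"
    proof (cases "?fix (d <# J)")
      case True
      then show ?thesis unfolding orbit[OF True] using fix_iff[OF d] by simp
    next
      case False
      then show ?thesis using nonfix[OF d False] fix_iff[OF d] by simp
    qed
  qed
  also have "\<dots> = card {d \<in> D. conjugate_right G Q d \<subseteq> J} +
      card Q * card {d \<in> D. \<not> conjugate_right G Q d \<subseteq> J}"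
    using finD by (simp add: sum.distrib sum_distrib_left[symmetric] Int_def del: of_bool_not_iff)
  finally show "card (lcosets J) = card {d \<in> D. conjugate_right G Q d \<subseteq> J} +
      card Q * card {d \<in> D. \<not> conjugate_right G Q d \<subseteq> J}" .
qed

section \<open>The Burnside ring as the corner at \<open>G\<close>\<close>

definition br :: "'a set \<Rightarrow> ('a mackey_gen list \<Rightarrow> int) set" where
  "br H = bas (carrier G) (carrier G) \<one> H"

lemma br_admissible: "subgroup H G \<Longrightarrow> admissible (carrier G) (carrier G) \<one> H"
  using conjugate_one[of H] subgroup.subset[of H G] by (simp add: admissible_def subgroup_self)

lemma br_closed: "subgroup H G \<Longrightarrow> br H \<in> carrier \<mu>"
  unfolding br_def by (intro bas_closed br_admissible)

text \<open>At this corner every \<open>g\<close> is absorbed by the transfer to \<open>G\<close>;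
  together with \<open>br_conjugate\<close>, only the conjugacy class of \<open>J\<close>
  matters.\<close>

lemma bas_eq_br:
  assumes "subgroup J G" "g \<in> carrier G"
  shows "bas (carrier G) (carrier G) g J = br J"
  using bas_left(1)[OF br_admissible[OF assms(1)] assms(2)] assms(2) by (simp add: br_def)

lemma br_conjugate:
  assumes "subgroup J G" "g \<in> carrier G"
  shows "br (conjugate G g J) = br J"
  using bas_right(1)[OF _ one_closed assms(2), of "carrier G" J] bas_eq_br[OF assms]
    bas_left(2)[OF br_admissible[OF assms(1)] assms(2)] assms(2) by (simp add: br_def)

lemma br_mult:
  assumes "subgroup Q G" "subgroup J G" "double_coset_reps G Q (carrier G) J D"
  shows "br Q \<otimes>\<^bsub>\<mu>\<^esub> br J = (\<Oplus>\<^bsub>\<mu>\<^esub>h\<in>D. br (conjugate_right G Q h \<inter> J))"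
proof -
  have J1: "conjugate G \<one> J = J" using conjugate_one[OF subgroup.subset[OF assms(2)]] .
  have DG: "D \<subseteq> carrier G" using assms(3) by (simp add: double_coset_reps_def)
  have I: "subgroup (conjugate_right G Q h \<inter> J) G" if "h \<in> D" for h
    using conjugate_right_Int_subgroup[OF assms(2,1)] that DG by blast
  have "br Q \<otimes>\<^bsub>\<mu>\<^esub> br J = (\<Oplus>\<^bsub>\<mu>\<^esub>h\<in>D. bas (carrier G) (carrier G) (\<one> \<otimes> (h \<otimes> \<one>))
      (conjugate G (inv \<one>) (conjugate_right G Q h \<inter> conjugate G \<one> J)))"
    unfolding br_def
    by (rule bas_mult(1)[OF br_admissible[OF assms(1)] br_admissible[OF assms(2)]]) (simp add: J1 assms(3))
  also have "\<dots> = (\<Oplus>\<^bsub>\<mu>\<^esub>h\<in>D. br (conjugate_right G Q h \<inter> J))"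
  proof (rule P.A.finsum_cong'[OF refl])
    fix h assume h: "h \<in> D"
    then show "bas (carrier G) (carrier G) (\<one> \<otimes> (h \<otimes> \<one>))
      (conjugate G (inv \<one>) (conjugate_right G Q h \<inter> conjugate G \<one> J)) = br (conjugate_right G Q h \<inter> J)"
      using bas_eq_br[OF I[OF h], of h] DG conjugate_one[OF subgroup.subset[OF I[OF h]]] J1 by auto
  qed (use I br_closed in blast)
  finally show ?thesis .
qed

text \<open>In the Burnside ring, the product of G/Q and G/J consists of one copy of G/Q for each
  fixed coset and \<open>k\<close> copies of G/1, one for each free \<open>Q\<close>-orbit on the
  moved cosets. The second equation computes \<open>k\<close> from the number of moved
  cosets.\<close>

lemma central_form_br_mult:
  assumes \<phi>: "central_form \<phi>" and Q: "subgroup Q G" "Q = {\<one>} \<or> Factorial_Ring.prime (card Q)" and J: "subgroup J G"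
  shows "\<exists>k. \<phi> (br Q \<otimes>\<^bsub>\<mu>\<^esub> br J) =
      int (card {C \<in> lcosets J. \<forall>q\<in>Q. q <# C = C}) * \<phi> (br Q) + k * \<phi> (br {\<one>}) \<and>
    int (card {C \<in> lcosets J. \<not> (\<forall>q\<in>Q. q <# C = C)}) = int (card Q) * k"
proof -
  obtain D where D: "double_coset_reps G Q (carrier G) J D"
    using exists_double_coset_reps[OF subgroup_self J Q(1)] subgroup.subset[OF J] subgroup.subset[OF Q(1)] by blast
  have DG: "D \<subseteq> carrier G" using D by (simp add: double_coset_reps_def)
  have finD: "finite D" by (rule double_coset_reps_finite[OF subgroup_self D])
  let ?F = "\<lambda>d. conjugate_right G Q d \<subseteq> J" and ?fix = "\<lambda>C. \<forall>q\<in>Q. q <# C = C"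
  have I: "subgroup (conjugate_right G Q h \<inter> J) G" if "h \<in> D" for h
    using conjugate_right_Int_subgroup[OF J Q(1)] that DG by blast
  have val: "\<phi> (br (conjugate_right G Q h \<inter> J)) = (if ?F h then \<phi> (br Q) else \<phi> (br {\<one>}))" if h: "h \<in> D" for h
  proof -
    have hG: "h \<in> carrier G" using h DG by blast
    let ?C = "conjugate_right G Q h"
    have C: "subgroup ?C G" "card ?C = card Q" "br ?C = br Q"
      using hG conjugate_subgroup[OF Q(1), of "inv h"] card_conjugate[OF subgroup.subset[OF Q(1)], of "inv h"]
        br_conjugate[OF Q(1), of "inv h"] by (auto simp: conjugate_right_eq)
    show ?thesis
    proof (cases "?F h")
      case True
      then have "?C \<inter> J = ?C" by blast
      then show ?thesis using True C(3) by simp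
    next
      case False
      have "Q \<noteq> {\<one>}"
      proof
        assume "Q = {\<one>}"
        then have "?C = {\<one>}" using trivial_card_subgroup[OF C(1)] C(2) by simp
        then show False using False subgroup.one_closed[OF J] by simp
      qed
      then have "?C \<inter> J = {\<one>}"
        using prime_subgroup_cases[OF fin C(1) _ I[OF h]] Q(2) C(2) False by auto
      then show ?thesis using False by simp
    qed
  qed
  have "\<phi> (br Q \<otimes>\<^bsub>\<mu>\<^esub> br J) = (\<Sum>h\<in>D. \<phi> (br (conjugate_right G Q h \<inter> J)))"
    unfolding br_mult[OF Q(1) J D]
    by (rule finsum_additive[OF P.A.abelian_group_axioms finD])
      (use \<phi> br_closed[OF I] in \<open>auto simp: central_form_def\<close>)
  also have "\<dots> = (\<Sum>h\<in>D. of_bool (?F h) * \<phi> (br Q) + of_bool (\<not> ?F h) * \<phi> (br {\<one>}))"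
    by (rule sum.cong[OF refl]) (simp add: val)
  also have "\<dots> = int (card {d \<in> D. ?F d}) * \<phi> (br Q) + int (card {d \<in> D. \<not> ?F d}) * \<phi> (br {\<one>})"
    using finD by (simp add: sum.distrib sum_distrib_right[symmetric] Int_def del: of_bool_not_iff)
  finally have 1: "\<phi> (br Q \<otimes>\<^bsub>\<mu>\<^esub> br J) =
    int (card {C \<in> lcosets J. ?fix C}) * \<phi> (br Q) + int (card {d \<in> D. \<not> ?F d}) * \<phi> (br {\<one>})"
    unfolding double_coset_orbits(1)[OF Q J D] .
  have "lcosets J = {C \<in> lcosets J. ?fix C} \<union> {C \<in> lcosets J. \<not> ?fix C}" by blast
  then have "card (lcosets J) = card ({C \<in> lcosets J. ?fix C} \<union> {C \<in> lcosets J. \<not> ?fix C})" by simp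
  also have "\<dots> = card {C \<in> lcosets J. ?fix C} + card {C \<in> lcosets J. \<not> ?fix C}"
    using finite_lcosets[OF J] by (intro card_Un_disjoint) auto
  finally have "card {C \<in> lcosets J. \<not> ?fix C} = card Q * card {d \<in> D. \<not> ?F d}"
    using double_coset_orbits[OF Q J D] by simp
  then have "int (card {C \<in> lcosets J. \<not> ?fix C}) = int (card Q) * int (card {d \<in> D. \<not> ?F d})" by simp
  with 1 show ?thesis by blast
qed

text \<open>
  Every orbit of \<open>P\<close> on \<open>lcosets J\<close> contributes a multiple of \<open>p\<^sup>2\<close>: the orbits of length \<open>p\<close>
  because the number of subgroups of order \<open>p\<close> is congruent to \<open>1\<close>.
\<close>

lemma sum_moved_cosets:
  assumes P: "subgroup P G" "card P = p\<^sup>2" and p: "Factorial_Ring.prime (p::nat)" and J: "subgroup J G"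
  shows "p\<^sup>2 dvd (\<Sum>Q\<in>{Q. subgroup Q G \<and> Q \<subseteq> P \<and> card Q = p}.
    card {C \<in> lcosets J. \<not> (\<forall>q\<in>Q. q <# C = C)})"
proof -
  let ?\<Q> = "{Q. subgroup Q G \<and> Q \<subseteq> P \<and> card Q = p}"
  interpret P: subgroup P G by fact
  have finQ: "finite ?\<Q>" by (rule finite_subset[OF _ finite_subgroups]) auto
  have finP: "finite P" by (rule finite_subgroup[OF P(1)])
  have finJ: "finite (lcosets J)" by (rule finite_lcosets[OF J])
  have p1: "p > 1" using prime_gt_1_nat[OF p] .
  define s where "s C = {x \<in> P. x <# C = C}" for C
  have sub: "C \<subseteq> carrier G" if "C \<in> lcosets J" for C by (rule lcoset_carrier[OF J that])
  have s: "subgroup (s C) G" "s C \<subseteq> P" if "C \<in> lcosets J" for C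
    unfolding s_def by (rule stabilizer_subgroup[OF P(1) sub[OF that]]) auto
  have s_act: "card (s (x <# C)) = card (s C)" if x: "x \<in> P" and C: "C \<in> lcosets J" for x C
  proof -
    have xG: "x \<in> carrier G" using x by simp
    have "s (x <# C) = conjugate G x (s C)"
    proof (intro equalityI subsetI)
      fix y assume y: "y \<in> s (x <# C)"
      then have yP: "y \<in> P" "(y \<otimes> x) <# C = x <# C" using sub[OF C] x by (auto simp: s_def lcos_m_assoc)
      then have "(inv (y \<otimes> x) \<otimes> x) <# C = C"
        using l_coset_eq_iff[OF sub[OF C], of "y \<otimes> x" x] x by simp
      then have "(inv x \<otimes> inv y \<otimes> x) \<in> s C"
        using x yP(1) by (simp add: s_def inv_mult_group)
      then have "inv (inv x \<otimes> inv y \<otimes> x) \<in> s C" by (rule subgroup.m_inv_closed[OF s(1)[OF C]])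
      then have "inv x \<otimes> y \<otimes> x \<in> s C" using x yP(1) by (simp add: inv_mult_group m_assoc)
      then show "y \<in> conjugate G x (s C)"
        using mem_conjugate[OF subgroup.subset[OF s(1)[OF C]] xG, of y] yP(1) by simp
    next
      fix y assume y: "y \<in> conjugate G x (s C)"
      then obtain z where z: "z \<in> P" "z <# C = C" "y = x \<otimes> z \<otimes> inv x" by (auto simp: conjugate_def s_def)
      have "y <# (x <# C) = (x \<otimes> z) <# C" using z x sub[OF C] by (simp add: lcos_m_assoc m_assoc)
      also have "\<dots> = x <# (z <# C)" using lcos_m_assoc[OF sub[OF C] xG, of z] z(1) by simp
      finally show "y \<in> s (x <# C)" using z x by (simp add: s_def)
    qed
    then show ?thesis using card_conjugate[OF subgroup.subset[OF s(1)[OF C]] xG] by simp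
  qed
  \<comment> \<open>The cosets whose stabilizer has order \<open>m\<close> form a union of
    \<open>P\<close>-orbits, since \<open>s_act\<close> makes this order constant along
    orbits.\<close>
  have dvd: "p\<^sup>2 dvd m * card {C \<in> lcosets J. card (s C) = m}" for m
    unfolding P(2)[symmetric]
    by (rule card_dvd_stabilizer_mult_card[OF P(1) finP])
      (use finJ sub s_act lcoset_act[OF J] in \<open>auto simp: s_def\<close>)
  have moved: "(\<forall>q\<in>Q. q <# C = C) \<longleftrightarrow> Q \<subseteq> s C" if "Q \<in> ?\<Q>" for Q C
    using that by (auto simp: s_def)
  have cases: "card (s C) = 1 \<or> card (s C) = p \<or> s C = P" if C: "C \<in> lcosets J" for C
  proof -
    have "card (s C) dvd p\<^sup>2" using subgroup_card_dvd[OF fin s(1)[OF C] P(1) s(2)[OF C]] P(2) by simp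
    then obtain i where i: "i \<le> 2" "card (s C) = p ^ i" using divides_primepow_nat[OF p] by blast
    then have "card (s C) = 1 \<or> card (s C) = p \<or> card (s C) = card P"
      using P(2) by (cases i) (auto simp: le_Suc_eq power2_eq_square numeral_2_eq_2)
    then show ?thesis using card_subset_eq[OF finP s(2)[OF C]] by blast
  qed
  \<comment> \<open>A coset with trivial stabilizer is moved by every \<open>Q\<close>, one with a
    stabilizer of order \<open>p\<close> by all \<open>Q\<close> but that stabilizer, and one fixed
    by \<open>P\<close> by none.\<close>
  have count: "card {Q \<in> ?\<Q>. \<not> Q \<subseteq> s C} =
      card ?\<Q> * of_bool (card (s C) = 1) + (card ?\<Q> - 1) * of_bool (card (s C) = p)"
    if C: "C \<in> lcosets J" for C
    using cases[OF C]
  proof (elim disjE)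
    assume 1: "card (s C) = 1"
    have "\<not> Q \<subseteq> s C" if "Q \<in> ?\<Q>" for Q
      using that 1 card_mono[OF finite_subgroup[OF s(1)[OF C]], of Q] p1 by auto
    then have "{Q \<in> ?\<Q>. \<not> Q \<subseteq> s C} = ?\<Q>" by blast
    then show ?thesis using 1 p1 by simp
  next
    assume 2: "card (s C) = p"
    have "Q \<subseteq> s C \<longleftrightarrow> Q = s C" if "Q \<in> ?\<Q>" for Q
      using that 2 card_subset_eq[OF finite_subgroup[OF s(1)[OF C]], of Q] by auto
    then have "{Q \<in> ?\<Q>. \<not> Q \<subseteq> s C} = ?\<Q> - {s C}" by blast
    moreover have "s C \<in> ?\<Q>" using s[OF C] 2 by simp
    ultimately show ?thesis using 2 p1 by (simp add: card_Diff_singleton)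
  next
    assume 3: "s C = P"
    then have empty: "{Q \<in> ?\<Q>. \<not> Q \<subseteq> s C} = {}" by blast
    have "card (s C) \<noteq> 1" "card (s C) \<noteq> p"
      using 3 P(2) p1 by (auto simp: power2_eq_square)
    then show ?thesis unfolding empty by simp
  qed
  have "(\<Sum>Q\<in>?\<Q>. card {C \<in> lcosets J. \<not> (\<forall>q\<in>Q. q <# C = C)}) =
      (\<Sum>Q\<in>?\<Q>. \<Sum>C\<in>lcosets J. of_bool (\<not> Q \<subseteq> s C))"
    by (rule sum.cong[OF refl]) (use finJ moved in \<open>simp add: Int_def del: of_bool_not_iff\<close>)
  also have "\<dots> = (\<Sum>C\<in>lcosets J. \<Sum>Q\<in>?\<Q>. of_bool (\<not> Q \<subseteq> s C))" by (rule sum.swap)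
  also have "\<dots> = (\<Sum>C\<in>lcosets J. card {Q \<in> ?\<Q>. \<not> Q \<subseteq> s C})"
    by (rule sum.cong[OF refl]) (use finQ in \<open>simp add: Int_def del: of_bool_not_iff\<close>)
  also have "\<dots> = (\<Sum>C\<in>lcosets J. card ?\<Q> * of_bool (card (s C) = 1) + (card ?\<Q> - 1) * of_bool (card (s C) = p))"
    by (rule sum.cong[OF refl count])
  also have "\<dots> = card ?\<Q> * card {C \<in> lcosets J. card (s C) = 1} + (card ?\<Q> - 1) * card {C \<in> lcosets J. card (s C) = p}"
    using finJ by (simp add: sum.distrib sum_distrib_left[symmetric] Int_def)
  finally have eq: "(\<Sum>Q\<in>?\<Q>. card {C \<in> lcosets J. \<not> (\<forall>q\<in>Q. q <# C = C)}) = \<dots>" .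
  \<comment> \<open>In the second term one factor \<open>p\<close> comes from the orbits of length
    \<open>p\<close>, the other from the number of subgroups minus one. In the first term the orbits
    are regular.\<close>
  have "p * p dvd p * card {C \<in> lcosets J. card (s C) = p}" using dvd[of p] by (simp add: power2_eq_square)
  then have "p dvd card {C \<in> lcosets J. card (s C) = p}" using p1 by simp
  moreover have "p dvd card ?\<Q> - 1" using card_prime_square_subgroups[OF P p] by (metis dvd_minus_mod)
  ultimately have "p * p dvd (card ?\<Q> - 1) * card {C \<in> lcosets J. card (s C) = p}" by (intro mult_dvd_mono)
  then show ?thesis unfolding eq using dvd[of 1] by (simp add: power2_eq_square)
qed

lemma bas_not_corner:
  assumes "subgroup Q G" "admissible H K g J" "H \<noteq> carrier G"
  shows "br Q \<otimes>\<^bsub>\<mu>\<^esub> bas H K g J = \<zero>\<^bsub>\<mu>\<^esub>"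
  unfolding br_def using assms by (intro bas_mult_non_composable[OF br_admissible]) auto

lemma bas_not_corner':
  assumes "subgroup Q G" "admissible H K g J" "K \<noteq> carrier G"
  shows "bas H K g J \<otimes>\<^bsub>\<mu>\<^esub> br Q = \<zero>\<^bsub>\<mu>\<^esub>"
  unfolding br_def using assms by (intro bas_mult_non_composable[OF _ br_admissible])

lemma central_form_zero: "central_form \<phi> \<Longrightarrow> \<phi> \<zero>\<^bsub>\<mu>\<^esub> = 0"
proof -
  assume "central_form \<phi>"
  then have "\<phi> (0 \<odot>\<^bsub>\<mu>\<^esub> \<zero>\<^bsub>\<mu>\<^esub>) = 0 * \<phi> \<zero>\<^bsub>\<mu>\<^esub>" unfolding central_form_def by blast
  then show ?thesis by (simp add: \<mu>.int_smult_distr)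
qed

text \<open>
  Multiplication by an element of the corner at \<open>G\<close> can be tested on the corner alone,
  since \<open>\<phi>\<close> is central.
\<close>

lemma corner_dvd:
  assumes \<phi>: "central_form \<phi>" and fin\<Q>: "finite \<Q>" and \<Q>: "\<And>Q. Q \<in> \<Q> \<Longrightarrow> subgroup Q G"
    and dvd: "\<And>J. subgroup J G \<Longrightarrow> m dvd (\<Sum>Q\<in>\<Q>. c Q * \<phi> (br Q \<otimes>\<^bsub>\<mu>\<^esub> br J))"
    and a: "a \<in> carrier \<mu>"
  shows "m dvd (\<Sum>Q\<in>\<Q>. c Q * \<phi> (br Q \<otimes>\<^bsub>\<mu>\<^esub> a))"
  using a
proof (induction a rule: span_induct)
  case (basis y)
  then obtain H K g J where adm: "admissible H K g J" and y: "y = bas H K g J" by (auto simp: basis_set_def)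
  show ?case
  proof (cases "H = carrier G \<and> K = carrier G")
    case True
    moreover from this have "subgroup J G" "g \<in> carrier G" using adm by (auto simp: admissible_def)
    ultimately show ?thesis using dvd[of J] bas_eq_br[of J g] y by simp
  next
    case False
    have "\<phi> (br Q \<otimes>\<^bsub>\<mu>\<^esub> y) = 0" if Q: "Q \<in> \<Q>" for Q
    proof (cases "H = carrier G")
      case True
      then have "y \<otimes>\<^bsub>\<mu>\<^esub> br Q = \<zero>\<^bsub>\<mu>\<^esub>" using bas_not_corner'[OF \<Q>[OF Q] adm] False y by simp
      moreover have "\<phi> (br Q \<otimes>\<^bsub>\<mu>\<^esub> y) = \<phi> (y \<otimes>\<^bsub>\<mu>\<^esub> br Q)"
        using \<phi> br_closed[OF \<Q>[OF Q]] bas_closed[OF adm] y unfolding central_form_def by blast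
      ultimately show ?thesis using central_form_zero[OF \<phi>] by simp
    next
      case False
      then show ?thesis using bas_not_corner[OF \<Q>[OF Q] adm] y central_form_zero[OF \<phi>] by simp
    qed
    then show ?thesis by simp
  qed
next
  case (add y z)
  have "(\<Sum>Q\<in>\<Q>. c Q * \<phi> (br Q \<otimes>\<^bsub>\<mu>\<^esub> (y \<oplus>\<^bsub>\<mu>\<^esub> z))) =
      (\<Sum>Q\<in>\<Q>. c Q * \<phi> (br Q \<otimes>\<^bsub>\<mu>\<^esub> y) + c Q * \<phi> (br Q \<otimes>\<^bsub>\<mu>\<^esub> z))"
  proof (rule sum.cong[OF refl])
    fix Q assume "Q \<in> \<Q>"
    then have "br Q \<in> carrier \<mu>" using br_closed \<Q> by blast
    then show "c Q * \<phi> (br Q \<otimes>\<^bsub>\<mu>\<^esub> (y \<oplus>\<^bsub>\<mu>\<^esub> z)) = c Q * \<phi> (br Q \<otimes>\<^bsub>\<mu>\<^esub> y) + c Q * \<phi> (br Q \<otimes>\<^bsub>\<mu>\<^esub> z)"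
      using add \<phi> by (simp add: P.A.r_distr central_form_def distrib_left)
  qed
  then show ?case using add by (simp add: sum.distrib)
next
  case (smult k y)
  have "(\<Sum>Q\<in>\<Q>. c Q * \<phi> (br Q \<otimes>\<^bsub>\<mu>\<^esub> (k \<odot>\<^bsub>\<mu>\<^esub> y))) = k * (\<Sum>Q\<in>\<Q>. c Q * \<phi> (br Q \<otimes>\<^bsub>\<mu>\<^esub> y))"
    unfolding sum_distrib_left
  proof (rule sum.cong[OF refl])
    fix Q assume "Q \<in> \<Q>"
    then have "br Q \<in> carrier \<mu>" using br_closed \<Q> by blast
    then show "c Q * \<phi> (br Q \<otimes>\<^bsub>\<mu>\<^esub> (k \<odot>\<^bsub>\<mu>\<^esub> y)) = k * (c Q * \<phi> (br Q \<otimes>\<^bsub>\<mu>\<^esub> y))"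
      using smult \<phi> by (simp add: P.A.smult_mult_right central_form_def)
  qed
  then show ?case using smult by simp
next
  case zero
  have "\<phi> (br Q \<otimes>\<^bsub>\<mu>\<^esub> \<zero>\<^bsub>\<mu>\<^esub>) = 0" if "Q \<in> \<Q>" for Q
    using br_closed[OF \<Q>[OF that]] central_form_zero[OF \<phi>] by simp
  then show ?case by simp
qed

section \<open>Contradiction modulo a prime whose square divides the order\<close>

lemma conjugacy_equiv:
  assumes \<Q>: "\<And>Q. Q \<in> \<Q> \<Longrightarrow> subgroup Q G"
  shows "equiv \<Q> {(Q, Q'). Q \<in> \<Q> \<and> Q' \<in> \<Q> \<and> (\<exists>a\<in>carrier G. conjugate G a Q = Q')}" (is "equiv _ ?r")
proof (rule equivI)
  note sub = subgroup.subset[OF \<Q>]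
  show "refl_on \<Q> ?r"
  proof (rule refl_onI)
    fix Q assume Q: "Q \<in> \<Q>"
    then show "(Q, Q) \<in> ?r" using conjugate_one[OF sub[OF Q]] by blast
  qed
  show "sym ?r"
  proof (rule symI)
    fix Q Q' assume "(Q, Q') \<in> ?r"
    then obtain a where a: "Q \<in> \<Q>" "Q' \<in> \<Q>" "a \<in> carrier G" "conjugate G a Q = Q'" by blast
    then have "conjugate G (inv a) Q' = Q" using conjugate_inv_cancel(1)[OF sub[OF a(1)] a(3)] by simp
    then show "(Q', Q) \<in> ?r" using a inv_closed[OF a(3)] by blast
  qed
  show "trans ?r"
  proof (rule transI)
    fix Q Q' Q'' assume "(Q, Q') \<in> ?r" "(Q', Q'') \<in> ?r"
    then obtain a b where ab: "Q \<in> \<Q>" "Q'' \<in> \<Q>" "a \<in> carrier G" "conjugate G a Q = Q'"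
      "b \<in> carrier G" "conjugate G b Q' = Q''" by blast
    then have "conjugate G (b \<otimes> a) Q = Q''"
      using conjugate_conjugate[OF sub[OF ab(1)] ab(5,3)] by simp
    then show "(Q, Q'') \<in> ?r" using ab m_closed[OF ab(5,3)] by blast
  qed
qed auto

text \<open>A symmetrizing form provides one central form \<phi> such that every central form \<psi>
  is \<phi> of the product with a fixed element \<open>a\<close>. Divisibility by \<open>p\<close>
  of \<phi> on the multiples of a corner element therefore passes to the value of every \<psi> at
  that element, and the coefficient forms refute this.\<close>

lemma not_symmetric:
  assumes p: "Factorial_Ring.prime (p::nat)" "p\<^sup>2 dvd order G"
  shows "\<not> symmetric_algebra \<Z> \<mu>"
proof
  assume "symmetric_algebra \<Z> \<mu>"
  then obtain \<beta> where bil: "bilinear_form \<Z> \<mu> \<beta>"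
    and assoc: "\<And>x y z. \<lbrakk>x \<in> carrier \<mu>; y \<in> carrier \<mu>; z \<in> carrier \<mu>\<rbrakk> \<Longrightarrow> \<beta> (x \<otimes>\<^bsub>\<mu>\<^esub> y) z = \<beta> x (y \<otimes>\<^bsub>\<mu>\<^esub> z)"
    and sym: "\<And>x y. \<lbrakk>x \<in> carrier \<mu>; y \<in> carrier \<mu>\<rbrakk> \<Longrightarrow> \<beta> x y = \<beta> y x"
    and nondeg: "nondegenerate_form \<Z> \<mu> \<beta>"
    unfolding symmetric_algebra_def by blast
  define \<phi> where "\<phi> x = \<beta> x \<one>\<^bsub>\<mu>\<^esub>" for x
  have \<phi>_mult: "\<phi> (x \<otimes>\<^bsub>\<mu>\<^esub> y) = \<beta> x y" if "x \<in> carrier \<mu>" "y \<in> carrier \<mu>" for x y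
    using that assoc[of x y "\<one>\<^bsub>\<mu>\<^esub>"] by (simp add: \<phi>_def)
  have hom: "(\<lambda>x\<in>carrier \<mu>. \<beta> x \<one>\<^bsub>\<mu>\<^esub>) \<in> module_hom \<Z> \<mu> (regular_module \<Z>)"
    using bil by (simp add: bilinear_form_def)
  have \<phi>: "central_form \<phi>"
    unfolding central_form_def
  proof (intro conjI ballI allI)
    fix x y assume "x \<in> carrier \<mu>" "y \<in> carrier \<mu>"
    then show "\<phi> (x \<oplus>\<^bsub>\<mu>\<^esub> y) = \<phi> x + \<phi> y" "\<phi> (x \<otimes>\<^bsub>\<mu>\<^esub> y) = \<phi> (y \<otimes>\<^bsub>\<mu>\<^esub> x)"
      using hom \<phi>_mult sym by (simp_all add: \<phi>_def module_hom_def regular_module_def)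
  next
    fix a x assume "x \<in> carrier \<mu>"
    then show "\<phi> (a \<odot>\<^bsub>\<mu>\<^esub> x) = a * \<phi> x"
      using hom by (simp add: \<phi>_def module_hom_def regular_module_def)
  qed
  have represent: "\<exists>a\<in>carrier \<mu>. \<forall>x\<in>carrier \<mu>. \<psi> x = \<phi> (x \<otimes>\<^bsub>\<mu>\<^esub> a)" if \<psi>: "central_form \<psi>" for \<psi>
  proof -
    have "restrict \<psi> (carrier \<mu>) \<in> carrier (hom_module \<Z> \<mu> (regular_module \<Z>))"
      using \<psi> by (simp add: central_form_def hom_module_def module_hom_def regular_module_def)
    also have "\<dots> = (\<lambda>x\<in>carrier \<mu>. \<lambda>y\<in>carrier \<mu>. \<beta> x y) ` carrier \<mu>"
      using nondeg by (simp add: nondegenerate_form_def module_iso_def bij_betw_def)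
    finally obtain a where "restrict \<psi> (carrier \<mu>) = (\<lambda>x\<in>carrier \<mu>. \<lambda>y\<in>carrier \<mu>. \<beta> x y) a" "a \<in> carrier \<mu>"
      by (rule imageE)
    then have a: "a \<in> carrier \<mu>" "restrict \<psi> (carrier \<mu>) = (\<lambda>y\<in>carrier \<mu>. \<beta> a y)" by simp_all
    have "\<psi> x = \<phi> (x \<otimes>\<^bsub>\<mu>\<^esub> a)" if x: "x \<in> carrier \<mu>" for x
      using fun_cong[OF a(2), of x] x a(1) \<phi>_mult[OF x a(1)] sym[OF x a(1)] by simp
    then show ?thesis using a(1) by blast
  qed
  obtain P where P: "subgroup P G" "card P = p\<^sup>2"
    using exists_subgroup_prime_power[OF fin subgroup_self p(1), of 2] p(2) by (auto simp: order_def)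
  let ?\<Q> = "{Q. subgroup Q G \<and> Q \<subseteq> P \<and> card Q = p}"
  have fin\<Q>: "finite ?\<Q>" by (rule finite_subset[OF _ finite_subgroups]) auto
  have p1: "p > 1" using prime_gt_1_nat[OF p(1)] .
  \<comment> \<open>In the notation of the overview this is the number \<phi>(u), and
    \<open>v\<close> below is the number \<phi>(v).\<close>
  define u where "u = \<phi> (br {\<one>})"
  have triv: "\<phi> (br {\<one>} \<otimes>\<^bsub>\<mu>\<^esub> br J) = int (card (lcosets J)) * u" if J: "subgroup J G" for J
  proof -
    have "\<one> <# C = C" if "C \<in> lcosets J" for C by (rule lcos_mult_one[OF lcoset_carrier[OF J that]])
    then have eq: "{C \<in> lcosets J. \<forall>q\<in>{\<one>}. q <# C = C} = lcosets J"
      "{C \<in> lcosets J. \<not> (\<forall>q\<in>{\<one>}. q <# C = C)} = {}"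
      by auto
    obtain k where "\<phi> (br {\<one>} \<otimes>\<^bsub>\<mu>\<^esub> br J) = int (card (lcosets J)) * u + k * u"
      "int (card ({} :: 'a set set)) = int (card {\<one>}) * k"
      using central_form_br_mult[OF \<phi> triv_subgroup disjI1[OF refl] J]
      unfolding eq u_def[symmetric] by (elim exE conjE)
    then show ?thesis by simp
  qed
  have br_coeff: "\<psi> (br J) = of_bool (\<exists>a\<in>carrier G. conjugate G a J = L)"
    if "subgroup J G" "\<And>H K g J. admissible H K g J \<Longrightarrow>
      \<psi> (bas H K g J) = of_bool (H = K \<and> g \<in> H \<and> (\<exists>a\<in>carrier G. conjugate G a J = L))" for \<psi> J L
    unfolding br_def using that(2)[OF br_admissible[OF that(1)]] by simp
  show False
  proof (cases "int p dvd u")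
    case True
    \<comment> \<open>Here \<phi> is divisible by \<open>p\<close> on all multiples of
      \<open>br {\<one>}\<close>, whereas the coefficient form of the trivial subgroup has the value
      1 at this element.\<close>
    obtain \<psi> where \<psi>: "central_form \<psi>" "\<And>H K g J. admissible H K g J \<Longrightarrow>
        \<psi> (bas H K g J) = of_bool (H = K \<and> g \<in> H \<and> (\<exists>a\<in>carrier G. conjugate G a J = {\<one>}))"
      using exists_coefficient_form[OF triv_subgroup] by blast
    obtain a where a: "a \<in> carrier \<mu>" "\<And>x. x \<in> carrier \<mu> \<Longrightarrow> \<psi> x = \<phi> (x \<otimes>\<^bsub>\<mu>\<^esub> a)"
      using represent[OF \<psi>(1)] by blast
    have "int p dvd (\<Sum>Q\<in>{{\<one>}}. 1 * \<phi> (br Q \<otimes>\<^bsub>\<mu>\<^esub> a))"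
      by (rule corner_dvd[OF \<phi> _ _ _ a(1)]) (use triv_subgroup triv True in auto)
    then have "int p dvd \<psi> (br {\<one>})" using a(2)[OF br_closed[OF triv_subgroup]] by simp
    moreover have "\<psi> (br {\<one>}) = 1"
      using br_coeff[OF triv_subgroup \<psi>(2)] conjugate_one[of "{\<one>}"] by auto
    ultimately show False using p1 by simp
  next
    case False
    define v where "v = (\<Sum>Q\<in>?\<Q>. \<phi> (br Q))"
    have one\<Q>: "{\<one>} \<notin> ?\<Q>" using p1 by auto
    \<comment> \<open>The coefficients of \<phi>(v) u - \<phi>(u) v, chosen so that \<phi> vanishes
      at this combination itself.\<close>
    define c where "c Q = (if Q = {\<one>} then v else - u)" for Q
    have dvd: "int p dvd (\<Sum>Q\<in>insert {\<one>} ?\<Q>. c Q * \<phi> (br Q \<otimes>\<^bsub>\<mu>\<^esub> br J))" if J: "subgroup J G" for J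
    proof -
      let ?f = "\<lambda>Q. int (card {C \<in> lcosets J. \<forall>q\<in>Q. q <# C = C})"
        and ?m = "\<lambda>Q. int (card {C \<in> lcosets J. \<not> (\<forall>q\<in>Q. q <# C = C)})"
      let ?n = "int (card (lcosets J))"
      have finJ: "finite (lcosets J)" by (rule finite_lcosets[OF J])
      have fm: "?f Q + ?m Q = ?n" for Q
      proof -
        have "lcosets J = {C \<in> lcosets J. \<forall>q\<in>Q. q <# C = C} \<union> {C \<in> lcosets J. \<not> (\<forall>q\<in>Q. q <# C = C)}" by blast
        then have "card (lcosets J) =
            card ({C \<in> lcosets J. \<forall>q\<in>Q. q <# C = C} \<union> {C \<in> lcosets J. \<not> (\<forall>q\<in>Q. q <# C = C)})" by simp
        also have "\<dots> = card {C \<in> lcosets J. \<forall>q\<in>Q. q <# C = C} + card {C \<in> lcosets J. \<not> (\<forall>q\<in>Q. q <# C = C)}"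
          using finJ by (intro card_Un_disjoint) auto
        finally show ?thesis by simp
      qed
      have "\<forall>Q\<in>?\<Q>. \<exists>k. \<phi> (br Q \<otimes>\<^bsub>\<mu>\<^esub> br J) = ?f Q * \<phi> (br Q) + k * u \<and> ?m Q = int p * k"
      proof
        fix Q assume Q: "Q \<in> ?\<Q>"
        then have "subgroup Q G" "Q = {\<one>} \<or> Factorial_Ring.prime (card Q)" "card Q = p" using p(1) by auto
        then show "\<exists>k. \<phi> (br Q \<otimes>\<^bsub>\<mu>\<^esub> br J) = ?f Q * \<phi> (br Q) + k * u \<and> ?m Q = int p * k"
          using central_form_br_mult[OF \<phi> _ _ J, of Q] unfolding u_def by simp
      qed
      from bchoice[OF this] obtain k where k:
        "\<forall>Q\<in>?\<Q>. \<phi> (br Q \<otimes>\<^bsub>\<mu>\<^esub> br J) = ?f Q * \<phi> (br Q) + k Q * u \<and> ?m Q = int p * k Q" by (rule exE)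
      \<comment> \<open>Modulo \<open>p\<close> the number of fixed cosets becomes
        \<open>?n\<close>, independent of \<open>Q\<close>; the terms with factor \<open>?n\<close>
        then cancel in the combination given by \<open>c\<close>.\<close>
      have k1: "\<phi> (br Q \<otimes>\<^bsub>\<mu>\<^esub> br J) = (?n - int p * k Q) * \<phi> (br Q) + k Q * u" if "Q \<in> ?\<Q>" for Q
      proof -
        have kQ: "\<phi> (br Q \<otimes>\<^bsub>\<mu>\<^esub> br J) = ?f Q * \<phi> (br Q) + k Q * u" "?m Q = int p * k Q"
          using bspec[OF k that] by simp_all
        have "?f Q = ?n - int p * k Q" using fm[of Q] unfolding kQ(2) by linarith
        then show ?thesis using kQ(1) by simp
      qed
      \<comment> \<open>A single \<open>k Q\<close> need not be divisible by \<open>p\<close>; the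
        sum over all \<open>Q\<close> is.\<close>
      have "int (p\<^sup>2) dvd int (\<Sum>Q\<in>?\<Q>. card {C \<in> lcosets J. \<not> (\<forall>q\<in>Q. q <# C = C)})"
        using sum_moved_cosets[OF P p(1) J] by (simp only: of_nat_dvd_iff)
      also have "int (\<Sum>Q\<in>?\<Q>. card {C \<in> lcosets J. \<not> (\<forall>q\<in>Q. q <# C = C)}) = (\<Sum>Q\<in>?\<Q>. ?m Q)" by simp
      also have "\<dots> = (\<Sum>Q\<in>?\<Q>. int p * k Q)" by (rule sum.cong[OF refl]) (rule conjunct2[OF bspec[OF k]])
      also have "\<dots> = int p * (\<Sum>Q\<in>?\<Q>. k Q)" by (simp add: sum_distrib_left)
      finally have "int p * int p dvd int p * (\<Sum>Q\<in>?\<Q>. k Q)" by (simp add: power2_eq_square)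
      then have pk: "int p dvd (\<Sum>Q\<in>?\<Q>. k Q)" using p1 by simp
      have c\<Q>: "c Q = - u" if "Q \<in> ?\<Q>" for Q using that one\<Q> by (auto simp: c_def)
      have "(\<Sum>Q\<in>insert {\<one>} ?\<Q>. c Q * \<phi> (br Q \<otimes>\<^bsub>\<mu>\<^esub> br J)) =
          v * (?n * u) + (\<Sum>Q\<in>?\<Q>. c Q * \<phi> (br Q \<otimes>\<^bsub>\<mu>\<^esub> br J))"
        using fin\<Q> one\<Q> by (subst sum.insert) (simp_all add: c_def triv[OF J])
      also have "(\<Sum>Q\<in>?\<Q>. c Q * \<phi> (br Q \<otimes>\<^bsub>\<mu>\<^esub> br J)) =
          (\<Sum>Q\<in>?\<Q>. - u * ?n * \<phi> (br Q) + int p * (u * k Q * \<phi> (br Q)) + (- u * u) * k Q)"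
        by (rule sum.cong[OF refl]) (simp only: c\<Q> k1, simp add: algebra_simps)
      also have "\<dots> = - u * ?n * v + int p * (\<Sum>Q\<in>?\<Q>. u * k Q * \<phi> (br Q)) + (- u * u) * (\<Sum>Q\<in>?\<Q>. k Q)"
        unfolding v_def by (simp only: sum.distrib sum_distrib_left)
      finally have "(\<Sum>Q\<in>insert {\<one>} ?\<Q>. c Q * \<phi> (br Q \<otimes>\<^bsub>\<mu>\<^esub> br J)) =
          int p * (\<Sum>Q\<in>?\<Q>. u * k Q * \<phi> (br Q)) + (- u * u) * (\<Sum>Q\<in>?\<Q>. k Q)"
        by (simp add: algebra_simps)
      then show ?thesis using pk by simp
    qed
    let ?r = "{(Q, Q'). Q \<in> ?\<Q> \<and> Q' \<in> ?\<Q> \<and> (\<exists>a\<in>carrier G. conjugate G a Q = Q')}"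
    have equiv: "equiv ?\<Q> ?r" by (rule conjugacy_equiv) simp
    \<comment> \<open>The number of all these subgroups is prime to \<open>p\<close>, so the same
      holds for some class of subgroups conjugate in \<open>G\<close>. The coefficient form of that
      class detects the combination modulo \<open>p\<close>.\<close>
    have "\<not> p dvd card ?\<Q>" using card_prime_square_subgroups[OF P p(1)] by (simp add: dvd_eq_mod_eq_0)
    then obtain Y where Y: "Y \<in> ?\<Q> // ?r" "\<not> p dvd card Y"
      using equiv_imp_dvd_card[OF fin\<Q> equiv] by blast
    then obtain L where L: "L \<in> ?\<Q>" "Y = ?r `` {L}" by (auto elim: quotientE)
    have YL: "Y = {Q \<in> ?\<Q>. \<exists>a\<in>carrier G. conjugate G a Q = L}"
    proof (rule Set.set_eqI)
      fix Q
      have "sym ?r" using equiv by (rule equivE)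
      then have "(L, Q) \<in> ?r \<longleftrightarrow> (Q, L) \<in> ?r" by (intro iffI) (erule (1) symD)+
      then show "Q \<in> Y \<longleftrightarrow> Q \<in> {Q \<in> ?\<Q>. \<exists>a\<in>carrier G. conjugate G a Q = L}"
        unfolding L(2) Image_singleton_iff using L(1) by simp
    qed
    obtain \<psi> where \<psi>: "central_form \<psi>" "\<And>H K g J. admissible H K g J \<Longrightarrow>
        \<psi> (bas H K g J) = of_bool (H = K \<and> g \<in> H \<and> (\<exists>a\<in>carrier G. conjugate G a J = L))"
      using exists_coefficient_form[of L] L(1) by blast
    obtain a where a: "a \<in> carrier \<mu>" "\<And>x. x \<in> carrier \<mu> \<Longrightarrow> \<psi> x = \<phi> (x \<otimes>\<^bsub>\<mu>\<^esub> a)"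
      using represent[OF \<psi>(1)] by blast
    have sub: "subgroup Q G" if "Q \<in> insert {\<one>} ?\<Q>" for Q using that triv_subgroup by auto
    have "int p dvd (\<Sum>Q\<in>insert {\<one>} ?\<Q>. c Q * \<phi> (br Q \<otimes>\<^bsub>\<mu>\<^esub> a))"
      by (rule corner_dvd[OF \<phi> _ sub dvd a(1)]) (use fin\<Q> in simp)
    also have "(\<Sum>Q\<in>insert {\<one>} ?\<Q>. c Q * \<phi> (br Q \<otimes>\<^bsub>\<mu>\<^esub> a)) = (\<Sum>Q\<in>insert {\<one>} ?\<Q>. c Q * \<psi> (br Q))"
      by (rule sum.cong[OF refl]) (simp only: a(2)[OF br_closed[OF sub]])
    also have "\<dots> = v * \<psi> (br {\<one>}) + (\<Sum>Q\<in>?\<Q>. c Q * \<psi> (br Q))"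
      using fin\<Q> one\<Q> by (subst sum.insert) (simp_all add: c_def)
    \<comment> \<open>\<open>L\<close> has order \<open>p\<close>, so it is not conjugate to the
      trivial subgroup and only the part with coefficient \<open>- u\<close> survives.\<close>
    also have "\<psi> (br {\<one>}) = 0"
    proof -
      have "conjugate G b {\<one>} \<noteq> L" if "b \<in> carrier G" for b
        using card_conjugate[of "{\<one>}" b] that L(1) p1 by auto
      then show ?thesis using br_coeff[OF triv_subgroup \<psi>(2)] by simp
    qed
    also have "(\<Sum>Q\<in>?\<Q>. c Q * \<psi> (br Q)) = (\<Sum>Q\<in>?\<Q>. - u * of_bool (Q \<in> Y))"
    proof (rule sum.cong[OF refl])
      fix Q assume Q: "Q \<in> ?\<Q>"
      then have "c Q = - u" using one\<Q> by (auto simp: c_def)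
      moreover have "\<psi> (br Q) = of_bool (Q \<in> Y)"
        using br_coeff[OF _ \<psi>(2), of Q] Q unfolding YL by simp
      ultimately show "c Q * \<psi> (br Q) = - u * of_bool (Q \<in> Y)" by simp
    qed
    also have "\<dots> = - u * (\<Sum>Q\<in>?\<Q>. of_bool (Q \<in> Y))" by (simp only: sum_distrib_left)
    also have "(\<Sum>Q\<in>?\<Q>. of_bool (Q \<in> Y)) = int (card Y)"
    proof -
      have "?\<Q> \<inter> {Q. Q \<in> Y} = Y" unfolding YL by blast
      then show ?thesis using fin\<Q> by (simp only: sum_of_bool_eq)
    qed
    finally have "int p dvd u * int (card Y)" by simp
    then have "int p dvd u \<or> int p dvd int (card Y)"
      using p(1) by (intro prime_dvd_multD) simp_all
    then show False using False Y(2) by simp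
  qed
qed

end

theorem theorem3p8:
  fixes G :: "('g, 'm) monoid_scheme"
  assumes "group G" and "finite (carrier G)"
  shows "symmetric_algebra \<Z> (mackey_algebra \<Z> G) \<longleftrightarrow>
    (\<forall>p :: nat. Factorial_Ring.prime p \<longrightarrow> \<not> p\<^sup>2 dvd order G)"
proof -
  interpret finite_group G
    using assms by (simp add: finite_group_def finite_group_axioms_def)
  show ?thesis
    unfolding mackey_algebra_eq
  proof
    assume "symmetric_algebra \<Z> \<mu>"
    then show "\<forall>p::nat. Factorial_Ring.prime p \<longrightarrow> \<not> p\<^sup>2 dvd order G"
      using not_symmetric by blast
  next
    assume "\<forall>p::nat. Factorial_Ring.prime p \<longrightarrow> \<not> p\<^sup>2 dvd order G"
    then interpret squarefree_group G by unfold_locales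
    show "symmetric_algebra \<Z> \<mu>" by (rule mackey_symmetric)
  qed
qed

end
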